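(* Let $Q=[u_1,\dots,u_n]\subset\mathbb{S}^2$ with $n\ge 6$ be a spherical polygon in balanced position (i.e. its vertices are not all contained in any closed hemisphere). If $Q$ has no self-intersections and no antipodal intersections, then $Q$ has at least six (spherical) inflections.
   Context: A spherical polygon $Q=[u_1,\dots,u_n]$ is a cyclic sequence of points of $\mathbb{S}^2$ (indices mod $n$) whose edges are the minimal great-circle arcs from $u_i$ to $u_{i+1}$. Standing assumption: no three vertices of $Q$ lie on a common great circle (equivalently, any three vertices are linearly independent in $\mathbb{R}^3$). $Q$ has a self-intersection at two non-adjacent edges if these two arcs intersect; it has an antipodal intersection at two non-adjacent edges $e,f$ if $e$ intersects the antipodal arc $-f$. Writing $[a,b,c]$ for the determinant of $a,b,c\in\mathbb{R}^3$, the pair $\{u_i,u_{i+1}\}$ is a (spherical) inflection if $[u_{i-1},u_i,u_{i+1}]$ and $[u_i,u_{i+1},u_{i+2}]$ have opposite signs. *)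

theory Defs
  imports "HOL-Analysis.Analysis"
begin

text \<open>A spherical polygon with n vertices is given by u :: nat => real^3, using the
  vertices u 0, ..., u (n-1); indices are taken mod n.\<close>

definition det3 :: "real^3 \<Rightarrow> real^3 \<Rightarrow> real^3 \<Rightarrow> real" where
  "det3 a b c = det (vector [a, b, c] :: real^3^3)"

definition vtx :: "(nat \<Rightarrow> real^3) \<Rightarrow> nat \<Rightarrow> nat \<Rightarrow> real^3" where
  "vtx u n i = u (i mod n)"

text \<open>Minimal great-circle arc from a to b (a, b unit vectors, not antipodal):
  the radial projection of the chord segment onto the sphere.\<close>
definition sph_arc :: "real^3 \<Rightarrow> real^3 \<Rightarrow> (real^3) set" where
  "sph_arc a b = {x. \<exists>t\<in>{0..1}. x = sgn ((1 - t) *\<^sub>R a + t *\<^sub>R b)}"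

definition edge :: "(nat \<Rightarrow> real^3) \<Rightarrow> nat \<Rightarrow> nat \<Rightarrow> (real^3) set" where
  "edge u n i = sph_arc (vtx u n i) (vtx u n (i + 1))"

definition nonadjacent :: "nat \<Rightarrow> nat \<Rightarrow> nat \<Rightarrow> bool" where
  "nonadjacent n i j \<longleftrightarrow> i < n \<and> j < n \<and> i \<noteq> j \<and> (i + 1) mod n \<noteq> j \<and> (j + 1) mod n \<noteq> i"

definition spherical_polygon :: "(nat \<Rightarrow> real^3) \<Rightarrow> nat \<Rightarrow> bool" where
  "spherical_polygon u n \<longleftrightarrow> (\<forall>i<n. norm (u i) = 1)"

text \<open>Standing assumption: any three vertices are linearly independent.\<close>
definition general_position :: "(nat \<Rightarrow> real^3) \<Rightarrow> nat \<Rightarrow> bool" where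
  "general_position u n \<longleftrightarrow>
     (\<forall>i<n. \<forall>j<n. \<forall>k<n. i \<noteq> j \<and> j \<noteq> k \<and> i \<noteq> k \<longrightarrow> det3 (u i) (u j) (u k) \<noteq> 0)"

definition balanced :: "(nat \<Rightarrow> real^3) \<Rightarrow> nat \<Rightarrow> bool" where
  "balanced u n \<longleftrightarrow> \<not> (\<exists>v::real^3. v \<noteq> 0 \<and> (\<forall>i<n. v \<bullet> u i \<ge> 0))"

definition has_self_intersection :: "(nat \<Rightarrow> real^3) \<Rightarrow> nat \<Rightarrow> bool" where
  "has_self_intersection u n \<longleftrightarrow>
     (\<exists>i j. nonadjacent n i j \<and> edge u n i \<inter> edge u n j \<noteq> {})"

definition has_antipodal_intersection :: "(nat \<Rightarrow> real^3) \<Rightarrow> nat \<Rightarrow> bool" where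
  "has_antipodal_intersection u n \<longleftrightarrow>
     (\<exists>i j. nonadjacent n i j \<and> edge u n i \<inter> uminus ` edge u n j \<noteq> {})"

definition inflection :: "(nat \<Rightarrow> real^3) \<Rightarrow> nat \<Rightarrow> nat \<Rightarrow> bool" where
  "inflection u n i \<longleftrightarrow>
     (let a = det3 (vtx u n (i + n - 1)) (vtx u n i) (vtx u n (i + 1));
          b = det3 (vtx u n i) (vtx u n (i + 1)) (vtx u n (i + 2))
      in (a > 0 \<and> b < 0) \<or> (a < 0 \<and> b > 0))"

definition num_inflections :: "(nat \<Rightarrow> real^3) \<Rightarrow> nat \<Rightarrow> nat" where
  "num_inflections u n = card {i. i < n \<and> inflection u n i}"

end

theory Submission
  imports Defs
begin

text \<open>
  Call a vertex essential if all other vertices lie in a closed hemisphere, and argue by induction on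
  the number of vertices. If no vertex is essential, then some corner is an ear: no vertex of the
  polygon or of its antipode lies in the triangle spanned by the corner and its two neighbours.
  Otherwise take a shortest inner chord of the polygon or of its antipode. All turns of the closed
  polygon that it cuts off are negative, so this polygon is convex, and the remaining vertices lie
  in its cone, contradicting balance. Deleting an ear creates neither crossings nor sign
  changes of the turns, and it preserves balance because the deleted vertex is not essential.

  If a vertex \<open>z 0\<close> is essential, look at the polygon from \<open>w = - z 0\<close>. Around \<open>w\<close> the other
  vertices have an extreme one \<open>z l\<close> below the line through \<open>w\<close> and \<open>z 1\<close> and an extreme one \<open>z m\<close>
  above the line through \<open>w\<close> and \<open>z (n - 1)\<close>. Counting the edges of \<open>z 1, ..., z l\<close> that meet the
  arcs issuing from \<open>w\<close> shows that the turn at \<open>z l\<close> has the same sign as the one at \<open>z 0\<close> and that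
  \<open>l < m\<close>; by symmetry this holds for \<open>z m\<close> too. A simple locally convex path lies in an open
  hemisphere, so each of the three pieces of the polygon between \<open>z 0\<close>, \<open>z l\<close>, \<open>z m\<close> and \<open>z n\<close>
  has a turn of the opposite sign.
\<close>

subsection \<open>Determinants and crossing arcs\<close>

text \<open>The sides of a polygon are not taken from a separation theorem but computed: the number
  of edges met by an arc from a base point to a vertex, corrected by the side on which the arc
  reaches that corner, has a parity independent of the corner (\<open>side_parity\<close>). All such
  counts are sums of Pasch's theorem for triangles modulo 2. Pasch's theorem needs general position,
  hence the generic base points; the antipode of a vertex depends linearly on it, so arcs ending at
  antipodes require degenerate versions. Antipodes cannot be ignored: an ear must keep them out of
  its triangle as well, since otherwise the new edge could cross the antipodal polygon.

  The other constraint is balance. Ears are cut off only while no vertex is essential; a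
  quadrilateral always has an essential vertex, so the reduction stops there at the latest, and
  everything is stated for at least four vertices. Six is the number of sign changes in a cyclic
  alternation of three distinguished corners with three pieces.\<close>

lemma det3_expand:
  "det3 a b c = a$1 * (b$2 * c$3 - b$3 * c$2) - a$2 * (b$1 * c$3 - b$3 * c$1)
     + a$3 * (b$1 * c$2 - b$2 * c$1)"
  by (simp add: det3_def det_3 algebra_simps)

lemma det3_swap12: "det3 b a c = - det3 a b c"
  and det3_swap23: "det3 a c b = - det3 a b c"
  and det3_swap13: "det3 c b a = - det3 a b c"
  and det3_rot: "det3 b c a = det3 a b c"
  and det3_rot': "det3 c a b = det3 a b c"
  by (simp_all add: det3_expand algebra_simps)

lemma det3_same [simp]: "det3 a a c = 0" "det3 a c a = 0" "det3 c a a = 0"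
  by (simp_all add: det3_expand algebra_simps)

lemma det3_zero [simp]: "det3 0 b c = 0" "det3 a 0 c = 0" "det3 a b 0 = 0"
  by (simp_all add: det3_expand)

lemma det3_minus [simp]:
  "det3 (- a) b c = - det3 a b c" "det3 a (- b) c = - det3 a b c" "det3 a b (- c) = - det3 a b c"
  by (simp_all add: det3_expand algebra_simps)

lemma det3_add:
  "det3 (a + a') b c = det3 a b c + det3 a' b c"
  "det3 a (b + b') c = det3 a b c + det3 a b' c"
  "det3 a b (c + c') = det3 a b c + det3 a b c'"
  by (simp_all add: det3_expand algebra_simps)

lemma det3_scaleR:
  "det3 (x *\<^sub>R a) b c = x * det3 a b c"
  "det3 a (x *\<^sub>R b) c = x * det3 a b c"
  "det3 a b (x *\<^sub>R c) = x * det3 a b c"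
  by (simp_all add: det3_expand algebra_simps)

text \<open>The linear dependence of four vectors in space. With known signs of the determinants it
  tells which of the vectors is a positive combination of which others.\<close>

lemma det3_cramer:
  "det3 b c d *\<^sub>R a - det3 a c d *\<^sub>R b + det3 a b d *\<^sub>R c - det3 a b c *\<^sub>R d = 0"
  by (simp add: vec_eq_iff forall_3 det3_expand algebra_simps)

lemma det3_pluecker:
  "det3 q a b * det3 q c d - det3 q a c * det3 q b d + det3 q a d * det3 q b c = 0"
  by (simp add: det3_expand algebra_simps)

text \<open>The open cones over the two arcs meet; see \<open>crossesI\<close> and \<open>crossesE\<close>.\<close>
definition crosses :: "real^3 \<Rightarrow> real^3 \<Rightarrow> real^3 \<Rightarrow> real^3 \<Rightarrow> bool" where
  "crosses a b c d \<longleftrightarrow> det3 a c d * det3 b c d < 0 \<and> det3 a b c * det3 a b d < 0 \<and>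
     det3 a b c * det3 b c d > 0"

text \<open>Dividing by \<open>det3 p q r\<close> would give the coordinates of \<open>z\<close> in
  the basis \<open>p, q, r\<close>. Products in place of quotients keep the condition independent of
  the orientation of the triangle.\<close>

definition in_cone :: "real^3 \<Rightarrow> real^3 \<Rightarrow> real^3 \<Rightarrow> real^3 \<Rightarrow> bool" where
  "in_cone z p q r \<longleftrightarrow> det3 z q r * det3 p q r > 0 \<and> det3 p z r * det3 p q r > 0 \<and>
     det3 p q z * det3 p q r > 0"

lemma mult_sign_iff:
  fixes a b :: real
  assumes "a \<noteq> 0" "b \<noteq> 0"
  shows "0 < a * b \<longleftrightarrow> (0 < a) = (0 < b)" "a * b < 0 \<longleftrightarrow> (0 < a) \<noteq> (0 < b)"
  using assms by (auto simp: zero_less_mult_iff mult_less_0_iff)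

text \<open>Three terms with sum zero cannot all have the same strict sign. In Boolean form each
  three-term relation becomes a propositional constraint on orientations.\<close>

lemma pluecker_sign:
  fixes x y z w u v :: real
  assumes "x * y - z * w + u * v = 0" "x \<noteq> 0" "y \<noteq> 0" "z \<noteq> 0" "w \<noteq> 0" "u \<noteq> 0" "v \<noteq> 0"
  shows "\<not> ((0 < x) = (0 < y) \<and> (0 < z) \<noteq> (0 < w) \<and> (0 < u) = (0 < v)) \<and>
         \<not> ((0 < x) \<noteq> (0 < y) \<and> (0 < z) = (0 < w) \<and> (0 < u) \<noteq> (0 < v))"
proof -
  have "\<not> (0 < x * y \<and> z * w < 0 \<and> 0 < u * v) \<and> \<not> (x * y < 0 \<and> 0 < z * w \<and> u * v < 0)"
    using assms(1) by linarith
  then show ?thesis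
    unfolding mult_sign_iff[OF assms(2,3)] mult_sign_iff[OF assms(4,5)] mult_sign_iff[OF assms(6,7)] .
qed

lemma crosses_iff:
  assumes "det3 a b c \<noteq> 0" "det3 a b d \<noteq> 0" "det3 a c d \<noteq> 0" "det3 b c d \<noteq> 0"
  shows "crosses a b c d \<longleftrightarrow> (0 < det3 a c d) \<noteq> (0 < det3 b c d) \<and>
    (0 < det3 a b c) \<noteq> (0 < det3 a b d) \<and> (0 < det3 a b c) = (0 < det3 b c d)"
  unfolding crosses_def by (simp only: mult_sign_iff assms not_False_eq_True)

lemma in_cone_iff:
  assumes "det3 z q r \<noteq> 0" "det3 p z r \<noteq> 0" "det3 p q z \<noteq> 0" "det3 p q r \<noteq> 0"
  shows "in_cone z p q r \<longleftrightarrow> (0 < det3 z q r) = (0 < det3 p q r) \<and>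
    (0 < det3 p z r) = (0 < det3 p q r) \<and> (0 < det3 p q z) = (0 < det3 p q r)"
  unfolding in_cone_def by (simp only: mult_sign_iff assms not_False_eq_True)

lemma crosses_commute: "crosses c d a b \<longleftrightarrow> crosses a b c d"
proof -
  have e: "det3 c d a = det3 a c d" "det3 c d b = det3 b c d" "det3 c a b = det3 a b c" "det3 d a b = det3 a b d"
    by (simp_all add: det3_expand algebra_simps)
  have **: "(z * w < 0 \<and> x * y < 0 \<and> 0 < x * w) = (x * y < 0 \<and> z * w < 0 \<and> (0::real) < z * y)" for x y z w :: real
    by (simp add: zero_less_mult_iff mult_less_0_iff) argo
  show ?thesis
    unfolding crosses_def e using ** by blast
qed

lemma crosses_flip1: "crosses b a c d \<longleftrightarrow> crosses a b c d"
proof -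
  have **: "(y * x < 0 \<and> - z * - w < 0 \<and> 0 < - z * x) = (x * y < 0 \<and> z * w < 0 \<and> (0::real) < z * y)" for x y z w :: real
    by (simp add: zero_less_mult_iff mult_less_0_iff) argo
  show ?thesis
    unfolding crosses_def det3_swap12[of b a] ** by (rule refl)
qed

lemma crosses_flip2: "crosses a b d c \<longleftrightarrow> crosses a b c d"
  using crosses_commute crosses_flip1 by metis

text \<open>The letters are signs: \<open>A\<close> of \<open>det3 p q r\<close>;
  \<open>c1, c2, c3\<close> and \<open>d1, d2, d3\<close> of the sides \<open>q r\<close>,
  \<open>p r\<close>, \<open>p q\<close> with \<open>c\<close> and with \<open>d\<close>;
  \<open>m1, m2, m3\<close> of \<open>p, q, r\<close> with the arc \<open>c d\<close>. The
  assumptions are five three-term relations.\<close>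

lemma pasch_bool:
  fixes A c1 c2 c3 d1 d2 d3 m1 m2 m3 :: bool
  assumes "\<not> ((A = m1) \<and> c3 \<noteq> d2 \<and> d3 = c2) \<and> \<not> ((A \<noteq> m1) \<and> c3 = d2 \<and> d3 \<noteq> c2)"
    "\<not> ((A = m2) \<and> c3 \<noteq> d1 \<and> d3 = c1) \<and> \<not> ((A \<noteq> m2) \<and> c3 = d1 \<and> d3 \<noteq> c1)"
    "\<not> ((A = m3) \<and> c2 \<noteq> d1 \<and> d2 = c1) \<and> \<not> ((A \<noteq> m3) \<and> c2 = d1 \<and> d2 \<noteq> c1)"
    "\<not> ((c3 = m3) \<and> c2 \<noteq> m2 \<and> m1 = c1) \<and> \<not> ((c3 \<noteq> m3) \<and> c2 = m2 \<and> m1 \<noteq> c1)"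
    "\<not> ((d3 = m3) \<and> d2 \<noteq> m2 \<and> m1 = d1) \<and> \<not> ((d3 \<noteq> m3) \<and> d2 = m2 \<and> m1 \<noteq> d1)"
  shows "even (of_bool (m1 \<noteq> m2 \<and> c3 \<noteq> d3 \<and> c3 = m2) + of_bool (m2 \<noteq> m3 \<and> c1 \<noteq> d1 \<and> c1 = m3)
     + of_bool (m1 \<noteq> m3 \<and> c2 \<noteq> d2 \<and> c2 = m3)
     + of_bool (c1 = A \<and> c2 \<noteq> A \<and> c3 = A) + of_bool (d1 = A \<and> d2 \<noteq> A \<and> d3 = A) :: nat)"
proof -
  have even5: "even (of_bool a + of_bool b + of_bool c + of_bool d + of_bool e :: nat) \<longleftrightarrow>
    (a \<longleftrightarrow> (b \<longleftrightarrow> (c \<longleftrightarrow> (d \<longleftrightarrow> \<not> e))))" for a b c d e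
    by (cases a; cases b; cases c; cases d; cases e) simp_all
  show ?thesis unfolding even5 using assms by argo
qed

text \<open>Pasch's theorem modulo 2: the number of sides met by an arc has the parity of the number
  of its ends inside the triangle.\<close>

lemma pasch:
  assumes nz: "det3 p q r \<noteq> 0"
    "det3 p q c \<noteq> 0" "det3 p r c \<noteq> 0" "det3 q r c \<noteq> 0"
    "det3 p q d \<noteq> 0" "det3 p r d \<noteq> 0" "det3 q r d \<noteq> 0"
    "det3 p c d \<noteq> 0" "det3 q c d \<noteq> 0" "det3 r c d \<noteq> 0"
  shows "even (of_bool (crosses p q c d) + of_bool (crosses q r c d) + of_bool (crosses p r c d)
     + of_bool (in_cone c p q r) + of_bool (in_cone d p q r) :: nat)"
proof -
  have pl: "det3 p q r * det3 p c d - det3 p q c * det3 p r d + det3 p q d * det3 p r c = 0"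
    "det3 p q r * det3 q c d - det3 p q c * det3 q r d + det3 p q d * det3 q r c = 0"
    "det3 p q r * det3 r c d - det3 p r c * det3 q r d + det3 p r d * det3 q r c = 0"
    "det3 p q c * det3 r c d - det3 p r c * det3 q c d + det3 p c d * det3 q r c = 0"
    "det3 p q d * det3 r c d - det3 p r d * det3 q c d + det3 p c d * det3 q r d = 0"
    by (simp_all add: det3_expand algebra_simps)
  have perm: "det3 c q r = det3 q r c" "det3 d q r = det3 q r d"
    "det3 p c r = - det3 p r c" "det3 p d r = - det3 p r d"
    by (simp_all add: det3_expand algebra_simps)
  have ic: "in_cone c p q r \<longleftrightarrow> (0 < det3 q r c) = (0 < det3 p q r) \<and> (0 < det3 p r c) \<noteq> (0 < det3 p q r) \<and> (0 < det3 p q c) = (0 < det3 p q r)"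
    "in_cone d p q r \<longleftrightarrow> (0 < det3 q r d) = (0 < det3 p q r) \<and> (0 < det3 p r d) \<noteq> (0 < det3 p q r) \<and> (0 < det3 p q d) = (0 < det3 p q r)"
    unfolding in_cone_def perm using nz by (simp_all add: mult_sign_iff)
  show ?thesis unfolding ic crosses_iff[OF nz(2) nz(5) nz(8) nz(9)]
      crosses_iff[OF nz(4) nz(7) nz(9) nz(10)] crosses_iff[OF nz(3) nz(6) nz(8) nz(10)]
    by (rule pasch_bool) (use pluecker_sign[OF pl(1)] pluecker_sign[OF pl(2)] pluecker_sign[OF pl(3)]
      pluecker_sign[OF pl(4)] pluecker_sign[OF pl(5)] nz in blast)+
qed

text \<open>\<open>y\<close> lies to the left of the path \<open>p, q, r\<close> at its corner \<open>q\<close>.\<close>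
definition left_of :: "real^3 \<Rightarrow> real^3 \<Rightarrow> real^3 \<Rightarrow> real^3 \<Rightarrow> bool" where
  "left_of p q r y \<longleftrightarrow> (if 0 < det3 p q r then 0 < det3 p q y \<and> 0 < det3 q r y
     else 0 < det3 p q y \<or> 0 < det3 q r y)"

text \<open>Seen from \<open>q\<close>, the direction of \<open>z\<close> lies in the convex angle
  between the directions of \<open>w\<close> and \<open>y\<close>.\<close>

definition sector :: "real^3 \<Rightarrow> real^3 \<Rightarrow> real^3 \<Rightarrow> real^3 \<Rightarrow> bool" where
  "sector q z w y \<longleftrightarrow> (0 < det3 q w z) = (0 < det3 q w y) \<and> (0 < det3 q z y) = (0 < det3 q w y)"

text \<open>The arc from \<open>w\<close> to \<open>y\<close> divides the lune over the angle at
  \<open>q\<close> into the triangle and a part that is reached from \<open>q\<close> only across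
  the arc. This handles edges that end at a corner of the triangle, where Pasch's theorem
  degenerates.\<close>

lemma sector_iff:
  assumes "det3 q w y \<noteq> 0" "det3 q w z \<noteq> 0" "det3 q z y \<noteq> 0" "det3 w z y \<noteq> 0"
  shows "(of_bool (in_cone z w q y) + of_bool (crosses q z w y) :: nat) = of_bool (sector q z w y)"
proof -
  have e: "det3 z q y = - det3 q z y" "det3 w q y = - det3 q w y" "det3 w q z = - det3 q w z"
    "det3 z w y = - det3 w z y" "det3 q z w = - det3 q w z"
    by (simp_all add: det3_expand algebra_simps)
  have ob: "(of_bool P + of_bool Q :: nat) = of_bool R" if "(P \<or> Q) = R" "\<not> (P \<and> Q)" for P Q R
    using that by auto
  show ?thesis
    apply (rule ob)
    unfolding in_cone_def crosses_def sector_def e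
    using assms by (simp_all add: mult_sign_iff) argo+
qed

text \<open>Turning about \<open>q\<close> from \<open>w\<close> to \<open>y\<close> changes the
  side once for each leg of the corner that is swept over.\<close>

lemma left_of_change:
  assumes "det3 q p r \<noteq> 0" "det3 q p w \<noteq> 0" "det3 q p y \<noteq> 0" "det3 q r w \<noteq> 0" "det3 q r y \<noteq> 0" "det3 q w y \<noteq> 0"
  shows "left_of p q r w \<noteq> left_of p q r y \<longleftrightarrow> sector q r w y \<noteq> sector q p w y"
proof -
  have e: "det3 p q r = - det3 q p r" "det3 p q w = - det3 q p w" "det3 p q y = - det3 q p y"
     "det3 q w r = - det3 q r w" "det3 q w p = - det3 q p w"
    by (simp_all add: det3_expand algebra_simps)
  show ?thesis
    using pluecker_sign[OF det3_pluecker[of q p r w y]] assms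
    unfolding left_of_def sector_def e by argo
qed

text \<open>The borderline case of \<open>left_of_change\<close> in which \<open>y\<close> moves
  onto a leg: the orientation of the leg and \<open>w\<close> takes the place of the side of
  \<open>y\<close>. \<open>left_of_sector2\<close> is the same for the other leg.\<close>

lemma left_of_sector1:
  assumes "det3 q p r \<noteq> 0" "det3 q p w \<noteq> 0" "det3 q r w \<noteq> 0"
  shows "left_of p q r w \<longleftrightarrow> (0 < det3 q r w) \<noteq> sector q p w r"
proof -
  have e: "det3 p q r = - det3 q p r" "det3 p q w = - det3 q p w" "det3 q w r = - det3 q r w" "det3 q w p = - det3 q p w"
    by (simp_all add: det3_expand algebra_simps)
  show ?thesis using assms unfolding left_of_def sector_def e by argo
qed

lemma left_of_sector2:
  assumes "det3 q p r \<noteq> 0" "det3 q p w \<noteq> 0" "det3 q r w \<noteq> 0"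
  shows "left_of p q r w \<longleftrightarrow> (0 < det3 p q w) \<noteq> sector q r w p"
proof -
  have e: "det3 p q r = - det3 q p r" "det3 p q w = - det3 q p w" "det3 q w r = - det3 q r w" "det3 q w p = - det3 q p w"
     "det3 q r p = - det3 q p r"
    by (simp_all add: det3_expand algebra_simps)
  show ?thesis using assms unfolding left_of_def sector_def e by argo
qed

lemma left_of_in_cone:
  assumes "in_cone y p q r"
  shows "left_of p q r y \<longleftrightarrow> 0 < det3 p q r"
proof -
  have e: "det3 y q r = det3 q r y" by (simp add: det3_expand algebra_simps)
  show ?thesis using assms unfolding in_cone_def left_of_def e by (auto simp: zero_less_mult_iff)
qed

text \<open>Turning counterclockwise about \<open>q\<close> from \<open>r\<close> to
  \<open>p\<close> sweeps the left side. If this turn meets \<open>y\<close>, then the turn from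
  \<open>y\<close> to \<open>p\<close> does not meet \<open>r\<close>.\<close>

lemma left_of_exchange:
  assumes "det3 q p r \<noteq> 0" "det3 q p y \<noteq> 0" "det3 q r y \<noteq> 0" "left_of p q r y"
  shows "\<not> left_of p q y r"
proof -
  have e: "det3 p q r = - det3 q p r" "det3 p q y = - det3 q p y" "det3 q y r = - det3 q r y"
    by (simp_all add: det3_expand algebra_simps)
  show ?thesis using assms unfolding left_of_def e by argo
qed

text \<open>The end \<open>- q\<close> is dependent on \<open>q\<close>, so \<open>pasch\<close>
  does not apply. But an arc from \<open>- q\<close> into the triangle enters through the side
  opposite to \<open>q\<close>, and the parity persists.\<close>

lemma pasch_antipodal:
  assumes "det3 p q r \<noteq> 0" "det3 q r d \<noteq> 0"
  shows "even (of_bool (crosses p q (- q) d) + of_bool (crosses q r (- q) d) + of_bool (crosses p r (- q) d)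
     + of_bool (in_cone (- q) p q r) + of_bool (in_cone d p q r) :: nat)"
proof -
  have e: "det3 d q r = det3 q r d" "det3 p d r = - det3 p r d" "det3 p r q = - det3 p q r"
     "det3 p q d = - det3 q p d" "det3 r q d = - det3 q r d" "det3 q r q = 0" "det3 r q r = 0"
    by (simp_all add: det3_expand algebra_simps)
  have "\<not> crosses p q (- q) d" "\<not> crosses q r (- q) d" "\<not> in_cone (- q) p q r"
    by (simp_all add: crosses_def in_cone_def)
  moreover have "crosses p r (- q) d \<longleftrightarrow> in_cone d p q r"
    unfolding crosses_def in_cone_def using assms
    by (simp add: e mult_less_0_iff zero_less_mult_iff) argo
  ultimately show ?thesis by simp
qed

subsection \<open>Locally convex paths\<close>

lemma det3_cross: "det3 a b x = cross3 a b \<bullet> x"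
  by (simp add: det3_expand cross3_simps inner_vec_def sum_3)

lemma det3_cross': "det3 x a b = cross3 a b \<bullet> x"
  using det3_cross[of a b x] by (metis det3_rot)

lemma cone_hull_nonneg:
  fixes f :: "'a::real_inner"
  assumes "\<And>x. x \<in> S \<Longrightarrow> 0 \<le> f \<bullet> x" "x \<in> convex_cone hull S"
  shows "0 \<le> f \<bullet> x"
proof -
  have "convex_cone hull S \<subseteq> {x. f \<bullet> x \<ge> 0}"
    by (intro hull_minimal) (use assms(1) convex_cone_halfspace_ge in auto)
  then show ?thesis using assms(2) by auto
qed

text \<open>The open half-space together with the ray of \<open>a\<close> is itself a convex cone.
  The lemma serves to show that certain vertices are not combinations of others.\<close>

lemma cone_hull_pos_or_ray:
  fixes f :: "'a::real_inner"
  assumes "f \<bullet> a = 0" "\<And>x. x \<in> S \<Longrightarrow> 0 < f \<bullet> x \<or> x = a" "x \<in> convex_cone hull S"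
  shows "0 < f \<bullet> x \<or> (\<exists>c\<ge>0. x = c *\<^sub>R a)"
proof -
  let ?T = "{x. 0 < f \<bullet> x \<or> (\<exists>c\<ge>0. x = c *\<^sub>R a)}"
  have "convex_cone ?T"
    unfolding convex_cone_iff
  proof (intro conjI ballI allI impI)
    show "0 \<in> ?T" by (auto intro: exI[of _ 0])
  next
    fix x y assume "x \<in> ?T" "y \<in> ?T"
    then show "x + y \<in> ?T"
      using assms(1) by (auto simp: inner_add_right scaleR_add_left[symmetric] intro!: add_nonneg_nonneg)
  next
    fix x and c :: real assume "x \<in> ?T" "0 \<le> c"
    then show "c *\<^sub>R x \<in> ?T"
      using assms(1) by (cases "c = 0") (auto intro: exI[of _ 0] mult_nonneg_nonneg)
  qed
  moreover have "S \<subseteq> ?T"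
  proof
    fix x assume "x \<in> S"
    then have "0 < f \<bullet> x \<or> x = 1 *\<^sub>R a" using assms(2) by simp
    then show "x \<in> ?T" by (metis (mono_tags, lifting) mem_Collect_eq zero_le_one)
  qed
  ultimately have "convex_cone hull S \<subseteq> ?T" by (rule hull_minimal[rotated])
  then show ?thesis using assms(3) by auto
qed

lemma cone_hull_pos:
  fixes f :: "'a::real_inner"
  assumes "\<And>x. x \<in> S \<Longrightarrow> 0 < f \<bullet> x" "x \<in> convex_cone hull S" "x \<noteq> 0"
  shows "0 < f \<bullet> x"
  using cone_hull_pos_or_ray[of f 0 S x] assms by auto

lemma cone_hull_subset:
  "x \<in> convex_cone hull S \<Longrightarrow> S \<subseteq> convex_cone hull T \<Longrightarrow> x \<in> convex_cone hull T"
  by (metis convex_cone_convex_cone_hull hull_minimal subsetD)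

lemma cone_hull_comb:
  fixes a b c d :: "'a::real_inner"
  assumes "a \<in> convex_cone hull S" "b \<in> convex_cone hull S" "c \<in> convex_cone hull S"
    "0 < w" "0 \<le> x" "0 \<le> y" "0 \<le> z" "w *\<^sub>R d = x *\<^sub>R a + y *\<^sub>R b + z *\<^sub>R c"
  shows "d \<in> convex_cone hull S"
proof -
  have "(1 / w) *\<^sub>R (x *\<^sub>R a + y *\<^sub>R b + z *\<^sub>R c) \<in> convex_cone hull S"
    using assms by (intro convex_cone_hull_mul convex_cone_hull_add) auto
  moreover have "d = (1 / w) *\<^sub>R (w *\<^sub>R d)" using assms(4) by simp
  ultimately show ?thesis using assms(8) by simp
qed

text \<open>The vertices of the window span, in this order, the extreme rays of a convex polyhedral
  cone.\<close>

definition positive_on :: "(nat \<Rightarrow> real^3) \<Rightarrow> nat \<Rightarrow> nat \<Rightarrow> bool" where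
  "positive_on v s e \<longleftrightarrow> (\<forall>i j k. s \<le> i \<and> i < j \<and> j < k \<and> k \<le> e \<longrightarrow> 0 < det3 (v i) (v j) (v k))"

text \<open>A locally convex path may be a spiral, but the part winding around its
  convex hull is a contiguous window.\<close>
lemma convex_path_window:
  fixes v :: "nat \<Rightarrow> real^3"
  assumes "m + 2 \<le> t"
    "\<And>i j k. m \<le> i \<Longrightarrow> i < j \<Longrightarrow> j < k \<Longrightarrow> k \<le> t \<Longrightarrow> det3 (v i) (v j) (v k) \<noteq> 0"
    "\<And>i. m \<le> i \<Longrightarrow> i + 2 \<le> t \<Longrightarrow> 0 < det3 (v i) (v (i + 1)) (v (i + 2))"
    "\<And>i j. m \<le> i \<Longrightarrow> i + 2 \<le> j \<Longrightarrow> j + 1 \<le> t \<Longrightarrow> \<not> crosses (v i) (v (i + 1)) (v j) (v (j + 1))"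
  shows "\<exists>s e. m \<le> s \<and> s + 2 \<le> e \<and> e \<le> t \<and> positive_on v s e \<and>
    (\<forall>i. m \<le> i \<and> i \<le> t \<longrightarrow> v i \<in> convex_cone hull (v ` {s..e}))"
  using assms
proof (induction "t - m" arbitrary: m t rule: less_induct)
  case less
  note gp = less.prems(2) and turn = less.prems(3) and nc = less.prems(4)
  let ?H = "\<lambda>s e. convex_cone hull (v ` {s..e})"
  have inH: "v i \<in> ?H s e" if "s \<le> i" "i \<le> e" for i s e
    using that by (intro hull_inc) auto
  show ?case
  proof (cases "t = m + 2")
    case True
    have "positive_on v m t"
      unfolding positive_on_def
    proof (intro allI impI)
      fix i j k assume "m \<le> i \<and> i < j \<and> j < k \<and> k \<le> t"
      then have "i = m" "j = m + 1" "k = m + 2" using True by auto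
      then show "0 < det3 (v i) (v j) (v k)" using turn[of m] True by simp
    qed
    then show ?thesis using True inH by blast
  next
    case False
    then have t: "m + 3 \<le> t" using less.prems(1) by simp
    have IH: "\<exists>s e. a \<le> s \<and> s + 2 \<le> e \<and> e \<le> b \<and> positive_on v s e \<and>
        (\<forall>i. a \<le> i \<and> i \<le> b \<longrightarrow> v i \<in> ?H s e)"
      if "b - a < t - m" "a + 2 \<le> b" "m \<le> a" "b \<le> t" for a b
    proof (rule less.hyps[OF that(1,2)])
      show "\<not> crosses (v i) (v (i + 1)) (v j) (v (j + 1))" if "a \<le> i" "i + 2 \<le> j" "j + 1 \<le> b" for i j
        by (rule nc) (use that \<open>m \<le> a\<close> \<open>b \<le> t\<close> in auto)
    qed (use that gp turn in auto)
    \<comment> \<open>The induction hypothesis is used for the path without its last vertex, for the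
      path without its first vertex, and later for the path without both.\<close>
    have "t - 1 - m < t - m" "m + 2 \<le> t - 1" using t by linarith+
    from IH[OF this le_refl diff_le_self]
    obtain s e where se_all: "m \<le> s \<and> s + 2 \<le> e \<and> e \<le> t - 1 \<and> positive_on v s e \<and>
        (\<forall>i. m \<le> i \<and> i \<le> t - 1 \<longrightarrow> v i \<in> ?H s e)" by (elim exE)
    then have se: "m \<le> s" "s + 2 \<le> e" "e \<le> t - 1" "positive_on v s e"
      "\<And>i. m \<le> i \<Longrightarrow> i \<le> t - 1 \<Longrightarrow> v i \<in> ?H s e" by blast+
    have "t - (m + 1) < t - m" "m + 1 + 2 \<le> t" using t by linarith+
    from IH[OF this le_add1 le_refl]
    obtain s' e' where se'_all: "m + 1 \<le> s' \<and> s' + 2 \<le> e' \<and> e' \<le> t \<and> positive_on v s' e' \<and>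
        (\<forall>i. m + 1 \<le> i \<and> i \<le> t \<longrightarrow> v i \<in> ?H s' e')" by (elim exE)
    then have se': "m + 1 \<le> s'" "s' + 2 \<le> e'" "e' \<le> t" "positive_on v s' e'"
      "\<And>i. m + 1 \<le> i \<Longrightarrow> i \<le> t \<Longrightarrow> v i \<in> ?H s' e'" by blast+
    \<comment> \<open>If the first window omits \<open>v m\<close>, then \<open>v m\<close> is a
      combination of later vertices, and the second window serves for the whole path. If the second
      window omits \<open>v t\<close>, the first one serves. What remains is that both ends are
      needed.\<close>
    show ?thesis
    proof (cases "m < s")
      case True
      have "v m \<in> ?H s' e'"
        by (rule cone_hull_subset[OF se(5)[of m]]) (use t True se se'(5) in auto)
      then have "v i \<in> ?H s' e'" if "m \<le> i" "i \<le> t" for i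
        using that se'(5)[of i] by (cases "i = m") auto
      then show ?thesis using se' by (intro exI[of _ s'] exI[of _ e']) auto
    next
      case False
      then have s: "s = m" using se by simp
      show ?thesis
      proof (cases "e' < t")
        case True
        have "v t \<in> ?H m e"
          by (rule cone_hull_subset[OF se'(5)[of t]]) (use t True se se' s in auto)
        then have "v i \<in> ?H m e" if "m \<le> i" "i \<le> t" for i
          using that se(5)[of i] s by (cases "i = t") auto
        then show ?thesis using se s by (intro exI[of _ m] exI[of _ e]) auto
      next
        case False
        then have e': "e' = t" using se' by simp
        define p where "p = t - 1"
        have p: "t = Suc p" "p + 1 = t" "m + 2 \<le> p" using t by (auto simp: p_def)
        \<comment> \<open>The first edge belongs to a convex window, so its functional is
          nonnegative on the window and hence on all vertices up to \<open>v p\<close>.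
          \<open>B\<close> is the same for the last edge.\<close>
        have A: "0 < det3 (v m) (v (m + 1)) (v i)" if "m + 2 \<le> i" "i \<le> p" for i
        proof -
          have "0 \<le> cross3 (v m) (v (m + 1)) \<bullet> v i"
          proof (rule cone_hull_nonneg[OF _ se(5)])
            fix x assume "x \<in> v ` {s..e}"
            then obtain j where j: "x = v j" "m \<le> j" "j \<le> e" using s by auto
            show "0 \<le> cross3 (v m) (v (m + 1)) \<bullet> x"
              unfolding j det3_cross[symmetric]
              using se(4)[unfolded positive_on_def, rule_format, of m "m + 1" j] j s
              by (cases "j = m \<or> j = m + 1") auto
          qed (use that p in auto)
          then show ?thesis using gp[of m "m + 1" i] that p by (simp add: det3_cross[symmetric])
        qed
        have B: "0 < det3 (v i) (v p) (v t)" if "m + 1 \<le> i" "i < p" for i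
        proof -
          have "0 \<le> cross3 (v p) (v t) \<bullet> v i"
          proof (rule cone_hull_nonneg[OF _ se'(5)])
            fix x assume "x \<in> v ` {s'..e'}"
            then obtain j where j: "x = v j" "s' \<le> j" "j \<le> t" using e' by auto
            have "s' < p" using se' e' p by simp
            then show "0 \<le> cross3 (v p) (v t) \<bullet> x"
              unfolding j det3_cross'[symmetric]
              using se'(4)[unfolded positive_on_def, rule_format, of j p t] j e' p
              by (cases "j = p \<or> j = t") auto
          qed (use that p in auto)
          then show ?thesis using gp[of i p t] that p by (simp add: det3_cross'[symmetric])
        qed
        have mid: "0 < det3 (v i) (v j) (v k)" if ijk: "m + 1 \<le> i" "i < j" "j < k" "k \<le> p" for i j k
        proof -
          have mp: "p - (m + 1) < t - m" "(m + 1) + 2 \<le> p" "p \<le> t" using ijk p by linarith+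
          from IH[OF mp(1,2) le_add1 mp(3)]
          obtain a b where "m + 1 \<le> a \<and> a + 2 \<le> b \<and> b \<le> p \<and> positive_on v a b \<and>
              (\<forall>i. m + 1 \<le> i \<and> i \<le> p \<longrightarrow> v i \<in> ?H a b)"
            by (elim exE)
          then have ab: "m + 1 \<le> a" "a + 2 \<le> b" "b \<le> p" "positive_on v a b"
            "\<And>i. m + 1 \<le> i \<Longrightarrow> i \<le> p \<Longrightarrow> v i \<in> ?H a b" by blast+
          \<comment> \<open>Otherwise \<open>v (m + 1)\<close> would be a combination of vertices
            lying strictly on one side of a plane through it.\<close>
          have "a = m + 1"
          proof (rule ccontr)
            assume "a \<noteq> m + 1"
            then have a: "m + 2 \<le> a" using ab by simp
            have "0 < cross3 (v m) (v (m + 1)) \<bullet> v (m + 1)"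
            proof (rule cone_hull_pos[OF _ ab(5)])
              fix x assume "x \<in> v ` {a..b}"
              then show "0 < cross3 (v m) (v (m + 1)) \<bullet> x"
                using A a ab(3) by (auto simp: det3_cross[symmetric])
            next
              show "v (m + 1) \<noteq> 0" using A[of "m + 2"] p by force
            qed (use p in auto)
            then show False by (simp add: det3_cross[symmetric])
          qed
          moreover have "b = p"
          proof (rule ccontr)
            assume "b \<noteq> p"
            then have b: "b < p" using ab by simp
            have "0 < cross3 (v p) (v t) \<bullet> v p"
            proof (rule cone_hull_pos[OF _ ab(5)])
              fix x assume "x \<in> v ` {a..b}"
              then show "0 < cross3 (v p) (v t) \<bullet> x"
                using B b ab(1) by (auto simp: det3_cross'[symmetric])
            next
              show "v p \<noteq> 0" using A[of p] p by force
            qed (use p in auto)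
            then show False by (simp add: det3_cross[symmetric])
          qed
          ultimately show ?thesis using ab(4) ijk unfolding positive_on_def by auto
        qed
        \<comment> \<open>The first and the last edge satisfy one linear relation, in which
          \<open>?P\<close> and \<open>?S\<close> are positive. The signs of \<open>?Q\<close> and
          \<open>?R\<close> decide whether these edges cross, \<open>v t\<close> is redundant,
          \<open>v m\<close> is redundant, or the whole path is in convex position.\<close>
        let ?P = "det3 (v (m + 1)) (v p) (v t)" and ?S = "det3 (v m) (v (m + 1)) (v p)"
        let ?Q = "det3 (v m) (v p) (v t)" and ?R = "det3 (v m) (v (m + 1)) (v t)"
        have P: "0 < ?P" and S: "0 < ?S" using A[of p] B[of "m + 1"] p by auto
        have Q0: "?Q \<noteq> 0" and R0: "?R \<noteq> 0" using gp p by auto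
        have cr: "?P *\<^sub>R v m - ?Q *\<^sub>R v (m + 1) + ?R *\<^sub>R v p - ?S *\<^sub>R v t = 0"
          by (rule det3_cramer)
        consider "?Q < 0" "?R < 0" | "?Q < 0" "0 < ?R" | "0 < ?Q" "?R < 0" | "0 < ?Q" "0 < ?R"
          using Q0 R0 by linarith
        then show ?thesis
        proof cases
          case 1
          then have "crosses (v m) (v (m + 1)) (v p) (v (p + 1))"
            using P S p unfolding crosses_def by (simp add: mult_less_0_iff zero_less_mult_iff)
          then show ?thesis using nc[of m p] p by simp
        next
          case 2
          have "v t \<in> ?H m e"
          proof (rule cone_hull_comb)
            show "?S *\<^sub>R v t = ?P *\<^sub>R v m + (- ?Q) *\<^sub>R v (m + 1) + ?R *\<^sub>R v p"
              using cr by (simp add: algebra_simps)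
          qed (use 2 P S se(5) s p in auto)
          then have "v i \<in> ?H m e" if "m \<le> i" "i \<le> t" for i
            using that se(5)[of i] s by (cases "i = t") auto
          then show ?thesis using se s by (intro exI[of _ m] exI[of _ e]) auto
        next
          case 3
          have "v m \<in> ?H s' t"
          proof (rule cone_hull_comb)
            show "?P *\<^sub>R v m = ?Q *\<^sub>R v (m + 1) + (- ?R) *\<^sub>R v p + ?S *\<^sub>R v t"
              using cr by (simp add: algebra_simps)
          qed (use 3 P S se'(5) e' p in auto)
          then have "v i \<in> ?H s' t" if "m \<le> i" "i \<le> t" for i
            using that se'(5)[of i] e' by (cases "i = m") auto
          then show ?thesis using se' e' by (intro exI[of _ s'] exI[of _ t]) auto
        next
          case 4
          have Ai: "0 < det3 (v m) (v i) (v p)" if i: "m + 1 \<le> i" "i < p" for i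
          proof (cases "i = m + 1")
            case False
            have "0 < det3 (v (m + 1)) (v i) (v p)" using mid[of "m + 1" i p] i False by simp
            moreover note B[OF i] P S 4
            moreover have "det3 (v p) (v m) (v i) * det3 (v p) (v (m + 1)) (v t) - det3 (v p) (v m) (v (m + 1)) * det3 (v p) (v i) (v t)
                + det3 (v p) (v m) (v t) * det3 (v p) (v i) (v (m + 1)) = 0"
              by (rule det3_pluecker)
            moreover have "det3 (v p) (v m) (v i) = det3 (v m) (v i) (v p)"
              "det3 (v p) (v (m + 1)) (v t) = - det3 (v (m + 1)) (v p) (v t)"
              "det3 (v p) (v m) (v (m + 1)) = det3 (v m) (v (m + 1)) (v p)"
              "det3 (v p) (v i) (v t) = - det3 (v i) (v p) (v t)"
              "det3 (v p) (v m) (v t) = - det3 (v m) (v p) (v t)"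
              "det3 (v p) (v i) (v (m + 1)) = - det3 (v (m + 1)) (v i) (v p)"
              by (simp_all add: det3_expand algebra_simps)
            ultimately have "det3 (v m) (v i) (v p) * ?P = ?S * det3 (v i) (v p) (v t) + ?Q * det3 (v (m + 1)) (v i) (v p)"
              "0 < ?S * det3 (v i) (v p) (v t)" "0 < ?Q * det3 (v (m + 1)) (v i) (v p)"
              by (simp_all add: algebra_simps)
            then have "0 < det3 (v m) (v i) (v p) * ?P" by linarith
            then show ?thesis using P by (simp add: zero_less_mult_iff)
          qed (use S in simp)
          have Bj: "0 < det3 (v (m + 1)) (v j) (v t)" if j: "m + 1 < j" "j \<le> p" for j
          proof (cases "j = p")
            case False
            have "0 < det3 (v (m + 1)) (v j) (v p)" using mid[of "m + 1" j p] j False by simp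
            moreover have "0 < det3 (v m) (v (m + 1)) (v j)" using A j by simp
            moreover note P S 4
            moreover have "det3 (v (m + 1)) (v j) (v t) * det3 (v (m + 1)) (v m) (v p) - det3 (v (m + 1)) (v j) (v m) * det3 (v (m + 1)) (v t) (v p)
                + det3 (v (m + 1)) (v j) (v p) * det3 (v (m + 1)) (v t) (v m) = 0"
              by (rule det3_pluecker)
            moreover have "det3 (v (m + 1)) (v m) (v p) = - ?S"
              "det3 (v (m + 1)) (v j) (v m) = det3 (v m) (v (m + 1)) (v j)"
              "det3 (v (m + 1)) (v t) (v p) = - ?P" "det3 (v (m + 1)) (v t) (v m) = ?R"
              by (simp_all add: det3_expand algebra_simps)
            ultimately have "det3 (v (m + 1)) (v j) (v t) * ?S = det3 (v m) (v (m + 1)) (v j) * ?P + det3 (v (m + 1)) (v j) (v p) * ?R"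
              "0 < det3 (v m) (v (m + 1)) (v j) * ?P" "0 < det3 (v (m + 1)) (v j) (v p) * ?R"
              by (simp_all add: algebra_simps)
            then have "0 < det3 (v (m + 1)) (v j) (v t) * ?S" by linarith
            then show ?thesis using S by (simp add: zero_less_mult_iff)
          qed (use P in simp)
          \<comment> \<open>If the window omitted \<open>v p\<close>, the plane through
            \<open>v p\<close> and \<open>v m\<close> would support it along the ray of
            \<open>v m\<close> alone, forcing \<open>v p\<close> onto that ray.\<close>
          have "e = p"
          proof (rule ccontr)
            assume "e \<noteq> p"
            then have e: "e < p" using se p by simp
            have "0 < cross3 (v p) (v m) \<bullet> v p \<or> (\<exists>c\<ge>0. v p = c *\<^sub>R v m)"
            proof (rule cone_hull_pos_or_ray[OF _ _ se(5)])
              fix x assume "x \<in> v ` {s..e}"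
              then obtain j where j: "x = v j" "m \<le> j" "j \<le> e" using s by auto
              then show "0 < cross3 (v p) (v m) \<bullet> x \<or> x = v m"
                using Ai[of j] e by (cases "j = m") (auto simp: det3_cross[symmetric] det3_rot'[of "v p"])
            qed (use p in \<open>auto simp: det3_cross[symmetric]\<close>)
            then obtain c where "v p = c *\<^sub>R v m" by (auto simp: det3_cross[symmetric])
            then have "?S = 0" by (simp add: det3_scaleR)
            then show False using S by simp
          qed
          moreover have "s' = m + 1"
          proof (rule ccontr)
            assume "s' \<noteq> m + 1"
            then have s': "m + 1 < s'" using se' by simp
            have "0 < cross3 (v t) (v (m + 1)) \<bullet> v (m + 1) \<or> (\<exists>c\<ge>0. v (m + 1) = c *\<^sub>R v t)"
            proof (rule cone_hull_pos_or_ray[OF _ _ se'(5)])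
              fix x assume "x \<in> v ` {s'..e'}"
              then obtain j where j: "x = v j" "s' \<le> j" "j \<le> t" using e' by auto
              then show "0 < cross3 (v t) (v (m + 1)) \<bullet> x \<or> x = v t"
                using Bj[of j] s' p by (cases "j = t") (auto simp: det3_cross[symmetric] det3_rot'[of "v t"])
            qed (use p in \<open>auto simp: det3_cross[symmetric]\<close>)
            then obtain c where "v (m + 1) = c *\<^sub>R v t" by (auto simp: det3_cross[symmetric])
            then have "?P = 0" by (simp add: det3_scaleR)
            then show False using P by simp
          qed
          ultimately have pos: "positive_on v m p" "positive_on v (m + 1) t" using se(4) s se'(4) e' by auto
          have D: "0 < det3 (v m) (v j) (v t)" if j: "m < j" "j < t" for j
          proof -
            consider "j = m + 1" | "j = p" | "m + 1 < j" "j < p" using j p by linarith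
            then show ?thesis
            proof cases
              case 3
              have "0 < det3 (v m) (v (m + 1)) (v j)" "0 < det3 (v m) (v j) (v p)" using A Ai 3 by auto
              moreover have "?S * det3 (v m) (v j) (v t) = det3 (v m) (v (m + 1)) (v j) * ?Q + ?R * det3 (v m) (v j) (v p)"
                using det3_pluecker[of "v m" "v (m + 1)" "v j" "v p" "v t"] by (simp add: algebra_simps)
              ultimately have "0 < ?S * det3 (v m) (v j) (v t)" using 4 by (metis add_pos_pos mult_pos_pos)
              then show ?thesis using S by (simp add: zero_less_mult_iff)
            qed (use 4 in auto)
          qed
          have "positive_on v m t"
            unfolding positive_on_def
          proof (intro allI impI)
            fix i j k assume ijk: "m \<le> i \<and> i < j \<and> j < k \<and> k \<le> t"
            show "0 < det3 (v i) (v j) (v k)"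
            proof (cases "i = m")
              case True
              then show ?thesis using D[of j] pos(1) ijk p unfolding positive_on_def
                by (cases "k = t") auto
            next
              case False
              then show ?thesis using pos(2) ijk unfolding positive_on_def by auto
            qed
          qed
          then show ?thesis using t inH by (intro exI[of _ m] exI[of _ t]) auto
        qed
      qed
    qed
  qed
qed

text \<open>On a convex window the functional of an edge vanishes only at the ends of the edge.
  Three edges without a common vertex therefore add up to a functional that is positive on the
  window, hence on the cone that contains the path.\<close>

lemma convex_path_halfspace:
  fixes v :: "nat \<Rightarrow> real^3"
  assumes "m + 2 \<le> t"
    "\<And>i j k. m \<le> i \<Longrightarrow> i < j \<Longrightarrow> j < k \<Longrightarrow> k \<le> t \<Longrightarrow> det3 (v i) (v j) (v k) \<noteq> 0"
    "\<And>i. m \<le> i \<Longrightarrow> i + 2 \<le> t \<Longrightarrow> 0 < det3 (v i) (v (i + 1)) (v (i + 2))"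
    "\<And>i j. m \<le> i \<Longrightarrow> i + 2 \<le> j \<Longrightarrow> j + 1 \<le> t \<Longrightarrow> \<not> crosses (v i) (v (i + 1)) (v j) (v (j + 1))"
  shows "\<exists>f. \<forall>i. m \<le> i \<and> i \<le> t \<longrightarrow> 0 < f \<bullet> v i"
proof -
  have "\<exists>s e. m \<le> s \<and> s + 2 \<le> e \<and> e \<le> t \<and> positive_on v s e \<and>
    (\<forall>i. m \<le> i \<and> i \<le> t \<longrightarrow> v i \<in> convex_cone hull (v ` {s..e}))"
    by (rule convex_path_window; fact assms)
  then obtain s e where "m \<le> s \<and> s + 2 \<le> e \<and> e \<le> t \<and> positive_on v s e \<and>
    (\<forall>i. m \<le> i \<and> i \<le> t \<longrightarrow> v i \<in> convex_cone hull (v ` {s..e}))"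
    by (elim exE)
  then have se: "m \<le> s" "s + 2 \<le> e" "e \<le> t" "positive_on v s e"
    and hull: "\<And>i. m \<le> i \<Longrightarrow> i \<le> t \<Longrightarrow> v i \<in> convex_cone hull (v ` {s..e})" by blast+
  have pos: "0 < det3 (v i) (v j) (v k)" if "s \<le> i" "i < j" "j < k" "k \<le> e" for i j k
    using se(4) that unfolding positive_on_def by blast
  define f where "f = cross3 (v s) (v (s + 1)) + cross3 (v (s + 1)) (v (s + 2)) + cross3 (v e) (v s)"
  have "0 < f \<bullet> x" if "x \<in> v ` {s..e}" for x
  proof -
    from that obtain j where j: "x = v j" "s \<le> j" "j \<le> e" by auto
    have f: "f \<bullet> x = det3 (v s) (v (s + 1)) (v j) + det3 (v j) (v (s + 1)) (v (s + 2)) + det3 (v s) (v j) (v e)"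
      unfolding f_def inner_add_left det3_cross[symmetric] j
      by (simp add: det3_expand algebra_simps)
    have p: "0 < det3 (v s) (v (s + 1)) (v (s + 2))" using pos se by simp
    have nn: "0 \<le> det3 (v s) (v j) (v e)"
      using pos[of s j e] j se by (cases "j = s \<or> j = e") auto
    consider "j = s" | "j = s + 1" | "s + 1 < j" using j by linarith
    then show ?thesis
    proof cases
      case 1
      then show ?thesis using p unfolding f by simp
    next
      case 2
      then show ?thesis using pos[of s j e] se unfolding f by simp
    next
      case 3
      have "0 \<le> det3 (v j) (v (s + 1)) (v (s + 2))"
        using pos[of "s + 1" "s + 2" j] 3 j by (cases "j = s + 2") (auto simp: det3_rot'[of "v j"])
      moreover have "0 < det3 (v s) (v (s + 1)) (v j)" using pos[of s "s + 1" j] 3 j by simp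
      ultimately show ?thesis using nn unfolding f by linarith
    qed
  qed
  moreover have "v i \<noteq> 0" if mi: "m \<le> i" "i \<le> t" for i
  proof -
    obtain j k where "m \<le> j" "j < k" "k \<le> t" "j \<noteq> i" "k \<noteq> i"
    proof -
      consider "i = m" | "i = m + 1" | "m + 2 \<le> i" using mi by linarith
      then show thesis
      proof cases
        case 1 then show thesis using that[of "m + 1" "m + 2"] assms(1) by simp
      next
        case 2 then show thesis using that[of m "m + 2"] assms(1) by simp
      next
        case 3 then show thesis using that[of m "m + 1"] assms(1) by simp
      qed
    qed
    then show ?thesis using assms(2)[of i j k] assms(2)[of j i k] assms(2)[of j k i] mi
      by (metis det3_zero linorder_neqE_nat)
  qed
  ultimately show ?thesis using cone_hull_pos[OF _ hull] by blast
qed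

subsection \<open>Parity of crossings with a projectively simple polygon\<close>

text \<open>Crossing is invariant under positive scaling, so the vertices need not be unit vectors, only
  represent the right rays.\<close>
definition proj_polygon :: "(int \<Rightarrow> real^3) \<Rightarrow> int \<Rightarrow> bool" where
  "proj_polygon z n \<longleftrightarrow> 3 \<le> n \<and> (\<forall>i. z (i + n) = z i) \<and>
    (\<forall>i j k. i < j \<and> j < k \<and> k < i + n \<longrightarrow> det3 (z i) (z j) (z k) \<noteq> 0) \<and>
    (\<forall>i j. i + 2 \<le> j \<and> j + 2 \<le> i + n \<longrightarrow> \<not> crosses (z i) (z (i + 1)) (z j) (z (j + 1)) \<and>
       \<not> crosses (z i) (z (i + 1)) (- z j) (- z (j + 1)))"

definition cnt :: "(int \<Rightarrow> real^3) \<Rightarrow> int \<Rightarrow> nat \<Rightarrow> real^3 \<Rightarrow> real^3 \<Rightarrow> nat" where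
  "cnt z i m a b = (\<Sum>j<m. of_bool (crosses a b (z (i + int j)) (z (i + int j + 1))))"

lemma cnt_0 [simp]: "cnt z i 0 a b = 0"
  by (simp add: cnt_def)

lemma cnt_add: "cnt z i (k + m) a b = cnt z i k a b + cnt z (i + int k) m a b"
  by (induction m) (simp_all add: cnt_def add.assoc)

lemma cnt_1: "cnt z i (Suc 0) a b = of_bool (crosses a b (z i) (z (i + 1)))"
  by (simp add: cnt_def)

lemma cnt_eq_0: "(\<And>j. j < m \<Longrightarrow> \<not> crosses a b (z (i + int j)) (z (i + int j + 1))) \<Longrightarrow> cnt z i m a b = 0"
  by (simp add: cnt_def)

text \<open>The conclusion of \<open>pasch\<close> as a predicate, so that generic and antipodal
  configurations can be summed along one path.\<close>

definition pasch_even :: "real^3 \<Rightarrow> real^3 \<Rightarrow> real^3 \<Rightarrow> real^3 \<Rightarrow> real^3 \<Rightarrow> bool" where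
  "pasch_even p q r c d \<longleftrightarrow> even (of_bool (crosses p q c d) + of_bool (crosses q r c d) + of_bool (crosses p r c d)
     + of_bool (in_cone c p q r) + of_bool (in_cone d p q r) :: nat)"

lemma in_cone_swap: "in_cone z p r q \<longleftrightarrow> in_cone z p q r"
proof -
  have e: "det3 z r q = - det3 z q r" "det3 p r q = - det3 p q r" "det3 p z q = - det3 p q z" "det3 p r z = - det3 p z r"
    by (simp_all add: det3_expand algebra_simps)
  show ?thesis unfolding in_cone_def e by auto
qed

lemma pasch_even_swap: "pasch_even p r q c d \<longleftrightarrow> pasch_even p q r c d"
  unfolding pasch_even_def in_cone_swap[of _ p r q] crosses_flip1[of q r] by (simp add: ac_simps)

lemma pasch_even_commute: "pasch_even p q r d c \<longleftrightarrow> pasch_even p q r c d"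
  unfolding pasch_even_def crosses_flip2[of _ _ d c] by (simp add: ac_simps)

text \<open>Every inner vertex of the path is an end of two edges, so its membership in the triangle
  cancels modulo 2.\<close>

lemma pasch_path:
  assumes "\<And>j. j < m \<Longrightarrow> pasch_even p q r (z (i + int j)) (z (i + int j + 1))"
  shows "even (cnt z i m p q + cnt z i m q r + cnt z i m p r + of_bool (in_cone (z i) p q r)
    + of_bool (in_cone (z (i + int m)) p q r))"
  using assms
proof (induction m)
  case (Suc m)
  have e: "i + int (Suc m) = i + int m + 1" by simp
  have *: "cnt z i (Suc m) a b = cnt z i m a b + of_bool (crosses a b (z (i + int m)) (z (i + int m + 1)))" for a b
    by (simp add: cnt_def)
  have pe: "pasch_even p q r (z (i + int m)) (z (i + int m + 1))" using Suc.prems by simp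
  have IH: "even (cnt z i m p q + cnt z i m q r + cnt z i m p r + of_bool (in_cone (z i) p q r)
    + of_bool (in_cone (z (i + int m)) p q r))" using Suc by simp
  show ?case using pe IH unfolding e * pasch_even_def by presburger
qed simp

lemma proj_polygonD:
  assumes "proj_polygon z n"
  shows "3 \<le> n" "z (i + n) = z i" "i < j \<Longrightarrow> j < k \<Longrightarrow> k < i + n \<Longrightarrow> det3 (z i) (z j) (z k) \<noteq> 0"
    "i + 2 \<le> j \<Longrightarrow> j + 2 \<le> i + n \<Longrightarrow> \<not> crosses (z i) (z (i + 1)) (z j) (z (j + 1))"
    "i + 2 \<le> j \<Longrightarrow> j + 2 \<le> i + n \<Longrightarrow> \<not> crosses (z i) (z (i + 1)) (- z j) (- z (j + 1))"
  using assms unfolding proj_polygon_def by blast+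

lemma proj_polygon_gp:
  assumes "proj_polygon z n" "distinct [i, j, k]" "{i, j, k} \<subseteq> {a..<a + n}"
  shows "det3 (z i) (z j) (z k) \<noteq> 0"
proof -
  have *: "det3 (z i) (z j) (z k) \<noteq> 0" if "i < j" "j < k" "{i, j, k} \<subseteq> {a..<a + n}" for i j k
    using proj_polygonD(3)[OF assms(1)] that by auto
  have sw: "det3 p r q = 0 \<longleftrightarrow> det3 p q r = 0" "det3 q p r = 0 \<longleftrightarrow> det3 p q r = 0" for p q r
    using det3_swap23[of p r q] det3_swap12[of q p r] by auto
  have ne: "i \<noteq> j" "j \<noteq> k" "i \<noteq> k" using assms(2) by auto
  have r: "det3 (z j) (z k) (z i) = 0 \<longleftrightarrow> det3 (z i) (z j) (z k) = 0" "det3 (z k) (z i) (z j) = 0 \<longleftrightarrow> det3 (z i) (z j) (z k) = 0"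
    "det3 (z k) (z j) (z i) = 0 \<longleftrightarrow> det3 (z i) (z j) (z k) = 0"
    using sw by blast+
  consider "i < j" "j < k" | "i < k" "k < j" | "j < i" "i < k" | "j < k" "k < i" | "k < i" "i < j" | "k < j" "j < i"
    using ne by linarith
  then show ?thesis
  proof cases
    case 1 then show ?thesis using *[of i j k] assms(3) by blast
  next
    case 2 then show ?thesis using *[of i k j] assms(3) sw by blast
  next
    case 3 then show ?thesis using *[of j i k] assms(3) sw by blast
  next
    case 4 then show ?thesis using *[of j k i] assms(3) r by blast
  next
    case 5 then show ?thesis using *[of k i j] assms(3) r by blast
  next
    case 6 then show ?thesis using *[of k j i] assms(3) r by blast
  qed
qed

definition generic :: "real^3 \<Rightarrow> (int \<Rightarrow> real^3) \<Rightarrow> int \<Rightarrow> bool" where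
  "generic w z n \<longleftrightarrow> (\<forall>i j. i < j \<and> j < i + n \<longrightarrow> det3 w (z i) (z j) \<noteq> 0)"

lemma genericD:
  assumes "generic w z n" "i \<noteq> j" "{i, j} \<subseteq> {a..<a + n}"
  shows "det3 w (z i) (z j) \<noteq> 0"
proof -
  have "i < j \<and> j < i + n \<or> j < i \<and> i < j + n" using assms(2,3) by auto
  then show ?thesis
    using assms(1) det3_swap23[of w "z j" "z i"] unfolding generic_def by force
qed

text \<open>A combinatorial substitute for \<open>w\<close> lying on the left of the closed curve:
  an arc from \<open>w\<close> to \<open>z t\<close> changes sides at each crossing and arrives on a
  known side of the corner. The two edges at \<open>z t\<close> are not counted, which leaves
  \<open>n - 2\<close>.\<close>

definition side_parity :: "(int \<Rightarrow> real^3) \<Rightarrow> int \<Rightarrow> real^3 \<Rightarrow> int \<Rightarrow> bool" where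
  "side_parity z n w t \<longleftrightarrow> odd (cnt z (t + 1) (nat (n - 2)) w (z t)) \<noteq> left_of (z (t - 1)) (z t) (z (t + 1)) w"

lemma odd_add_xor: "odd (a + b :: nat) \<longleftrightarrow> odd a \<noteq> odd b"
  by auto

lemma odd_of_bool: "odd (of_bool P :: nat) \<longleftrightarrow> P"
  by simp

lemma of_bool_add_xor: "(of_bool P + of_bool Q :: nat) = of_bool R \<Longrightarrow> (P \<noteq> Q) = R"
  by (cases P; cases Q; cases R) simp_all

text \<open>If nothing blocks the arc from \<open>z t\<close> to \<open>y\<close>, the triangle
  \<open>w\<close>, \<open>z t\<close>, \<open>y\<close> converts crossings of \<open>w y\<close>
  into crossings of \<open>w\<close> with \<open>z t\<close>. The assumption \<open>local\<close>
  isolates the contribution of the two edges at \<open>z t\<close>, so that generic and antipodal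
  \<open>y\<close> share the argument.\<close>

lemma side_parity_visible_aux:
  assumes z: "proj_polygon z n"
    and local: "left_of (z (t - 1)) (z t) (z (t + 1)) w \<noteq> left_of (z (t - 1)) (z t) (z (t + 1)) y \<longleftrightarrow>
      (in_cone (z (t + 1)) w (z t) y \<noteq> crosses (z t) (z (t + 1)) w y) \<noteq>
      (in_cone (z (t - 1)) w (z t) y \<noteq> crosses (z t) (z (t - 1)) w y)"
    and pe: "\<And>j. t + 1 \<le> j \<Longrightarrow> j < t + n - 1 \<Longrightarrow> pasch_even w (z t) y (z j) (z (j + 1))"
    and vis: "\<And>j. t + 1 \<le> j \<Longrightarrow> j < t + n - 1 \<Longrightarrow> \<not> crosses (z t) y (z j) (z (j + 1))"
  shows "odd (cnt z t (nat n) w y) \<longleftrightarrow> side_parity z n w t \<noteq> left_of (z (t - 1)) (z t) (z (t + 1)) y"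
proof -
  define m where "m = nat (n - 2)"
  have n: "nat n = Suc 0 + (m + Suc 0)" "n = int m + 2" using proj_polygonD(1)[OF z] by (auto simp: m_def)
  have zt: "z (t + n - 1) = z (t - 1)" "z (t + n) = z t"
    using proj_polygonD(2)[OF z, of "t - 1"] proj_polygonD(2)[OF z, of t] by (simp_all add: algebra_simps)
  let ?p = "z (t - 1)" and ?q = "z t" and ?r = "z (t + 1)"
  have 1: "cnt z t (nat n) w y = of_bool (crosses w y ?q ?r) + cnt z (t + 1) m w y + of_bool (crosses w y ?p ?q)"
    unfolding n(1) cnt_add cnt_1 using zt n(2) by (simp add: algebra_simps)
  have "even (cnt z (t + 1) m w ?q + cnt z (t + 1) m ?q y + cnt z (t + 1) m w y + of_bool (in_cone (z (t + 1)) w ?q y)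
    + of_bool (in_cone (z (t + 1 + int m)) w ?q y))"
    by (rule pasch_path, rule pe) (use n(2) in auto)
  moreover have "cnt z (t + 1) m ?q y = 0"
    by (rule cnt_eq_0, rule vis) (use n(2) in auto)
  moreover have "z (t + 1 + int m) = ?p" using zt n(2) by (simp add: algebra_simps)
  ultimately have 2: "even (cnt z (t + 1) m w ?q + cnt z (t + 1) m w y + of_bool (in_cone ?r w ?q y) + of_bool (in_cone ?p w ?q y))"
    by simp
  have 5: "crosses w y ?q ?r = crosses ?q ?r w y" "crosses w y ?p ?q = crosses ?q ?p w y"
    using crosses_commute crosses_flip1 by blast+
  have "\<not> odd (cnt z (t + 1) m w ?q + cnt z (t + 1) m w y + of_bool (in_cone ?r w ?q y) + of_bool (in_cone ?p w ?q y))"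
    using 2 by blast
  then show ?thesis
    using local unfolding 1 5 side_parity_def m_def[symmetric] odd_add_xor odd_of_bool by argo
qed

lemma side_parity_visible:
  assumes z: "proj_polygon z n"
    and nz: "det3 (z t) (z (t - 1)) w \<noteq> 0" "det3 (z t) (z (t - 1)) y \<noteq> 0" "det3 (z t) (z (t + 1)) w \<noteq> 0"
      "det3 (z t) (z (t + 1)) y \<noteq> 0" "det3 (z t) w y \<noteq> 0" "det3 w (z (t - 1)) y \<noteq> 0" "det3 w (z (t + 1)) y \<noteq> 0"
    and pe: "\<And>j. t + 1 \<le> j \<Longrightarrow> j < t + n - 1 \<Longrightarrow> pasch_even w (z t) y (z j) (z (j + 1))"
    and vis: "\<And>j. t + 1 \<le> j \<Longrightarrow> j < t + n - 1 \<Longrightarrow> \<not> crosses (z t) y (z j) (z (j + 1))"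
  shows "odd (cnt z t (nat n) w y) \<longleftrightarrow> side_parity z n w t \<noteq> left_of (z (t - 1)) (z t) (z (t + 1)) y"
proof -
  have "det3 (z (t - 1)) (z t) (z (t + 1)) \<noteq> 0"
    by (rule proj_polygonD(3)[OF z]) (use proj_polygonD(1)[OF z] in auto)
  then have nz0: "det3 (z t) (z (t - 1)) (z (t + 1)) \<noteq> 0" using det3_swap12[of "z t" "z (t - 1)" "z (t + 1)"] by auto
  have 3: "(in_cone (z (t + 1)) w (z t) y \<noteq> crosses (z t) (z (t + 1)) w y) = sector (z t) (z (t + 1)) w y"
    by (rule of_bool_add_xor, rule sector_iff) (use nz det3_swap23[of "z t" w "z (t + 1)"] in auto)
  have 4: "(in_cone (z (t - 1)) w (z t) y \<noteq> crosses (z t) (z (t - 1)) w y) = sector (z t) (z (t - 1)) w y"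
    by (rule of_bool_add_xor, rule sector_iff) (use nz det3_swap23[of "z t" w "z (t - 1)"] in auto)
  show ?thesis
    by (rule side_parity_visible_aux[OF z _ pe vis], unfold 3 4, rule left_of_change) (use nz nz0 in auto)
qed

text \<open>Pasch's theorem for the triangle \<open>w\<close>, \<open>z t\<close>,
  \<open>z (t + 1)\<close> and the \<open>n - 3\<close> edges that touch neither of these two
  vertices. The two neighbouring edges contribute sectors, which account for the change of
  corner.\<close>

lemma side_parity_Suc:
  assumes z: "proj_polygon z n" and w: "generic w z n"
  shows "side_parity z n w (t + 1) = side_parity z n w t"
proof -
  define m where "m = nat (n - 3)"
  have n: "nat (n - 2) = Suc 0 + m" "nat (n - 2) = m + Suc 0" "n = int m + 3"
    using proj_polygonD(1)[OF z] by (auto simp: m_def)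
  have zt: "z (t + n - 1) = z (t - 1)" "z (t + n) = z t"
    using proj_polygonD(2)[OF z, of "t - 1"] proj_polygonD(2)[OF z, of t] by (simp_all add: algebra_simps)
  let ?a = "z (t - 1)" and ?b = "z t" and ?c = "z (t + 1)" and ?d = "z (t + 2)"
  have gp: "det3 (z i) (z j) (z k) \<noteq> 0" if "distinct [i, j, k]" "{i, j, k} \<subseteq> {t..<t + n}" for i j k
    using proj_polygon_gp[OF z that] .
  have gw: "det3 w (z i) (z j) \<noteq> 0" if "i \<noteq> j" "{i, j} \<subseteq> {t..<t + n}" for i j
    using genericD[OF w that] .
  have M1: "cnt z (t + 1) (nat (n - 2)) w ?b = of_bool (crosses w ?b ?c ?d) + cnt z (t + 2) m w ?b"
    unfolding n(1) cnt_add cnt_1 by (simp add: algebra_simps)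
  have M2: "cnt z (t + 1 + 1) (nat (n - 2)) w ?c = cnt z (t + 2) m w ?c + of_bool (crosses w ?c ?a ?b)"
    unfolding n(2) cnt_add cnt_1 using zt n(3) by (simp add: algebra_simps)
  have "even (cnt z (t + 2) m w ?b + cnt z (t + 2) m ?b ?c + cnt z (t + 2) m w ?c + of_bool (in_cone (z (t + 2)) w ?b ?c)
    + of_bool (in_cone (z (t + 2 + int m)) w ?b ?c))"
  proof (rule pasch_path)
    fix j assume "j < m"
    then show "pasch_even w ?b ?c (z (t + 2 + int j)) (z (t + 2 + int j + 1))"
      unfolding pasch_even_def by (intro pasch gp gw) (use n(3) in auto)
  qed
  moreover have "cnt z (t + 2) m ?b ?c = 0"
    by (rule cnt_eq_0, rule proj_polygonD(4)[OF z]) (use n(3) in auto)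
  moreover have "z (t + 2 + int m) = ?a" using zt n(3) by (simp add: algebra_simps)
  ultimately have 2: "even (cnt z (t + 2) m w ?b + cnt z (t + 2) m w ?c + of_bool (in_cone ?d w ?b ?c) + of_bool (in_cone ?a w ?b ?c))"
    by simp
  have ga: "det3 ?a ?b ?c \<noteq> 0" "det3 ?b ?c ?d \<noteq> 0" "det3 w ?a ?b \<noteq> 0" "det3 w ?b ?c \<noteq> 0" "det3 w ?c ?d \<noteq> 0"
    "det3 w ?b ?d \<noteq> 0" "det3 w ?a ?c \<noteq> 0"
    using gp[of "t + n - 1" t "t + 1"] gp[of t "t + 1" "t + 2"] gw[of "t + n - 1" t] gw[of t "t + 1"] gw[of "t + 1" "t + 2"]
      gw[of t "t + 2"] gw[of "t + n - 1" "t + 1"] n(3) unfolding zt by auto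
  have perm: "det3 ?c w ?b = - det3 w ?c ?b" "det3 ?c w ?d = - det3 w ?c ?d" "det3 ?c ?d ?b = det3 ?b ?c ?d"
    "det3 w ?d ?b = - det3 w ?b ?d" "det3 ?b w ?c = - det3 w ?b ?c" "det3 ?b w ?a = det3 w ?a ?b" "det3 ?b ?a ?c = - det3 ?a ?b ?c"
    "det3 w ?c ?b = - det3 w ?b ?c" "det3 ?b ?c w = det3 w ?b ?c" "det3 ?b ?a w = - det3 w ?a ?b" "det3 ?c ?b ?d = - det3 ?b ?c ?d"
    "det3 ?c ?b w = - det3 w ?b ?c" "det3 ?c ?d w = det3 w ?c ?d"
    by (simp_all add: det3_expand algebra_simps)
  have 3: "(in_cone ?d w ?c ?b \<noteq> crosses ?c ?d w ?b) = sector ?c ?d w ?b"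
    by (rule of_bool_add_xor, rule sector_iff) (use ga in \<open>auto simp: perm\<close>)
  have 4: "(in_cone ?a w ?b ?c \<noteq> crosses ?b ?a w ?c) = sector ?b ?a w ?c"
    by (rule of_bool_add_xor, rule sector_iff) (use ga in \<open>auto simp: perm\<close>)
  have 5: "crosses w ?b ?c ?d = crosses ?c ?d w ?b" "crosses w ?c ?a ?b = crosses ?b ?a w ?c"
    using crosses_commute crosses_flip1 by blast+
  have 6: "in_cone ?d w ?c ?b = in_cone ?d w ?b ?c" by (rule in_cone_swap)
  have 7: "left_of ?a ?b ?c w \<longleftrightarrow> (0 < det3 ?b ?c w) \<noteq> sector ?b ?a w ?c"
    by (rule left_of_sector1) (use ga in \<open>auto simp: perm\<close>)
  have 8: "left_of ?b ?c ?d w \<longleftrightarrow> (0 < det3 ?b ?c w) \<noteq> sector ?c ?d w ?b"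
    by (rule left_of_sector2) (use ga in \<open>auto simp: perm\<close>)
  have 9: "t + 1 - 1 = t" "t + 1 + 1 = t + 2" by simp_all
  have "\<not> odd (cnt z (t + 2) m w ?b + cnt z (t + 2) m w ?c + of_bool (in_cone ?d w ?b ?c) + of_bool (in_cone ?a w ?b ?c))"
    using 2 by blast
  then show ?thesis
    using 3 4 7 8 unfolding side_parity_def M1 M2 unfolding 9 5 6 odd_add_xor odd_of_bool by argo
qed

lemma side_parity_const:
  assumes "proj_polygon z n" "generic w z n"
  shows "side_parity z n w s = side_parity z n w t"
proof -
  have "side_parity z n w i = side_parity z n w 0" for i
    by (induction i rule: int_induct[where k = 0])
      (use side_parity_Suc[OF assms] in simp, use side_parity_Suc[OF assms] in simp,
       use side_parity_Suc[OF assms, of "_ - 1"] in simp)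
  then show ?thesis by metis
qed

lemma cnt_shift:
  assumes "\<And>i. z (i + n) = z i"
  shows "cnt z (i + n) m a b = cnt z i m a b"
proof -
  have "z (i + n + int j) = z (i + int j)" "z (i + n + int j + 1) = z (i + int j + 1)" for j
    using assms[of "i + int j"] assms[of "i + int j + 1"] by (simp_all add: algebra_simps)
  then show ?thesis by (simp add: cnt_def)
qed

text \<open>An uncrossed chord stays on one side of the polygon, so it leaves both its ends on the
  same side. The parities at the two ends are compared through the triangle of \<open>w\<close> and
  the chord, separately on the two paths into which the chord cuts the polygon.\<close>

lemma side_parity_chord:
  assumes z: "proj_polygon z n" and w: "generic w z n"
    and s: "t + 2 \<le> s" "s + 2 \<le> t + n"
    and unc: "\<And>j. t + 1 \<le> j \<Longrightarrow> j \<le> t + n - 2 \<Longrightarrow> j \<noteq> s \<Longrightarrow> j \<noteq> s - 1 \<Longrightarrow> \<not> crosses (z t) (z s) (z j) (z (j + 1))"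
  shows "left_of (z (t - 1)) (z t) (z (t + 1)) (z s) = left_of (z (s - 1)) (z s) (z (s + 1)) (z t)"
proof -
  \<comment> \<open>The numbers of edges on the two paths that touch neither end of the
    chord.\<close>
  define a b where "a = nat (s - t - 2)" and "b = nat (t + n - s - 2)"
  have ab: "s = t + int a + 2" "n = int a + int b + 4" using s by (auto simp: a_def b_def)
  have n: "nat (n - 2) = a + (Suc 0 + (Suc 0 + b))" "nat (n - 2) = b + (Suc 0 + (Suc 0 + a))" using ab by auto
  have per: "z (i + n) = z i" for i using proj_polygonD(2)[OF z] .
  have zt: "z (t + n - 1) = z (t - 1)" "z (t + n) = z t" "z (t + n + 1) = z (t + 1)"
    using per[of "t - 1"] per[of t] per[of "t + 1"] by (simp_all add: algebra_simps)
  let ?p = "z (t - 1)" and ?q = "z t" and ?r = "z (t + 1)" and ?p' = "z (s - 1)" and ?q' = "z s" and ?r' = "z (s + 1)"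
  have gp: "det3 (z i) (z j) (z k) \<noteq> 0" if "distinct [i, j, k]" "{i, j, k} \<subseteq> {t..<t + n}" for i j k
    using proj_polygon_gp[OF z that] .
  have gw: "det3 w (z i) (z j) \<noteq> 0" if "i \<noteq> j" "{i, j} \<subseteq> {t..<t + n}" for i j
    using genericD[OF w that] .
  have M1: "cnt z (t + 1) (nat (n - 2)) w ?q = cnt z (t + 1) a w ?q + of_bool (crosses w ?q ?p' ?q') +
       of_bool (crosses w ?q ?q' ?r') + cnt z (s + 1) b w ?q"
    unfolding n(1) cnt_add cnt_1 using ab by (simp add: algebra_simps)
  have ix: "s + 1 + int b = t + n - 1" "t + n - 1 + int (Suc 0) = t + n" "t + n + int (Suc 0) = t + 1 + n"
     "t + n - 1 + 1 = t + n"
    using ab by simp_all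
  have M2: "cnt z (s + 1) (nat (n - 2)) w ?q' = cnt z (s + 1) b w ?q' + (of_bool (crosses w ?q' ?p ?q) +
       (of_bool (crosses w ?q' ?q ?r) + cnt z (t + 1) a w ?q'))"
    unfolding n(2) cnt_add cnt_1 ix zt cnt_shift[of z n, OF per] ..
  have "even (cnt z (t + 1) a w ?q + cnt z (t + 1) a ?q ?q' + cnt z (t + 1) a w ?q' + of_bool (in_cone (z (t + 1)) w ?q ?q')
    + of_bool (in_cone (z (t + 1 + int a)) w ?q ?q'))"
  proof (rule pasch_path)
    fix j assume "j < a"
    then show "pasch_even w ?q ?q' (z (t + 1 + int j)) (z (t + 1 + int j + 1))"
      unfolding pasch_even_def by (intro pasch gp gw) (use ab in auto)
  qed
  moreover have "cnt z (t + 1) a ?q ?q' = 0"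
    by (rule cnt_eq_0, rule unc) (use ab in auto)
  moreover have "z (t + 1 + int a) = ?p'" using ab by (simp add: algebra_simps)
  ultimately have 1: "even (cnt z (t + 1) a w ?q + cnt z (t + 1) a w ?q' + of_bool (in_cone ?r w ?q ?q') + of_bool (in_cone ?p' w ?q ?q'))"
    by simp
  have "even (cnt z (s + 1) b w ?q + cnt z (s + 1) b ?q ?q' + cnt z (s + 1) b w ?q' + of_bool (in_cone (z (s + 1)) w ?q ?q')
    + of_bool (in_cone (z (s + 1 + int b)) w ?q ?q'))"
  proof (rule pasch_path)
    fix j assume "j < b"
    then show "pasch_even w ?q ?q' (z (s + 1 + int j)) (z (s + 1 + int j + 1))"
      unfolding pasch_even_def by (intro pasch gp gw) (use ab in auto)
  qed
  moreover have "cnt z (s + 1) b ?q ?q' = 0"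
    by (rule cnt_eq_0, rule unc) (use ab in auto)
  moreover have "z (s + 1 + int b) = ?p" using zt ab by (simp add: algebra_simps)
  ultimately have 2: "even (cnt z (s + 1) b w ?q + cnt z (s + 1) b w ?q' + of_bool (in_cone ?r' w ?q ?q') + of_bool (in_cone ?p w ?q ?q'))"
    by simp
  have g0: "det3 ?p ?q ?r \<noteq> 0" "det3 ?p' ?q' ?r' \<noteq> 0"
    by (rule proj_polygonD(3)[OF z]; use ab in simp)+
  have "det3 (z (t + n - 1)) ?q ?q' \<noteq> 0" "det3 ?r ?q ?q' \<noteq> 0" "det3 ?p' ?q ?q' \<noteq> 0" "det3 ?r' ?q ?q' \<noteq> 0"
    by (rule gp; use ab in simp)+
  note g1 = this[unfolded zt]
  have "det3 w (z (t + n - 1)) ?q \<noteq> 0" "det3 w ?q ?r \<noteq> 0" "det3 w (z (t + n - 1)) ?q' \<noteq> 0" "det3 w ?r ?q' \<noteq> 0"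
     "det3 w ?p' ?q \<noteq> 0" "det3 w ?p' ?q' \<noteq> 0" "det3 w ?r' ?q \<noteq> 0" "det3 w ?r' ?q' \<noteq> 0" "det3 w ?q ?q' \<noteq> 0"
    by (rule gw; use ab in simp)+
  note g2 = this[unfolded zt]
  have perm: "det3 c b a = - det3 a b c" "det3 b a c = - det3 a b c" "det3 b c a = det3 a b c" "det3 c a b = det3 a b c" "det3 a c b = - det3 a b c"
    for a b c by (simp_all add: det3_expand algebra_simps)
  have 11: "(in_cone ?r w ?q ?q' \<noteq> crosses ?q ?r w ?q') = sector ?q ?r w ?q'"
    by (rule of_bool_add_xor, rule sector_iff) (use g1 g2 perm[of w ?q ?q'] perm[of w ?q ?r] perm[of ?r ?q ?q'] perm[of w ?r ?q'] in auto)
  have 12: "(in_cone ?p w ?q ?q' \<noteq> crosses ?q ?p w ?q') = sector ?q ?p w ?q'"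
    by (rule of_bool_add_xor, rule sector_iff) (use g1 g2 perm[of w ?q ?q'] perm[of w ?p ?q] perm[of ?p ?q ?q'] perm[of w ?p ?q'] in auto)
  have 13: "(in_cone ?r' w ?q' ?q \<noteq> crosses ?q' ?r' w ?q) = sector ?q' ?r' w ?q"
    by (rule of_bool_add_xor, rule sector_iff) (use g1 g2 perm[of w ?q ?q'] perm[of w ?r' ?q'] perm[of ?r' ?q ?q'] perm[of w ?r' ?q] in auto)
  have 14: "(in_cone ?p' w ?q' ?q \<noteq> crosses ?q' ?p' w ?q) = sector ?q' ?p' w ?q"
    by (rule of_bool_add_xor, rule sector_iff) (use g1 g2 perm[of w ?q ?q'] perm[of w ?p' ?q'] perm[of ?p' ?q ?q'] perm[of w ?p' ?q] in auto)
  have 15: "in_cone ?r' w ?q' ?q = in_cone ?r' w ?q ?q'" "in_cone ?p' w ?q' ?q = in_cone ?p' w ?q ?q'" by (rule in_cone_swap)+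
  have 16: "crosses w ?q ?p' ?q' = crosses ?q' ?p' w ?q" "crosses w ?q ?q' ?r' = crosses ?q' ?r' w ?q"
     "crosses w ?q' ?p ?q = crosses ?q ?p w ?q'" "crosses w ?q' ?q ?r = crosses ?q ?r w ?q'"
    using crosses_commute crosses_flip1 by blast+
  have 17: "left_of ?p ?q ?r w \<noteq> left_of ?p ?q ?r ?q' \<longleftrightarrow> sector ?q ?r w ?q' \<noteq> sector ?q ?p w ?q'"
    by (rule left_of_change) (use g0 g1 g2 perm[of ?p ?q ?r] perm[of w ?p ?q] perm[of ?p ?q ?q'] perm[of w ?q ?r] perm[of ?r ?q ?q'] perm[of w ?q ?q'] in auto)
  have 18: "left_of ?p' ?q' ?r' w \<noteq> left_of ?p' ?q' ?r' ?q \<longleftrightarrow> sector ?q' ?r' w ?q \<noteq> sector ?q' ?p' w ?q"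
    by (rule left_of_change) (use g0 g1 g2 perm[of ?p' ?q' ?r'] perm[of w ?p' ?q'] perm[of ?p' ?q ?q'] perm[of w ?r' ?q'] perm[of ?r' ?q ?q'] perm[of w ?q ?q'] in auto)
  have 19: "side_parity z n w s = side_parity z n w t" by (rule side_parity_const[OF z w])
  have "\<not> odd (cnt z (t + 1) a w ?q + cnt z (t + 1) a w ?q' + of_bool (in_cone ?r w ?q ?q') + of_bool (in_cone ?p' w ?q ?q'))"
    "\<not> odd (cnt z (s + 1) b w ?q + cnt z (s + 1) b w ?q' + of_bool (in_cone ?r' w ?q ?q') + of_bool (in_cone ?p w ?q ?q'))"
    using 1 2 by blast+
  then show ?thesis
    using 11 12 13 14 17 18 19 unfolding side_parity_def M1 M2 15 16 odd_add_xor odd_of_bool by argo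
qed

subsection \<open>Visibility, chords and ears\<close>

lemma crossesI:
  assumes "x *\<^sub>R a + y *\<^sub>R b = u *\<^sub>R c + v *\<^sub>R d" "0 < x" "0 < y" "0 < u" "0 < v" "det3 b c d \<noteq> 0"
  shows "crosses a b c d"
proof -
  have "det3 (x *\<^sub>R a + y *\<^sub>R b) c d = 0" unfolding assms(1) by (simp add: det3_add det3_scaleR)
  then have 1: "x * det3 a c d = - (y * det3 b c d)" by (simp add: det3_add det3_scaleR)
  have "det3 a (x *\<^sub>R a + y *\<^sub>R b) c = v * det3 a d c" unfolding assms(1) by (simp add: det3_add det3_scaleR)
  then have 2: "y * det3 a b c = - (v * det3 a c d)" by (simp add: det3_add det3_scaleR det3_swap23[of a d c])
  have "det3 a b (u *\<^sub>R c + v *\<^sub>R d) = 0" unfolding assms(1)[symmetric] by (simp add: det3_add det3_scaleR)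
  then have 3: "u * det3 a b c = - (v * det3 a b d)" by (simp add: det3_add det3_scaleR)
  have s: "(0 < p) = (q < 0)" "(p < 0) = (0 < q)" if "x * p = - (y * q)" "0 < x" "0 < y" for x y p q :: real
  proof -
    have "0 < p \<longleftrightarrow> 0 < x * p" "p < 0 \<longleftrightarrow> x * p < 0" "q < 0 \<longleftrightarrow> y * q < 0" "0 < q \<longleftrightarrow> 0 < y * q"
      using that(2,3) by (simp_all add: zero_less_mult_iff mult_less_0_iff)
    then show "(0 < p) = (q < 0)" "(p < 0) = (0 < q)" using that(1) by argo+
  qed
  show ?thesis
    unfolding crosses_def mult_less_0_iff zero_less_mult_iff
    using s[OF 1 assms(2,3)] s[OF 2 assms(3,5)] s[OF 3 assms(4,5)] assms(6) by argo
qed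

lemma crossesE:
  assumes "crosses a b c d"
  obtains x y u v where "0 < x" "0 < y" "0 < u" "0 < v" "x *\<^sub>R a + y *\<^sub>R b = u *\<^sub>R c + v *\<^sub>R d"
proof -
  have cr: "det3 b c d *\<^sub>R a - det3 a c d *\<^sub>R b + det3 a b d *\<^sub>R c - det3 a b c *\<^sub>R d = 0"
    by (rule det3_cramer)
  show thesis
  proof (cases "0 < det3 b c d")
    case True
    then have "0 < det3 b c d" "0 < - det3 a c d" "0 < - det3 a b d" "0 < det3 a b c"
      using assms unfolding crosses_def by (auto simp: mult_less_0_iff zero_less_mult_iff)
    moreover have "det3 b c d *\<^sub>R a + (- det3 a c d) *\<^sub>R b = (- det3 a b d) *\<^sub>R c + det3 a b c *\<^sub>R d"
      using cr by (simp add: algebra_simps)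
    ultimately show thesis by (rule that)
  next
    case False
    then have "0 < - det3 b c d" "0 < det3 a c d" "0 < det3 a b d" "0 < - det3 a b c"
      using assms unfolding crosses_def by (auto simp: mult_less_0_iff zero_less_mult_iff)
    moreover have "(- det3 b c d) *\<^sub>R a + det3 a c d *\<^sub>R b = det3 a b d *\<^sub>R c + (- det3 a b c) *\<^sub>R d"
      using cr by (simp add: algebra_simps)
    ultimately show thesis by (rule that)
  qed
qed

lemma crosses_minus [simp]: "crosses (- a) (- b) (- c) (- d) = crosses a b c d"
  by (simp add: crosses_def)

lemma crosses_minus2: "crosses (- a) (- b) c d = crosses a b (- c) (- d)"
  by (simp add: crosses_def)

lemma in_cone_minus [simp]: "in_cone (- y) (- p) (- q) (- r) = in_cone y p q r"
  by (simp add: in_cone_def)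

lemma in_cone_flip: "in_cone y r q p = in_cone y p q r"
proof -
  have e: "det3 y q p = - det3 p q y" "det3 r q p = - det3 p q r" "det3 r y p = - det3 p y r" "det3 r q y = - det3 y q r"
    by (simp_all add: det3_expand algebra_simps)
  show ?thesis unfolding in_cone_def e by auto
qed

text \<open>In the basis \<open>p, q, r\<close> this is the sum of the outer coordinates divided by
  the middle one: zero at \<open>q\<close>, invariant under scaling, and growing towards the side
  \<open>p r\<close>. In the plane through \<open>p\<close>, \<open>q\<close> and \<open>r\<close>
  its level lines are parallel to that side.\<close>

definition cone_dist :: "real^3 \<Rightarrow> real^3 \<Rightarrow> real^3 \<Rightarrow> real^3 \<Rightarrow> real" where
  "cone_dist p q r y = (det3 y q r + det3 p q y) / det3 p y r"

lemma cone_dist_flip: "cone_dist r q p y = cone_dist p q r y"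
proof -
  have e: "det3 y q p = - det3 p q y" "det3 r q y = - det3 y q r" "det3 r y p = - det3 p y r"
    by (simp_all add: det3_expand algebra_simps)
  have "- x + - y = - (x + y)" for x y :: real by simp
  then show ?thesis unfolding cone_dist_def e by (metis add.commute minus_divide_divide)
qed

lemma cone_coords: "det3 p q r *\<^sub>R v = det3 v q r *\<^sub>R p + det3 p v r *\<^sub>R q + det3 p q v *\<^sub>R r"
  by (simp add: vec_eq_iff forall_3 det3_expand algebra_simps)

text \<open>Assumption \<open>h\<close> says that \<open>c\<close> is the end towards which the arc
  does not recede from \<open>q\<close>. Going from \<open>x\<close> to \<open>c\<close>, the arc
  either stays in the triangle or leaves through a side at \<open>q\<close>. The assumptions
  \<open>deg\<close> admit ends that are plus or minus \<open>p\<close> or \<open>r\<close>.\<close>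

lemma near_cross_aux:
  assumes A: "0 < det3 p q r" and y: "in_cone y p q r"
    and x: "0 < lx" "0 < mx" "x = lx *\<^sub>R q + mx *\<^sub>R y" "0 < gx" "0 < dx" "x = gx *\<^sub>R c + dx *\<^sub>R d"
    and nz: "det3 q c d \<noteq> 0"
    and deg: "det3 c q r = 0 \<Longrightarrow> det3 p c r = 0" "det3 p q c = 0 \<Longrightarrow> det3 p c r = 0"
    and h: "(det3 c q r + det3 p q c) * det3 p x r \<le> det3 p c r * (det3 x q r + det3 p q x)"
  shows "in_cone c p q r \<and> cone_dist p q r c < cone_dist p q r y \<or> crosses p q c d \<or> crosses q r c d"
proof -
  define a b g where "a = (\<lambda>v. det3 v q r)" "b = (\<lambda>v. det3 p v r)" "g = (\<lambda>v. det3 p q v)"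
  note defs = this
  have lin: "a (s *\<^sub>R u + t *\<^sub>R v) = s * a u + t * a v" "b (s *\<^sub>R u + t *\<^sub>R v) = s * b u + t * b v"
    "g (s *\<^sub>R u + t *\<^sub>R v) = s * g u + t * g v" for s t u v
    unfolding defs by (simp_all add: det3_add det3_scaleR)
  have y': "0 < a y" "0 < b y" "0 < g y" using y A unfolding in_cone_def defs by (simp_all add: zero_less_mult_iff)
  have q: "a q = 0" "g q = 0" "0 < b q" using A unfolding defs by simp_all
  have ax: "a x = mx * a y" "g x = mx * g y" "b x = lx * b q + mx * b y" unfolding x(3) lin using q by simp_all
  have x': "0 < a x" "0 < g x" "0 < b x" unfolding ax using x y' q by (simp_all add: add_pos_pos)
  have h': "(a c + g c) * b x \<le> b c * (a x + g x)" using h unfolding defs .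
  have xy: "(a x + g x) * b y < (a y + g y) * b x"
  proof -
    have "(a x + g x) * b y = (a y + g y) * (mx * b y)" unfolding ax by (simp add: algebra_simps)
    also have "\<dots> < (a y + g y) * b x" unfolding ax using x y' q by simp
    finally show ?thesis .
  qed
  have D: "a x * g c - a c * g x \<noteq> 0"
  proof -
    have "a x * g c - a c * g x = dx * (a d * g c - a c * g d)"
      unfolding x(6) lin by (simp add: algebra_simps)
    also have "a d * g c - a c * g d = det3 p q r * det3 q c d"
      unfolding defs by (simp add: det3_expand algebra_simps)
    finally show ?thesis using x A nz by simp
  qed
  have case_a: ?thesis if ac: "a c < 0" and gv: "0 < a x * g c - a c * g x"
  proof -
    \<comment> \<open>The point where the arc from \<open>x\<close> to \<open>c\<close> meets the
      plane of \<open>q\<close> and \<open>r\<close>; \<open>h\<close> keeps its middle coordinate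
      positive, so it lies on the side \<open>q r\<close>.\<close>
    define v where "v = a x *\<^sub>R c + (- a c) *\<^sub>R x"
    have v: "a v = 0" "g v = a x * g c - a c * g x" "b v = a x * b c - a c * b x" unfolding v_def lin by simp_all
    have "(a v + g v) * b x \<le> b v * (a x + g x)"
    proof -
      have "a x * ((a c + g c) * b x) \<le> a x * (b c * (a x + g x))" using h' x' by (intro mult_left_mono) auto
      then show ?thesis unfolding v by (simp add: algebra_simps)
    qed
    moreover have "0 < (a v + g v) * b x" using v gv x' by simp
    ultimately have "0 < b v * (a x + g x)" by linarith
    then have bv: "0 < b v" using x' by (simp add: zero_less_mult_iff)
    have "det3 p q r *\<^sub>R v = b v *\<^sub>R q + g v *\<^sub>R r" using cone_coords[of p q r v] v(1) unfolding defs by simp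
    moreover have "v = (a x - a c * gx) *\<^sub>R c + (- a c * dx) *\<^sub>R d" unfolding v_def x(6) by (simp add: algebra_simps)
    ultimately have eq: "g v *\<^sub>R r + b v *\<^sub>R q = (det3 p q r * (a x - a c * gx)) *\<^sub>R c + (det3 p q r * (- a c * dx)) *\<^sub>R d"
      by (metis add.commute scaleR_add_right scaleR_scaleR)
    have "0 < det3 p q r * (a x - a c * gx)" "0 < det3 p q r * (- a c * dx)"
    proof -
      have "a c * gx < 0" "a c * dx < 0" using ac x by (simp_all add: mult_neg_pos)
      then have "0 < a x - a c * gx" "0 < - a c * dx" using x' by simp_all
      then show "0 < det3 p q r * (a x - a c * gx)" "0 < det3 p q r * (- a c * dx)"
        using A by (blast intro: mult_pos_pos)+
    qed
    from crossesI[OF eq _ bv this nz] have "crosses r q c d" using v gv by simp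
    then show ?thesis using crosses_flip1 by blast
  qed
  have case_g: ?thesis if gc: "g c < 0" and av: "0 < g x * a c - g c * a x"
  proof -
    define v where "v = g x *\<^sub>R c + (- g c) *\<^sub>R x"
    have v: "g v = 0" "a v = g x * a c - g c * a x" "b v = g x * b c - g c * b x" unfolding v_def lin by simp_all
    have "(a v + g v) * b x \<le> b v * (a x + g x)"
    proof -
      have "g x * ((a c + g c) * b x) \<le> g x * (b c * (a x + g x))" using h' x' by (intro mult_left_mono) auto
      then show ?thesis unfolding v by (simp add: algebra_simps)
    qed
    moreover have "0 < (a v + g v) * b x" using v av x' by simp
    ultimately have "0 < b v * (a x + g x)" by linarith
    then have bv: "0 < b v" using x' by (simp add: zero_less_mult_iff)
    have "det3 p q r *\<^sub>R v = a v *\<^sub>R p + b v *\<^sub>R q" using cone_coords[of p q r v] v(1) unfolding defs by simp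
    moreover have "v = (g x - g c * gx) *\<^sub>R c + (- g c * dx) *\<^sub>R d" unfolding v_def x(6) by (simp add: algebra_simps)
    ultimately have eq: "a v *\<^sub>R p + b v *\<^sub>R q = (det3 p q r * (g x - g c * gx)) *\<^sub>R c + (det3 p q r * (- g c * dx)) *\<^sub>R d"
      by (metis scaleR_add_right scaleR_scaleR)
    have "0 < det3 p q r * (g x - g c * gx)" "0 < det3 p q r * (- g c * dx)"
    proof -
      have "g c * gx < 0" "g c * dx < 0" using gc x by (simp_all add: mult_neg_pos)
      then have "0 < g x - g c * gx" "0 < - g c * dx" using x' by simp_all
      then show "0 < det3 p q r * (g x - g c * gx)" "0 < det3 p q r * (- g c * dx)"
        using A by (blast intro: mult_pos_pos)+
    qed
    from crossesI[OF eq _ bv this nz] have "crosses p q c d" using v av by simp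
    then show ?thesis by blast
  qed
  show ?thesis
  proof (cases "0 < a c \<and> 0 < g c")
    case True
    then have "0 < (a c + g c) * b x" using x' by simp
    then have "0 < b c * (a x + g x)" using h' by linarith
    then have bc: "0 < b c" using x' by (simp add: zero_less_mult_iff)
    then have "in_cone c p q r" using True A unfolding in_cone_def defs by simp
    moreover have "(a c + g c) / b c < (a y + g y) / b y"
    proof -
      have "(a c + g c) / b c \<le> (a x + g x) / b x" using h' bc x' by (simp add: field_simps)
      also have "\<dots> < (a y + g y) / b y" using xy y' x' by (simp add: field_simps)
      finally show ?thesis .
    qed
    ultimately show ?thesis unfolding cone_dist_def defs by blast
  next
    case False
    then consider "a c < 0" "0 \<le> g c" | "g c < 0" "0 \<le> a c" | "a c < 0" "g c < 0" | "a c = 0" "0 \<le> g c" | "g c = 0" "0 \<le> a c"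
      by linarith
    then show ?thesis
    proof cases
      case 1
      then have "0 < - a c * g x" "0 \<le> a x * g c" using x' by (simp_all add: mult_neg_pos)
      then show ?thesis using case_a 1 by simp
    next
      case 2
      then have "0 < - g c * a x" "0 \<le> g x * a c" using x' by (simp_all add: mult_neg_pos)
      then show ?thesis using case_g 2 by simp
    next
      case 3
      \<comment> \<open>Both outer coordinates become negative; the sign of the nonzero quantity in
        \<open>D\<close> says which plane is met first.\<close>
      then show ?thesis using case_a case_g D by (smt (verit) mult.commute)
    next
      case 4
      then have "0 < g c" using D x' by (cases "g c = 0") auto
      then have "0 < (a c + g c) * b x" using x' 4 by simp
      then have "0 < b c * (a x + g x)" using h' by linarith
      then show ?thesis using deg(1) 4 unfolding defs by simp
    next
      case 5
      then have "0 < a c" using D x' by (cases "a c = 0") auto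
      then have "0 < (a c + g c) * b x" using x' 5 by simp
      then have "0 < b c * (a x + g x)" using h' by linarith
      then show ?thesis using deg(2) 5 unfolding defs by simp
    qed
  qed
qed

lemma near_cross_pos:
  assumes A: "0 < det3 p q r" and y: "in_cone y p q r" and cr: "crosses q y c d"
    and deg: "det3 c q r = 0 \<Longrightarrow> det3 p c r = 0" "det3 p q c = 0 \<Longrightarrow> det3 p c r = 0"
      "det3 d q r = 0 \<Longrightarrow> det3 p d r = 0" "det3 p q d = 0 \<Longrightarrow> det3 p d r = 0"
  shows "in_cone c p q r \<and> cone_dist p q r c < cone_dist p q r y \<or>
    in_cone d p q r \<and> cone_dist p q r d < cone_dist p q r y \<or> crosses p q c d \<or> crosses q r c d"
proof -
  obtain lx mx gx dx where x: "0 < lx" "0 < mx" "0 < gx" "0 < dx" "lx *\<^sub>R q + mx *\<^sub>R y = gx *\<^sub>R c + dx *\<^sub>R d"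
    using crossesE[OF cr] .
  define x where "x = lx *\<^sub>R q + mx *\<^sub>R y"
  have x2: "x = gx *\<^sub>R c + dx *\<^sub>R d" "x = dx *\<^sub>R d + gx *\<^sub>R c" using x(5) by (simp_all add: x_def)
  have nz: "det3 q c d \<noteq> 0" using cr unfolding crosses_def by auto
  then have nz': "det3 q d c \<noteq> 0" using det3_swap23[of q d c] by simp
  \<comment> \<open>A linear form that compares distances with the crossing point \<open>x\<close>
    and vanishes there. As \<open>x\<close> is a positive combination of \<open>c\<close> and
    \<open>d\<close>, it cannot be positive at both.\<close>
  define h where "h = (\<lambda>v. (det3 v q r + det3 p q v) * det3 p x r - det3 p v r * (det3 x q r + det3 p q x))"
  have "gx * h c + dx * h d = h x"
    unfolding h_def by (subst (5 6 7) x2(1)) (simp add: det3_add det3_scaleR algebra_simps)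
  also have "h x = 0" by (simp add: h_def algebra_simps)
  finally have "gx * h c + dx * h d = 0" .
  then have "h c \<le> 0 \<or> h d \<le> 0" using x(3,4)
    by (smt (verit) mult_pos_pos)
  then show ?thesis
  proof
    assume "h c \<le> 0"
    then have "(det3 c q r + det3 p q c) * det3 p x r \<le> det3 p c r * (det3 x q r + det3 p q x)" by (simp add: h_def)
    from near_cross_aux[OF A y x(1,2) x_def x(3,4) x2(1) nz deg(1,2) this] show ?thesis by blast
  next
    assume "h d \<le> 0"
    then have "(det3 d q r + det3 p q d) * det3 p x r \<le> det3 p d r * (det3 x q r + det3 p q x)" by (simp add: h_def)
    from near_cross_aux[OF A y x(1,2) x_def x(4,3) x2(2) nz' deg(3,4) this] show ?thesis
      unfolding crosses_flip2[of _ _ d c] by blast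
  qed
qed

text \<open>If an arc separates the apex of a triangle from a point \<open>y\<close> inside, then it meets one of
  the two sides at the apex or has an end point in the triangle nearer to the apex than \<open>y\<close>.\<close>
lemma near_cross:
  assumes y: "in_cone y p q r" and cr: "crosses q y c d"
    and deg: "det3 c q r = 0 \<Longrightarrow> det3 p c r = 0" "det3 p q c = 0 \<Longrightarrow> det3 p c r = 0"
      "det3 d q r = 0 \<Longrightarrow> det3 p d r = 0" "det3 p q d = 0 \<Longrightarrow> det3 p d r = 0"
  shows "in_cone c p q r \<and> cone_dist p q r c < cone_dist p q r y \<or>
    in_cone d p q r \<and> cone_dist p q r d < cone_dist p q r y \<or> crosses p q c d \<or> crosses q r c d"
proof -
  have "det3 p q r \<noteq> 0" using y unfolding in_cone_def by auto
  then consider "0 < det3 p q r" | "0 < det3 r q p" using det3_swap13[of r q p] by linarith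
  then show ?thesis
  proof cases
    case 1
    then show ?thesis by (rule near_cross_pos[OF _ y cr deg])
  next
    case 2
    have e: "det3 v q p = - det3 p q v" "det3 r v p = - det3 p v r" "det3 r q v = - det3 v q r" for v
      by (simp_all add: det3_expand algebra_simps)
    have "in_cone c r q p \<and> cone_dist r q p c < cone_dist r q p y \<or>
      in_cone d r q p \<and> cone_dist r q p d < cone_dist r q p y \<or> crosses r q c d \<or> crosses q p c d"
      by (rule near_cross_pos[OF 2]) (use y cr deg in \<open>simp_all add: in_cone_flip e\<close>)
    then show ?thesis unfolding in_cone_flip[of _ r q p] cone_dist_flip[of r q p] crosses_flip1[of q r] crosses_flip1[of p q] by blast
  qed
qed

lemma cone_nearest:
  assumes "finite S" "y0 \<in> S" "in_cone y0 p q r"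
  obtains y where "y \<in> S" "in_cone y p q r" "\<And>c. c \<in> S \<Longrightarrow> in_cone c p q r \<Longrightarrow> cone_dist p q r y \<le> cone_dist p q r c"
proof -
  let ?S = "{c \<in> S. in_cone c p q r}"
  have "finite ?S" "?S \<noteq> {}" using assms by auto
  from ex_min_if_finite[of "cone_dist p q r ` ?S"] this
  obtain m where m: "m \<in> cone_dist p q r ` ?S" "\<not> (\<exists>x\<in>cone_dist p q r ` ?S. x < m)" by auto
  then obtain y where "y \<in> ?S" "m = cone_dist p q r y" by auto
  then show thesis using m(2) by (intro that[of y]) (auto simp: not_less)
qed

section \<open>Crossing parities at the antipodal polygon\<close>

lemma cnt_rotate:
  assumes "\<And>i. z (i + n) = z i" "0 \<le> n"
  shows "cnt z i (nat n) a b = cnt z j (nat n) a b"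
proof -
  have step: "cnt z (i + 1) (nat n) a b = cnt z i (nat n) a b" for i
  proof -
    have "cnt z i (Suc 0 + nat n) a b = cnt z i (nat n + Suc 0) a b" by simp
    then show ?thesis
      unfolding cnt_add cnt_1 using assms(2) assms(1)[of i] assms(1)[of "i + 1"]
      by (simp add: add.commute add.left_commute)
  qed
  have "cnt z i (nat n) a b = cnt z 0 (nat n) a b" for i
  proof (induction i rule: int_induct[where k = 0])
    case (step2 i)
    then show ?case using step[of "i - 1"] by simp
  qed (use step in simp_all)
  then show ?thesis by metis
qed

text \<open>For a closed polygon the two end terms of \<open>pasch_path\<close> coincide. Hence the
  end of an arc may be moved along any arc that avoids the polygon.\<close>

lemma cnt_parity_step:
  assumes z: "proj_polygon z n"
    and "\<And>j. t \<le> j \<Longrightarrow> j < t + n \<Longrightarrow> pasch_even w a b (z j) (z (j + 1))"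
    and "\<And>j. t \<le> j \<Longrightarrow> j < t + n \<Longrightarrow> \<not> crosses a b (z j) (z (j + 1))"
  shows "odd (cnt z i (nat n) w a) = odd (cnt z i (nat n) w b)"
proof -
  have n: "0 \<le> n" using proj_polygonD(1)[OF z] by simp
  have "even (cnt z t (nat n) w a + cnt z t (nat n) a b + cnt z t (nat n) w b + of_bool (in_cone (z t) w a b)
    + of_bool (in_cone (z (t + int (nat n))) w a b))"
    by (rule pasch_path, rule assms(2)) auto
  moreover have "cnt z t (nat n) a b = 0" by (rule cnt_eq_0, rule assms(3)) auto
  moreover have "z (t + int (nat n)) = z t" using n proj_polygonD(2)[OF z] by simp
  ultimately have "odd (cnt z t (nat n) w a) = odd (cnt z t (nat n) w b)" by auto
  then show ?thesis using cnt_rotate[of z n, OF proj_polygonD(2)[OF z] n] by metis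
qed

lemma pasch_even_generic:
  assumes "det3 p q r \<noteq> 0" "det3 p q c \<noteq> 0" "det3 p r c \<noteq> 0" "det3 q r c \<noteq> 0"
    "det3 p q d \<noteq> 0" "det3 p r d \<noteq> 0" "det3 q r d \<noteq> 0"
    "det3 p c d \<noteq> 0" "det3 q c d \<noteq> 0" "det3 r c d \<noteq> 0"
  shows "pasch_even p q r c d"
  unfolding pasch_even_def by (rule pasch) fact+

lemma pasch_even_antipodal2: "det3 p q r \<noteq> 0 \<Longrightarrow> det3 q r d \<noteq> 0 \<Longrightarrow> pasch_even p q r (- q) d"
  unfolding pasch_even_def by (rule pasch_antipodal)

lemma pasch_even_antipodal3:
  assumes "det3 p q r \<noteq> 0" "det3 q r d \<noteq> 0"
  shows "pasch_even p q r (- r) d"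
  using pasch_even_antipodal2[of p r q d] assms det3_swap23[of p r q] det3_swap12[of r q d]
  by (simp add: pasch_even_swap[of p r q])

lemma crosses_eq_False [simp]: "\<not> crosses a b a d" "\<not> crosses a b b d" "\<not> crosses a b d a" "\<not> crosses a b d b"
  "\<not> crosses a b (- a) d" "\<not> crosses a b (- b) d" "\<not> crosses a b d (- a)" "\<not> crosses a b d (- b)"
  "\<not> crosses (- a) b a d" "\<not> crosses a (- b) b d" "\<not> crosses (- a) b d a" "\<not> crosses a (- b) d b"
  by (simp_all add: crosses_def)

lemma in_cone_eq_False [simp]: "\<not> in_cone p p q r" "\<not> in_cone q p q r" "\<not> in_cone r p q r"
  "\<not> in_cone (- p) p q r" "\<not> in_cone (- q) p q r" "\<not> in_cone (- r) p q r"
  "\<not> in_cone p p q (- p)"  "\<not> in_cone p (- p) q p"  "\<not> in_cone p w q (- p)"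
  by (simp_all add: in_cone_def)

text \<open>The antipodal polygon avoids the polygon, so \<open>cnt_parity_step\<close> leads from
  each antipode to the next. Only the edges at \<open>z s\<close> and \<open>z (s + 1)\<close> are
  dependent on the arc between their antipodes.\<close>

lemma cnt_parity_antipodal:
  assumes z: "proj_polygon z n" and w: "generic w z n"
  shows "odd (cnt z i (nat n) w (- z s)) = odd (cnt z i (nat n) w (- z t))"
proof -
  have n: "3 \<le> n" by (rule proj_polygonD(1)[OF z])
  have step: "odd (cnt z i (nat n) w (- z s)) = odd (cnt z i (nat n) w (- z (s + 1)))" for s
  proof (rule cnt_parity_step[OF z, of s])
    have gp: "det3 (z i) (z j) (z k) \<noteq> 0" if "distinct [i, j, k]" "{i, j, k} \<subseteq> {s..<s + n}" for i j k
      using proj_polygon_gp[OF z that] .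
    have gw: "det3 w (z i) (z j) \<noteq> 0" if "i \<noteq> j" "{i, j} \<subseteq> {s..<s + n}" for i j
      using genericD[OF w that] .
    fix j assume j: "s \<le> j" "j < s + n"
    consider "j = s" | "j = s + 1" | "j = s + n - 1" "s + 2 \<le> j" | "s + 2 \<le> j" "j + 2 \<le> s + n" using j by linarith
    then have "pasch_even w (- z s) (- z (s + 1)) (z j) (z (j + 1)) \<and> \<not> crosses (- z s) (- z (s + 1)) (z j) (z (j + 1))"
    proof cases
      case 1
      then show ?thesis by (simp add: pasch_even_def) (simp add: crosses_def in_cone_def)
    next
      case 2
      have "pasch_even w (- z s) (- z (s + 1)) (- (- z (s + 1))) (z (s + 2))"
        by (rule pasch_even_antipodal3) (use gw[of s "s + 1"] gp[of s "s + 1" "s + 2"] n in auto)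
      moreover have "\<not> crosses (- z s) (- z (s + 1)) (z (s + 1)) (z (s + 2))" by (simp add: crosses_def)
      ultimately show ?thesis using 2 by (simp add: add.commute)
    next
      case 3
      have zs: "z (s + n) = z s" by (rule proj_polygonD(2)[OF z])
      have "pasch_even w (- z s) (- z (s + 1)) (- (- z s)) (z j)"
        by (rule pasch_even_antipodal2) (use gw[of s "s + 1"] gp[of s "s + 1" j] 3 n in auto)
      moreover have "\<not> crosses (- z s) (- z (s + 1)) (z j) (z s)" by (simp add: crosses_def)
      ultimately show ?thesis using 3 zs by (simp add: pasch_even_commute[of _ _ _ "z s"])
    next
      case 4
      have "pasch_even w (- z s) (- z (s + 1)) (z j) (z (j + 1))"
        by (rule pasch_even_generic)
          (use 4 in \<open>simp_all add: gw gp\<close>)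
      moreover have "\<not> crosses (- z s) (- z (s + 1)) (z j) (z (j + 1))"
        using proj_polygonD(5)[OF z, of s j] 4 by (simp add: crosses_minus2)
      ultimately show ?thesis by blast
    qed
    then show "pasch_even w (- z s) (- z (s + 1)) (z j) (z (j + 1))" "\<not> crosses (- z s) (- z (s + 1)) (z j) (z (j + 1))" by blast+
  qed
  have "odd (cnt z i (nat n) w (- z s)) = odd (cnt z i (nat n) w (- z 0))" for s
  proof (induction s rule: int_induct[where k = 0])
    case (step2 s)
    then show ?case using step[of "s - 1"] by simp
  qed (use step in simp_all)
  then show ?thesis by metis
qed

text \<open>Intended for \<open>y\<close> equal to \<open>z s\<close> or its antipode: the range of
  \<open>j\<close> leaves out the edges at \<open>z t\<close>, and those at \<open>z s\<close> are
  exempt. The view may be blocked by the polygon or by its antipode.\<close>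

definition visible :: "(int \<Rightarrow> real^3) \<Rightarrow> int \<Rightarrow> int \<Rightarrow> int \<Rightarrow> real^3 \<Rightarrow> bool" where
  "visible z n t s y \<longleftrightarrow> (\<forall>j. t + 1 \<le> j \<and> j \<le> t + n - 2 \<and> j \<noteq> s \<and> j \<noteq> s - 1 \<longrightarrow>
     \<not> crosses (z t) y (z j) (z (j + 1)) \<and> \<not> crosses (z t) y (- z j) (- z (j + 1)))"

text \<open>Replaces \<open>left_of_change\<close> when \<open>y\<close> is the antipode of a
  neighbour: one orientation vanishes, and only the other leg can be swept over.\<close>

lemma left_of_antipodal_prev:
  assumes "det3 p q r \<noteq> 0" "det3 p q w \<noteq> 0" "det3 q r w \<noteq> 0"
  shows "left_of p q r w \<noteq> left_of p q r (- p) \<longleftrightarrow> sector q r w (- p)"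
proof -
  have e: "det3 q w r = - det3 q r w" "det3 q w (- p) = - det3 p q w" "det3 q r (- p) = - det3 p q r" "det3 p q (- p) = 0"
    by (simp_all add: det3_expand algebra_simps)
  show ?thesis using assms unfolding left_of_def sector_def e by argo
qed

lemma left_of_antipodal_next:
  assumes "det3 p q r \<noteq> 0" "det3 p q w \<noteq> 0" "det3 q r w \<noteq> 0"
  shows "left_of p q r w \<noteq> left_of p q r (- r) \<longleftrightarrow> sector q p w (- r)"
proof -
  have e: "det3 q w p = det3 p q w" "det3 q w (- r) = det3 q r w" "det3 q p (- r) = det3 p q r" "det3 p q (- r) = - det3 p q r" "det3 q r (- r) = 0"
    by (simp_all add: det3_expand algebra_simps)
  show ?thesis using assms unfolding left_of_def sector_def e by argo
qed

lemma side_parity_antipodal: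
  assumes z: "proj_polygon z n" and w: "generic w z n" and s: "t + 1 \<le> s" "s \<le> t + n - 1"
    and vis: "visible z n t s (- z s)"
  shows "odd (cnt z t (nat n) w (- z s)) \<longleftrightarrow> side_parity z n w t \<noteq> left_of (z (t - 1)) (z t) (z (t + 1)) (- z s)"
proof (rule side_parity_visible_aux[OF z])
  have n: "3 \<le> n" by (rule proj_polygonD(1)[OF z])
  have gp: "det3 (z i) (z j) (z k) \<noteq> 0" if "distinct [i, j, k]" "{i, j, k} \<subseteq> {t..<t + n}" for i j k
    using proj_polygon_gp[OF z that] .
  have gw: "det3 w (z i) (z j) \<noteq> 0" if "i \<noteq> j" "{i, j} \<subseteq> {t..<t + n}" for i j
    using genericD[OF w that] .
  have zt: "z (t + n - 1) = z (t - 1)" using proj_polygonD(2)[OF z, of "t - 1"] by (simp add: algebra_simps)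
  fix j assume j: "t + 1 \<le> j" "j < t + n - 1"
  consider "j = s" | "j = s - 1" | "j \<noteq> s" "j \<noteq> s - 1" by blast
  then have "pasch_even w (z t) (- z s) (z j) (z (j + 1)) \<and> \<not> crosses (z t) (- z s) (z j) (z (j + 1))"
  proof cases
    case 1
    have "pasch_even w (z t) (- z s) (- (- z s)) (z (j + 1))"
      by (rule pasch_even_antipodal3) (use gw[of t s] gp[of t s "j + 1"] 1 j in auto)
    then show ?thesis using 1 by simp
  next
    case 2
    have "pasch_even w (z t) (- z s) (- (- z s)) (z j)"
      by (rule pasch_even_antipodal3) (use gw[of t s] gp[of t s j] 2 j s in auto)
    then show ?thesis using 2 by (simp add: pasch_even_commute[of _ _ _ "z s"])
  next
    case 3
    have "pasch_even w (z t) (- z s) (z j) (z (j + 1))"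
      by (rule pasch_even_generic)
        (use 3 j s in \<open>simp_all add: gw gp\<close>)
    then show ?thesis using 3 vis j unfolding visible_def by auto
  qed
  then show "pasch_even w (z t) (- z s) (z j) (z (j + 1))" "\<not> crosses (z t) (- z s) (z j) (z (j + 1))" by blast+
next
  have n: "3 \<le> n" by (rule proj_polygonD(1)[OF z])
  have zt: "z (t + n - 1) = z (t - 1)" using proj_polygonD(2)[OF z, of "t - 1"] by (simp add: algebra_simps)
  let ?p = "z (t - 1)" and ?q = "z t" and ?r = "z (t + 1)" and ?y = "- z s"
  have gp: "det3 (z i) (z j) (z k) \<noteq> 0" if "distinct [i, j, k]" "{i, j, k} \<subseteq> {t..<t + n}" for i j k
    using proj_polygon_gp[OF z that] .
  have gw: "det3 w (z i) (z j) \<noteq> 0" if "i \<noteq> j" "{i, j} \<subseteq> {t..<t + n}" for i j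
    using genericD[OF w that] .
  have perm: "det3 c b a = - det3 a b c" "det3 b a c = - det3 a b c" "det3 b c a = det3 a b c" "det3 c a b = det3 a b c" "det3 a c b = - det3 a b c"
    for a b c by (simp_all add: det3_expand algebra_simps)
  have "det3 (z (t + n - 1)) ?q ?r \<noteq> 0" "det3 w (z (t + n - 1)) ?q \<noteq> 0" "det3 w (z (t + n - 1)) ?r \<noteq> 0"
    "det3 w ?q ?r \<noteq> 0" "det3 w ?q (z s) \<noteq> 0"
    using gp[of "t + n - 1" t "t + 1"] gw[of "t + n - 1" t] gw[of "t + n - 1" "t + 1"] gw[of t "t + 1"] gw[of t s] n s by auto
  note g = this[unfolded zt]
  consider "s = t + 1" | "s = t + n - 1" | "t + 2 \<le> s" "s \<le> t + n - 2" using s by linarith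
  then show "left_of ?p ?q ?r w \<noteq> left_of ?p ?q ?r ?y \<longleftrightarrow>
      (in_cone ?r w ?q ?y \<noteq> crosses ?q ?r w ?y) \<noteq> (in_cone ?p w ?q ?y \<noteq> crosses ?q ?p w ?y)"
  proof cases
    case 1
    have "(in_cone ?p w ?q (- ?r) \<noteq> crosses ?q ?p w (- ?r)) = sector ?q ?p w (- ?r)"
      by (rule of_bool_add_xor, rule sector_iff) (use g perm[of w ?p ?q] perm[of w ?q ?r] perm[of ?p ?q ?r] perm[of w ?p ?r] in auto)
    moreover have "left_of ?p ?q ?r w \<noteq> left_of ?p ?q ?r (- ?r) \<longleftrightarrow> sector ?q ?p w (- ?r)"
      by (rule left_of_antipodal_next) (use g perm[of w ?p ?q] perm[of w ?q ?r] in auto)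
    moreover have "\<not> in_cone ?r w ?q (- ?r)" "\<not> crosses ?q ?r w (- ?r)" by simp_all
    ultimately show ?thesis unfolding 1 by auto
  next
    case 2
    then have ys: "z s = ?p" using zt by simp
    have "(in_cone ?r w ?q (- ?p) \<noteq> crosses ?q ?r w (- ?p)) = sector ?q ?r w (- ?p)"
      by (rule of_bool_add_xor, rule sector_iff) (use g perm[of w ?p ?q] perm[of w ?q ?r] perm[of ?p ?q ?r] perm[of w ?p ?r] in auto)
    moreover have "left_of ?p ?q ?r w \<noteq> left_of ?p ?q ?r (- ?p) \<longleftrightarrow> sector ?q ?r w (- ?p)"
      by (rule left_of_antipodal_prev) (use g perm[of w ?p ?q] perm[of w ?q ?r] in auto)
    moreover have "\<not> in_cone ?p w ?q (- ?p)" "\<not> crosses ?q ?p w (- ?p)" by simp_all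
    ultimately show ?thesis unfolding ys by auto
  next
    case 3
    have "det3 (z (t + n - 1)) ?q (z s) \<noteq> 0" "det3 ?q ?r (z s) \<noteq> 0" "det3 w (z (t + n - 1)) (z s) \<noteq> 0" "det3 w ?r (z s) \<noteq> 0"
      using gp[of "t + n - 1" t s] gp[of t "t + 1" s] gw[of "t + n - 1" s] gw[of "t + 1" s] n 3 by auto
    note g' = g this[unfolded zt]
    have a: "(in_cone ?p w ?q ?y \<noteq> crosses ?q ?p w ?y) = sector ?q ?p w ?y"
      by (rule of_bool_add_xor, rule sector_iff) (use g' perm[of w ?p ?q] perm[of w ?q "z s"] perm[of ?p ?q "z s"] perm[of w ?p "z s"] in auto)
    have b: "(in_cone ?r w ?q ?y \<noteq> crosses ?q ?r w ?y) = sector ?q ?r w ?y"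
      by (rule of_bool_add_xor, rule sector_iff) (use g' perm[of w ?q ?r] perm[of w ?q "z s"] perm[of ?q ?r "z s"] perm[of w ?r "z s"] in auto)
    have "left_of ?p ?q ?r w \<noteq> left_of ?p ?q ?r ?y \<longleftrightarrow> sector ?q ?r w ?y \<noteq> sector ?q ?p w ?y"
      by (rule left_of_change)
        (use g' perm[of ?p ?q ?r] perm[of w ?p ?q] perm[of ?p ?q "z s"] perm[of w ?q ?r] perm[of ?q ?r "z s"] perm[of w ?q "z s"] in auto)
    then show ?thesis unfolding a b .
  qed
qed

text \<open>The antipodal polygon lies on the right of the polygon, as far as single views from the
  vertices can tell.\<close>

definition antipode_free :: "(int \<Rightarrow> real^3) \<Rightarrow> int \<Rightarrow> bool" where
  "antipode_free z n \<longleftrightarrow> (\<forall>t s. t + 1 \<le> s \<and> s \<le> t + n - 1 \<and> visible z n t s (- z s) \<longrightarrow>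
     \<not> left_of (z (t - 1)) (z t) (z (t + 1)) (- z s))"

text \<open>In the induction step the vector is moved along the new normal by a factor avoiding
  finitely many bad values.\<close>

lemma exists_not_orthogonal:
  assumes "finite V" "0 \<notin> V"
  shows "\<exists>w::'a::real_inner. \<forall>v\<in>V. v \<bullet> w \<noteq> 0"
  using assms
proof (induction rule: finite_induct)
  case (insert x V)
  then obtain w where w: "\<And>v. v \<in> V \<Longrightarrow> v \<bullet> w \<noteq> 0" by auto
  have "finite ((\<lambda>v. - (v \<bullet> w) / (v \<bullet> x)) ` insert x V)" using insert.hyps by simp
  then obtain e where e: "e \<notin> insert 0 ((\<lambda>v. - (v \<bullet> w) / (v \<bullet> x)) ` insert x V)"
    using ex_new_if_finite[OF infinite_UNIV_char_0] by (meson finite_insert)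
  have "v \<bullet> (w + e *\<^sub>R x) \<noteq> 0" if v: "v \<in> insert x V" for v
  proof (cases "v \<bullet> x = 0")
    case True
    then have "v \<noteq> x" using insert.prems by auto
    then show ?thesis using True v w by (simp add: inner_add_right)
  next
    case False
    then have "v \<bullet> (w + e *\<^sub>R x) = 0 \<longleftrightarrow> e = - (v \<bullet> w) / (v \<bullet> x)"
      by (auto simp: inner_add_right field_simps)
    then show ?thesis using e v by blast
  qed
  then show ?case by blast
qed simp

lemma periodic_mod:
  fixes z :: "int \<Rightarrow> 'a"
  assumes "\<And>i. z (i + n) = z i"
  shows "z (i mod n) = z i"
proof -
  have "z (i + k * n) = z i" for i k
  proof (induction k rule: int_induct[where k = 0])
    case (step1 k)
    then show ?case using assms[of "i + k * n"] by (simp add: algebra_simps)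
  next
    case (step2 k)
    then show ?case using assms[of "i + (k - 1) * n"] by (simp add: algebra_simps)
  qed simp
  from this[of "i mod n" "i div n"] show ?thesis by simp
qed

lemma generic_exists:
  assumes z: "proj_polygon z n"
  obtains w where "generic w z n"
proof -
  let ?V = "(\<lambda>(i, j). cross3 (z i) (z j)) ` {(i, j) \<in> {0..<n} \<times> {0..<n}. cross3 (z i) (z j) \<noteq> 0}"
  have "finite ?V" by (rule finite_imageI, rule finite_subset[of _ "{0..<n} \<times> {0..<n}"]) auto
  moreover have "0 \<notin> ?V" by auto
  ultimately have "\<exists>w. \<forall>v\<in>?V. v \<bullet> w \<noteq> 0" by (rule exists_not_orthogonal)
  then obtain w where w: "\<forall>v\<in>?V. v \<bullet> w \<noteq> 0" ..
  have n: "3 \<le> n" by (rule proj_polygonD(1)[OF z])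
  have per: "z (i mod n) = z i" for i by (rule periodic_mod, rule proj_polygonD(2)[OF z])
  have "generic w z n"
    unfolding generic_def
  proof (intro allI impI)
    fix i j assume ij: "i < j \<and> j < i + n"
    have "\<exists>k. i \<le> k \<and> k < i + n \<and> k \<noteq> i \<and> k \<noteq> j"
      using ij n by (cases "j = i + 1") (auto intro: exI[of _ "i + 1"] exI[of _ "i + 2"])
    then obtain k where "i \<le> k" "k < i + n" "k \<noteq> i" "k \<noteq> j" by blast
    then have "det3 (z i) (z j) (z k) \<noteq> 0" using ij by (intro proj_polygon_gp[OF z, of _ _ _ i]) auto
    then have "cross3 (z i) (z j) \<noteq> 0" by (auto simp: det3_cross)
    then have "cross3 (z i) (z j) \<in> ?V"
      using n per[of i] per[of j] by (intro image_eqI[of _ _ "(i mod n, j mod n)"]) auto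
    from w[rule_format, OF this] show "det3 w (z i) (z j) \<noteq> 0" by (simp add: det3_cross[symmetric] det3_rot)
  qed
  then show thesis by (rule that)
qed

lemma crosses_rev: "crosses a b c d = crosses d c b a"
  by (metis crosses_commute crosses_flip1 crosses_flip2)

lemma proj_polygon_shift: "proj_polygon z n \<Longrightarrow> proj_polygon (\<lambda>i. z (i + s)) n"
  unfolding proj_polygon_def
proof (elim conjE, intro conjI allI impI)
  assume a: "\<forall>i. z (i + n) = z i" "\<forall>i j k. i < j \<and> j < k \<and> k < i + n \<longrightarrow> det3 (z i) (z j) (z k) \<noteq> 0"
    "\<forall>i j. i + 2 \<le> j \<and> j + 2 \<le> i + n \<longrightarrow> \<not> crosses (z i) (z (i + 1)) (z j) (z (j + 1)) \<and>
       \<not> crosses (z i) (z (i + 1)) (- z j) (- z (j + 1))"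
  show "z (i + n + s) = z (i + s)" for i using a(1)[rule_format, of "i + s"] by (simp add: algebra_simps)
  show "det3 (z (i + s)) (z (j + s)) (z (k + s)) \<noteq> 0" if "i < j \<and> j < k \<and> k < i + n" for i j k
    by (rule a(2)[rule_format]) (use that in auto)
  fix i j assume ij: "i + 2 \<le> j \<and> j + 2 \<le> i + n"
  have e: "i + 1 + s = i + s + 1" "j + 1 + s = j + s + 1" by simp_all
  show "\<not> crosses (z (i + s)) (z (i + 1 + s)) (z (j + s)) (z (j + 1 + s))"
    "\<not> crosses (z (i + s)) (z (i + 1 + s)) (- z (j + s)) (- z (j + 1 + s))"
    unfolding e using a(3)[rule_format, of "i + s" "j + s"] ij by auto
qed

lemma proj_polygon_minus: "proj_polygon z n \<Longrightarrow> proj_polygon (\<lambda>i. - z i) n"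
  unfolding proj_polygon_def by (simp add: crosses_minus2)

text \<open>Reversal and the antipodal map each change the sign of every turn, so their composition
  preserves turns and left sides. It is the mirror symmetry that exchanges the two ends of a
  path.\<close>

lemma proj_polygon_flip:
  assumes z: "proj_polygon z n"
  shows "proj_polygon (\<lambda>i. - z (- i)) n"
  unfolding proj_polygon_def
proof (intro conjI allI impI)
  show "3 \<le> n" by (rule proj_polygonD(1)[OF z])
  show "- z (- (i + n)) = - z (- i)" for i using proj_polygonD(2)[OF z, of "- (i + n)"] by simp
  show "det3 (- z (- i)) (- z (- j)) (- z (- k)) \<noteq> 0" if "i < j \<and> j < k \<and> k < i + n" for i j k
    using proj_polygon_gp[OF z, of "- i" "- j" "- k" "- k"] that by simp
  fix i j assume ij: "i + 2 \<le> j \<and> j + 2 \<le> i + n"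
  have e: "- (i + 1) = - i - 1" "- (j + 1) = - j - 1" "- i - 1 + 1 = - i" "- j - 1 + 1 = - j" by simp_all
  have "\<not> crosses (z (- j - 1)) (z (- j)) (z (- i - 1)) (z (- i))"
    "\<not> crosses (z (- j - 1)) (z (- j)) (- z (- i - 1)) (- z (- i))"
    using proj_polygonD(4,5)[OF z, of "- j - 1" "- i - 1", unfolded e] ij by auto
  then show "\<not> crosses (- z (- i)) (- z (- (i + 1))) (- z (- j)) (- z (- (j + 1)))"
    "\<not> crosses (- z (- i)) (- z (- (i + 1))) (- (- z (- j))) (- (- z (- (j + 1))))"
    unfolding e minus_minus crosses_minus crosses_minus2
    by (simp_all only: crosses_rev[of "z (- i)"] crosses_minus2 not_False_eq_True)
qed

lemma left_of_minus:
  assumes "det3 p q r \<noteq> 0" "det3 p q y \<noteq> 0 \<and> det3 q r y \<noteq> 0 \<or> y = - p \<or> y = - r"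
  shows "left_of (- p) (- q) (- r) (- y) \<longleftrightarrow> \<not> left_of p q r y"
proof -
  have "det3 q r p = det3 p q r" by (rule det3_rot)
  then show ?thesis using assms unfolding left_of_def by auto
qed

lemma left_of_flip: "left_of (- r) (- q) (- p) (- y) = left_of p q r y"
proof -
  have "det3 r q p = - det3 p q r" "det3 r q y = - det3 q r y" "det3 q p y = - det3 p q y"
    by (simp_all add: det3_expand algebra_simps)
  then show ?thesis unfolding left_of_def by auto
qed

text \<open>All visible antipodes lie on the same side of the polygon, recorded by
  \<open>\<delta>\<close>. The antipodal map interchanges left and right, so one of the two polygons
  has them on the right.\<close>

lemma antipode_free_cases:
  assumes z: "proj_polygon z n"
  shows "antipode_free z n \<or> antipode_free (\<lambda>i. - z i) n"
proof -
  obtain w where w: "generic w z n" using generic_exists[OF z] .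
  have n: "3 \<le> n" by (rule proj_polygonD(1)[OF z])
  define \<delta> where "\<delta> = (odd (cnt z 0 (nat n) w (- z 0)) \<noteq> side_parity z n w 0)"
  have side: "left_of (z (t - 1)) (z t) (z (t + 1)) (- z s) = \<delta>"
    if "t + 1 \<le> s" "s \<le> t + n - 1" "visible z n t s (- z s)" for t s
  proof -
    have "cnt z t (nat n) w (- z s) = cnt z 0 (nat n) w (- z s)"
      by (rule cnt_rotate) (use proj_polygonD(2)[OF z] n in auto)
    then show ?thesis
      using side_parity_antipodal[OF z w that] cnt_parity_antipodal[OF z w, of 0 s 0]
        side_parity_const[OF z w, of t 0] unfolding \<delta>_def by auto
  qed
  show ?thesis
  proof (cases \<delta>)
    case True
    have "antipode_free (\<lambda>i. - z i) n"
      unfolding antipode_free_def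
    proof (intro allI impI, elim conjE)
      fix t s assume s: "t + 1 \<le> s" "s \<le> t + n - 1" and "visible (\<lambda>i. - z i) n t s (- (- z s))"
      then have "visible z n t s (- z s)"
        unfolding visible_def using crosses_minus[of "z t" "- z s"] by simp (metis minus_minus)
      then have "left_of (z (t - 1)) (z t) (z (t + 1)) (- z s)" using side[OF s] True by simp
      moreover have "left_of (- z (t - 1)) (- z t) (- z (t + 1)) (- (- z s)) \<longleftrightarrow> \<not> left_of (z (t - 1)) (z t) (z (t + 1)) (- z s)"
      proof (rule left_of_minus)
        show "det3 (z (t - 1)) (z t) (z (t + 1)) \<noteq> 0" by (rule proj_polygonD(3)[OF z]) (use n in auto)
        have zt: "z (t + n - 1) = z (t - 1)" using proj_polygonD(2)[OF z, of "t - 1"] by (simp add: algebra_simps)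
        have "det3 (z (t + n - 1)) (z t) (z s) \<noteq> 0 \<and> det3 (z t) (z (t + 1)) (z s) \<noteq> 0 \<or> s = t + n - 1 \<or> s = t + 1"
          using proj_polygon_gp[OF z, of "t + n - 1" t s t] proj_polygon_gp[OF z, of t "t + 1" s t] s n by auto
        then show "det3 (z (t - 1)) (z t) (- z s) \<noteq> 0 \<and> det3 (z t) (z (t + 1)) (- z s) \<noteq> 0 \<or>
          - z s = - z (t - 1) \<or> - z s = - z (t + 1)"
          unfolding zt using zt by auto
      qed
      ultimately show "\<not> left_of (- z (t - 1)) (- z t) (- z (t + 1)) (- (- z s))" by simp
    qed
    then show ?thesis ..
  next
    case False
    then show ?thesis using side unfolding antipode_free_def by blast
  qed
qed

lemma visible_shift: "visible (\<lambda>i. z (i + a)) n t s y = visible z n (t + a) (s + a) y"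
proof -
  have e: "j + 1 + a = j + a + 1" for j by simp
  have "(\<forall>j. P (j + a)) = (\<forall>j. P j)" for P by (metis diff_add_cancel)
  from this[of "\<lambda>j. t + a + 1 \<le> j \<and> j \<le> t + a + n - 2 \<and> j \<noteq> s + a \<and> j \<noteq> s + a - 1 \<longrightarrow>
     \<not> crosses (z (t + a)) y (z j) (z (j + 1)) \<and> \<not> crosses (z (t + a)) y (- z j) (- z (j + 1))"]
  show ?thesis unfolding visible_def e by (simp add: algebra_simps)
qed

lemma visible_flip:
  assumes z: "proj_polygon z n" and vis: "visible z n (- t) (n - s) (- y)"
  shows "visible (\<lambda>i. - z (- i)) n t s y"
  unfolding visible_def
proof (intro allI impI, elim conjE)
  fix j assume j: "t + 1 \<le> j" "j \<le> t + n - 2" "j \<noteq> s" "j \<noteq> s - 1"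
  have e: "z (- j) = z (n - 1 - j + 1)" "z (- (j + 1)) = z (n - 1 - j)"
    using proj_polygonD(2)[OF z, of "- j"] proj_polygonD(2)[OF z, of "- (j + 1)"] by (simp_all add: algebra_simps)
  have "\<not> crosses (z (- t)) (- y) (z (n - 1 - j)) (z (n - 1 - j + 1))"
     "\<not> crosses (z (- t)) (- y) (- z (n - 1 - j)) (- z (n - 1 - j + 1))"
    using vis[unfolded visible_def, rule_format, of "n - 1 - j"] j by auto
  then have 1: "\<not> crosses (- z (- t)) y (- z (n - 1 - j)) (- z (n - 1 - j + 1))"
     "\<not> crosses (- z (- t)) y (z (n - 1 - j)) (z (n - 1 - j + 1))"
    using crosses_minus[of "z (- t)" "- y"] by (metis minus_minus)+
  then show "\<not> crosses (- z (- t)) y (- z (- j)) (- z (- (j + 1))) \<and>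
      \<not> crosses (- z (- t)) y (- (- z (- j))) (- (- z (- (j + 1))))"
    unfolding e minus_minus using crosses_flip2 by metis
qed

lemma antipode_free_shift: "antipode_free z n \<Longrightarrow> antipode_free (\<lambda>i. z (i + a)) n"
  unfolding antipode_free_def visible_shift
proof (intro allI impI, elim conjE)
  fix t s assume a: "\<forall>t s. t + 1 \<le> s \<and> s \<le> t + n - 1 \<and> visible z n t s (- z s) \<longrightarrow> \<not> left_of (z (t - 1)) (z t) (z (t + 1)) (- z s)"
    and b: "t + 1 \<le> s" "s \<le> t + n - 1" "visible z n (t + a) (s + a) (- z (s + a))"
  have e: "t - 1 + a = t + a - 1" "t + 1 + a = t + a + 1" by simp_all
  show "\<not> left_of (z (t - 1 + a)) (z (t + a)) (z (t + 1 + a)) (- z (s + a))"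
    unfolding e using a[rule_format, of "t + a" "s + a"] b by simp
qed

lemma visible_flip_conv:
  assumes z: "proj_polygon z n" and vis: "visible (\<lambda>i. - z (- i)) n t s y"
  shows "visible z n (- t) (n - s) (- y)"
proof -
  have *: "visible (\<lambda>i. - (- z (- (- i)))) n (- t) (n - s) (- y)"
    by (rule visible_flip[OF proj_polygon_flip[OF z]]) (use vis in simp)
  then show ?thesis by simp
qed

lemma antipode_free_flip:
  assumes z: "proj_polygon z n" and a: "antipode_free z n"
  shows "antipode_free (\<lambda>i. - z (- i)) n"
  unfolding antipode_free_def
proof (intro allI impI, elim conjE)
  fix t s assume s: "t + 1 \<le> s" "s \<le> t + n - 1" and v: "visible (\<lambda>i. - z (- i)) n t s (- (- z (- s)))"
  have e: "z (n - s) = z (- s)" using proj_polygonD(2)[OF z, of "- s"] by (simp add: algebra_simps)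
  have "visible z n (- t) (n - s) (- z (n - s))"
    using visible_flip_conv[OF z v] e by simp
  then have "\<not> left_of (z (- t - 1)) (z (- t)) (z (- t + 1)) (- z (n - s))"
    using a[unfolded antipode_free_def, rule_format, of "- t" "n - s"] s by auto
  moreover have "- (t - 1) = - t + 1" "- (t + 1) = - t - 1" by simp_all
  ultimately show "\<not> left_of (- z (- (t - 1))) (- z (- t)) (- z (- (t + 1))) (- (- z (- s)))"
    using left_of_flip[of "z (- t + 1)" "z (- t)" "z (- t - 1)" "- z (- s)"] e by simp
qed

lemma visible_next:
  assumes z: "proj_polygon z n"
  shows "visible z n t (t + 1) (z (t + 1))"
  unfolding visible_def using proj_polygonD(4,5)[OF z, of t] by auto

lemma visible_prev:
  assumes z: "proj_polygon z n"
  shows "visible z n t (t + n - 1) (z (t + n - 1))"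
  unfolding visible_def
proof (intro allI impI)
  fix j assume j: "t + 1 \<le> j \<and> j \<le> t + n - 2 \<and> j \<noteq> t + n - 1 \<and> j \<noteq> t + n - 1 - 1"
  have "\<not> crosses (z j) (z (j + 1)) (z (t + n - 1)) (z (t + n))"
    "\<not> crosses (z j) (z (j + 1)) (- z (t + n - 1)) (- z (t + n))"
    using proj_polygonD(4,5)[OF z, of j "t + n - 1"] j by auto
  then show "\<not> crosses (z t) (z (t + n - 1)) (z j) (z (j + 1)) \<and> \<not> crosses (z t) (z (t + n - 1)) (- z j) (- z (j + 1))"
    unfolding proj_polygonD(2)[OF z]
    using crosses_commute crosses_flip1 crosses_minus2 by metis
qed

text \<open>Vertices and antipodes compete together for the least distance from the apex. An edge of
  either polygon that blocked the view of the winner would, by \<open>near_cross\<close>, have a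
  nearer end in the triangle or cross one of its visible sides. The last conclusion also covers arcs
  that are not edges, such as the closing edge of a polygon cut off by a chord.\<close>

lemma corner_nearest:
  assumes z: "proj_polygon z n"
    and ab: "t < a" "a < t + n" "t < b" "b < t + n" "a \<noteq> b"
    and va: "visible z n t a (z a)" and vb: "visible z n t b (z b)"
    and s0: "t < s0" "s0 < t + n" "s0 \<noteq> a" "s0 \<noteq> b" "y0 = z s0 \<or> y0 = - z s0" "in_cone y0 (z a) (z t) (z b)"
  obtains s y where "t < s" "s < t + n" "s \<noteq> a" "s \<noteq> b" "y = z s \<or> y = - z s" "in_cone y (z a) (z t) (z b)"
    "visible z n t s y"
    "\<forall>i j. t < i \<and> i < t + n \<and> t < j \<and> j < t + n \<and> crosses (z t) y (z i) (z j) \<longrightarrow>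
       crosses (z t) (z a) (z i) (z j) \<or> crosses (z t) (z b) (z i) (z j)"
proof -
  let ?I = "{s. t < s \<and> s < t + n \<and> s \<noteq> a \<and> s \<noteq> b}"
  define S where "S = z ` ?I \<union> (\<lambda>s. - z s) ` ?I"
  have fin: "finite S" unfolding S_def by (rule finite_UnI; rule finite_imageI; rule finite_subset[of _ "{t..t + n}"]) auto
  have mem: "y0 \<in> S" using s0 unfolding S_def by auto
  obtain y where y: "y \<in> S" "in_cone y (z a) (z t) (z b)"
    "\<And>c. c \<in> S \<Longrightarrow> in_cone c (z a) (z t) (z b) \<Longrightarrow> cone_dist (z a) (z t) (z b) y \<le> cone_dist (z a) (z t) (z b) c"
    using cone_nearest[OF fin mem s0(6)] by blast
  from y(1) obtain s where s: "t < s" "s < t + n" "s \<noteq> a" "s \<noteq> b" "y = z s \<or> y = - z s" unfolding S_def by auto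
  have deg: "det3 c (z t) (z b) = 0 \<longrightarrow> det3 (z a) c (z b) = 0" "det3 (z a) (z t) c = 0 \<longrightarrow> det3 (z a) c (z b) = 0"
    "\<not> (in_cone c (z a) (z t) (z b) \<and> cone_dist (z a) (z t) (z b) c < cone_dist (z a) (z t) (z b) y)"
    if c: "c = z j \<or> c = - z j" "t < j" "j < t + n" for c j
  proof -
    have g: "j \<noteq> b \<Longrightarrow> det3 (z j) (z t) (z b) \<noteq> 0" "j \<noteq> a \<Longrightarrow> det3 (z a) (z t) (z j) \<noteq> 0"
      using proj_polygon_gp[OF z, of j t b t] proj_polygon_gp[OF z, of a t j t] c ab by auto
    show "det3 c (z t) (z b) = 0 \<longrightarrow> det3 (z a) c (z b) = 0" "det3 (z a) (z t) c = 0 \<longrightarrow> det3 (z a) c (z b) = 0"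
      using g c(1) by (cases "j = a"; cases "j = b"; auto)+
    show "\<not> (in_cone c (z a) (z t) (z b) \<and> cone_dist (z a) (z t) (z b) c < cone_dist (z a) (z t) (z b) y)"
    proof (cases "j = a \<or> j = b")
      case True
      then show ?thesis using c(1) by auto
    next
      case False
      then have "c \<in> S" using c unfolding S_def by auto
      then show ?thesis using y(3)[of c] by linarith
    qed
  qed
  have near: "crosses (z t) (z a) c d \<or> crosses (z t) (z b) c d"
    if cd: "c = z i \<or> c = - z i" "d = z j \<or> d = - z j" and ij: "t < i" "i < t + n" "t < j" "j < t + n"
      and cr: "crosses (z t) y c d" for i j c d
  proof -
    note degc = deg[OF cd(1) ij(1,2)] and degd = deg[OF cd(2) ij(3,4)]
    have "in_cone c (z a) (z t) (z b) \<and> cone_dist (z a) (z t) (z b) c < cone_dist (z a) (z t) (z b) y \<or>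
      in_cone d (z a) (z t) (z b) \<and> cone_dist (z a) (z t) (z b) d < cone_dist (z a) (z t) (z b) y \<or>
      crosses (z a) (z t) c d \<or> crosses (z t) (z b) c d"
      by (rule near_cross[OF y(2) cr]) (use degc degd in blast)+
    then show ?thesis using degc(3) degd(3) crosses_flip1 by blast
  qed
  have nocross: "\<not> crosses (z t) y c d"
    if j: "t + 1 \<le> j" "j \<le> t + n - 2" and cd: "c = z j \<and> d = z (j + 1) \<or> c = - z j \<and> d = - z (j + 1)" for j c d
  proof
    assume cr: "crosses (z t) y c d"
    have "crosses (z t) (z a) c d \<or> crosses (z t) (z b) c d"
      by (rule near[of c j d "j + 1"]) (use cd cr j in auto)
    moreover have "\<not> crosses (z t) (z a) c d"
    proof (cases "j = a \<or> j = a - 1")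
      case True
      then show ?thesis using cd by auto
    next
      case False
      then show ?thesis using va j cd unfolding visible_def by blast
    qed
    moreover have "\<not> crosses (z t) (z b) c d"
    proof (cases "j = b \<or> j = b - 1")
      case True
      then show ?thesis using cd by auto
    next
      case False
      then show ?thesis using vb j cd unfolding visible_def by blast
    qed
    ultimately show False by blast
  qed
  have "visible z n t s y" unfolding visible_def using nocross by blast
  then show thesis
    by (rule that[OF s y(2)]) (intro allI impI; elim conjE; rule near[OF disjI1[OF refl] disjI1[OF refl]])
qed

text \<open>Cuts the polygon into two, the chord starting on the left side of the corner at \<open>t\<close>.\<close>
definition inner_chord :: "(int \<Rightarrow> real^3) \<Rightarrow> int \<Rightarrow> int \<Rightarrow> int \<Rightarrow> bool" where
  "inner_chord z n t r \<longleftrightarrow> 2 \<le> r \<and> r \<le> n - 2 \<and> visible z n t (t + r) (z (t + r)) \<and>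
     left_of (z (t - 1)) (z t) (z (t + 1)) (z (t + r))"

text \<open>Visibility is symmetric, and the left side carries over to the other end by
  \<open>side_parity_chord\<close>.\<close>

lemma inner_chord_commute:
  assumes z: "proj_polygon z n" and c: "inner_chord z n t r"
  shows "inner_chord z n (t + r) (n - r)"
proof -
  have r: "2 \<le> r" "r \<le> n - 2" and v: "visible z n t (t + r) (z (t + r))"
    and l: "left_of (z (t - 1)) (z t) (z (t + 1)) (z (t + r))"
    using c unfolding inner_chord_def by auto
  have e: "t + r + (n - r) = t + n" by simp
  have per: "z (i + n) = z i" for i by (rule proj_polygonD(2)[OF z])
  have "visible z n (t + r) (t + n) (z t)"
    unfolding visible_def
  proof (intro allI impI, elim conjE)
    fix j assume j: "t + r + 1 \<le> j" "j \<le> t + r + n - 2" "j \<noteq> t + n" "j \<noteq> t + n - 1"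
    have "\<exists>i. t + 1 \<le> i \<and> i \<le> t + n - 2 \<and> i \<noteq> t + r \<and> i \<noteq> t + r - 1 \<and> z i = z j \<and> z (i + 1) = z (j + 1)"
    proof (cases "j \<le> t + n - 2")
      case True
      then show ?thesis using j r by (intro exI[of _ j]) auto
    next
      case False
      then show ?thesis using j r per[of "j - n"] per[of "j - n + 1"]
        by (intro exI[of _ "j - n"]) (auto simp: algebra_simps)
    qed
    then obtain i where "t + 1 \<le> i" "i \<le> t + n - 2" "i \<noteq> t + r" "i \<noteq> t + r - 1" "z i = z j" "z (i + 1) = z (j + 1)" by blast
    then show "\<not> crosses (z (t + r)) (z t) (z j) (z (j + 1)) \<and> \<not> crosses (z (t + r)) (z t) (- z j) (- z (j + 1))"
      using v unfolding visible_def crosses_flip1[of "z (t + r)"] by metis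
  qed
  moreover obtain w where w: "generic w z n" using generic_exists[OF z] .
  have "left_of (z (t - 1)) (z t) (z (t + 1)) (z (t + r)) = left_of (z (t + r - 1)) (z (t + r)) (z (t + r + 1)) (z t)"
    by (rule side_parity_chord[OF z w]) (use r v in \<open>auto simp: visible_def\<close>)
  ultimately show ?thesis unfolding inner_chord_def e using r l per by auto
qed

lemma inner_chord_shift: "inner_chord (\<lambda>i. z (i + a)) n t r = inner_chord z n (t + a) r"
proof -
  have e: "t - 1 + a = t + a - 1" "t + 1 + a = t + a + 1" "t + r + a = t + a + r" by simp_all
  show ?thesis unfolding inner_chord_def visible_shift e ..
qed

lemma inner_chord_flip:
  assumes z: "proj_polygon z n" and c: "inner_chord z n (- t - r) r"
  shows "inner_chord (\<lambda>i. - z (- i)) n t r"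
proof -
  have "- t - r + r = - t" by simp
  with inner_chord_commute[OF z c] have c': "inner_chord z n (- t) (n - r)" by simp
  have r: "2 \<le> r" "r \<le> n - 2" using c unfolding inner_chord_def by auto
  have e: "z (- t + (n - r)) = z (- (t + r))" "- t + (n - r) = n - (t + r)" "- (t - 1) = - t + 1" "- (t + 1) = - t - 1"
    using proj_polygonD(2)[OF z, of "- (t + r)"] by (simp_all add: algebra_simps)
  have "visible (\<lambda>i. - z (- i)) n t (t + r) (- z (- (t + r)))"
  proof (rule visible_flip[OF z])
    have "n - (t + r) = - (t + r) + n" by simp
    then have "z (n - (t + r)) = z (- (t + r))" by (simp only: proj_polygonD(2)[OF z])
    moreover have "visible z n (- t) (- t + (n - r)) (z (- t + (n - r)))"
      using c' unfolding inner_chord_def by blast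
    ultimately show "visible z n (- t) (n - (t + r)) (- (- z (- (t + r))))"
      unfolding e(2) minus_minus by (simp only:)
  qed
  moreover have "left_of (- z (- (t - 1))) (- z (- t)) (- z (- (t + 1))) (- z (- (t + r)))"
    unfolding e(3,4) left_of_flip using c' e(1) by (simp add: inner_chord_def)
  ultimately show ?thesis unfolding inner_chord_def using r by auto
qed

definition ear :: "(int \<Rightarrow> real^3) \<Rightarrow> int \<Rightarrow> int \<Rightarrow> bool" where
  "ear z n t \<longleftrightarrow> (\<forall>s. t + 2 \<le> s \<and> s \<le> t + n - 2 \<longrightarrow>
     \<not> in_cone (z s) (z (t - 1)) (z t) (z (t + 1)) \<and> \<not> in_cone (- z s) (z (t - 1)) (z t) (z (t + 1)))"

lemma ear_minus: "ear (\<lambda>i. - z i) n t = ear z n t"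
  unfolding ear_def using in_cone_minus by (metis minus_minus)

lemma ear_shift: "ear (\<lambda>i. z (i + a)) n t = ear z n (t + a)"
proof -
  have e: "t - 1 + a = t + a - 1" "t + 1 + a = t + a + 1" by simp_all
  have "(\<forall>s. P (s + a)) = (\<forall>s. P s)" for P by (metis diff_add_cancel)
  from this[of "\<lambda>s. t + a + 2 \<le> s \<and> s \<le> t + a + n - 2 \<longrightarrow>
     \<not> in_cone (z s) (z (t + a - 1)) (z (t + a)) (z (t + a + 1)) \<and> \<not> in_cone (- z s) (z (t + a - 1)) (z (t + a)) (z (t + a + 1))"]
  show ?thesis unfolding ear_def e by (simp add: algebra_simps)
qed

lemma ear_flip:
  assumes z: "proj_polygon z n" and e: "ear (\<lambda>i. - z (- i)) n t"
  shows "ear z n (- t)"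
  unfolding ear_def
proof (intro allI impI, elim conjE)
  fix s assume s: "- t + 2 \<le> s" "s \<le> - t + n - 2"
  have zs: "z (- (n - s)) = z s" using proj_polygonD(2)[OF z, of "s - n"] by (simp add: algebra_simps)
  have "- (t - 1) = - t + 1" "- (t + 1) = - t - 1" by simp_all
  moreover have "\<not> in_cone (- z (- (n - s))) (- z (- (t - 1))) (- z (- t)) (- z (- (t + 1)))"
    "\<not> in_cone (- (- z (- (n - s)))) (- z (- (t - 1))) (- z (- t)) (- z (- (t + 1)))"
    using e[unfolded ear_def, rule_format, of "n - s"] s by auto
  ultimately show "\<not> in_cone (z s) (z (- t - 1)) (z (- t)) (z (- t + 1)) \<and> \<not> in_cone (- z s) (z (- t - 1)) (z (- t)) (z (- t + 1))"
    unfolding zs using in_cone_minus in_cone_flip by (metis minus_minus)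
qed

lemma mod_neq_window:
  fixes i j p :: int
  assumes "i < j" "j < i + p"
  shows "i mod p \<noteq> j mod p"
proof
  assume "i mod p = j mod p"
  then have "p dvd j - i" by (metis mod_eq_dvd_iff)
  then show False using assms zdvd_imp_le[of p "j - i"] by linarith
qed

lemma proj_polygonI:
  assumes p: "3 \<le> p"
    and gp: "\<And>a b c. {a, b, c} \<subseteq> {0..<p} \<Longrightarrow> distinct [a, b, c] \<Longrightarrow> det3 (x a) (x b) (x c) \<noteq> 0"
    and nc: "\<And>a b. {a, b} \<subseteq> {0..<p} \<Longrightarrow> a \<noteq> b \<Longrightarrow> (a + 1) mod p \<noteq> b \<Longrightarrow> (b + 1) mod p \<noteq> a \<Longrightarrow>
      \<not> crosses (x a) (x ((a + 1) mod p)) (x b) (x ((b + 1) mod p)) \<and>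
      \<not> crosses (x a) (x ((a + 1) mod p)) (- x b) (- x ((b + 1) mod p))"
  shows "proj_polygon (\<lambda>i. x (i mod p)) p"
  unfolding proj_polygon_def
proof (intro conjI allI impI)
  show "3 \<le> p" by (rule p)
  show "x ((i + p) mod p) = x (i mod p)" for i by simp
  have rng: "i mod p \<in> {0..<p}" for i using p by simp
  show "det3 (x (i mod p)) (x (j mod p)) (x (k mod p)) \<noteq> 0" if "i < j \<and> j < k \<and> k < i + p" for i j k
  proof (rule gp)
    show "distinct [i mod p, j mod p, k mod p]"
      using mod_neq_window[of i j p] mod_neq_window[of j k p] mod_neq_window[of i k p] that by auto
  qed (use rng in auto)
  fix i j assume ij: "i + 2 \<le> j \<and> j + 2 \<le> i + p"
  have e: "(i + 1) mod p = (i mod p + 1) mod p" "(j + 1) mod p = (j mod p + 1) mod p" by (simp_all add: mod_simps)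
  have "i + p \<noteq> j + 1" using ij by simp
  have ne: "(i mod p + 1) mod p \<noteq> j mod p" "(j mod p + 1) mod p \<noteq> i mod p" "i mod p \<noteq> j mod p"
    using mod_neq_window[of "i + 1" j p] mod_neq_window[of "j + 1" "i + p" p] mod_neq_window[of i j p] ij
    unfolding e by auto
  show "\<not> crosses (x (i mod p)) (x ((i + 1) mod p)) (x (j mod p)) (x ((j + 1) mod p))"
    "\<not> crosses (x (i mod p)) (x ((i + 1) mod p)) (- x (j mod p)) (- x ((j + 1) mod p))"
    unfolding e using nc[of "i mod p" "j mod p"] ne rng[of i] rng[of j] by auto
qed

section \<open>The closed polygon cut off by an inner chord\<close>

locale chord_polygon =
  fixes z :: "int \<Rightarrow> real^3" and n r :: int
  assumes z: "proj_polygon z n" and chord: "inner_chord z n 0 r"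
begin

text \<open>Periodicity makes the chord itself the closing edge, from \<open>k r\<close> to
  \<open>k (r + 1)\<close>.\<close>

definition k :: "int \<Rightarrow> real^3" where
  "k i = z (i mod (r + 1))"

lemma r: "2 \<le> r" "r \<le> n - 2" "3 \<le> n"
  using chord proj_polygonD(1)[OF z] unfolding inner_chord_def by auto

lemma per: "z (i + n) = z i"
  by (rule proj_polygonD(2)[OF z])

lemma chord_visible: "visible z n 0 r (z r)" and chord_left: "left_of (z (- 1)) (z 0) (z 1) (z r)"
  using chord unfolding inner_chord_def by auto

lemma chord_left': "left_of (z (r - 1)) (z r) (z (r + 1)) (z 0)"
  using inner_chord_commute[OF z chord] per[of 0] unfolding inner_chord_def by simp

lemma k_eq: "0 \<le> i \<Longrightarrow> i \<le> r \<Longrightarrow> k i = z i"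
  by (simp add: k_def)

lemma k_per: "k (i + (r + 1)) = k i"
  by (simp add: k_def)

lemma mod_range: "0 \<le> i mod (r + 1)" "i mod (r + 1) \<le> r"
  using pos_mod_sign[of "r + 1" i] pos_mod_bound[of "r + 1" i] r by linarith+

lemma k_edge:
  obtains "0 \<le> j mod (r + 1)" "j mod (r + 1) < r" "k j = z (j mod (r + 1))" "k (j + 1) = z (j mod (r + 1) + 1)"
  | "j mod (r + 1) = r" "k j = z r" "k (j + 1) = z 0"
proof -
  define a where "a = j mod (r + 1)"
  have a: "0 \<le> a" "a < r + 1" using mod_range[of j] by (simp_all add: a_def)
  have e: "(j + 1) mod (r + 1) = (a + 1) mod (r + 1)" unfolding a_def by (simp add: mod_simps)
  show thesis
  proof (cases "a = r")
    case True
    then show thesis using that(2) e unfolding k_def a_def by simp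
  next
    case False
    then have "a < r" using a by simp
    then show thesis using that(1) e a unfolding k_def a_def by simp
  qed
qed

lemma chord_uncrossed:
  assumes "1 \<le> b" "b \<le> n - 2" "b \<noteq> r" "b \<noteq> r - 1"
  shows "\<not> crosses (z r) (z 0) (z b) (z (b + 1))" "\<not> crosses (z r) (z 0) (- z b) (- z (b + 1))"
    "\<not> crosses (z b) (z (b + 1)) (z r) (z 0)" "\<not> crosses (z b) (z (b + 1)) (- z r) (- z 0)"
    "\<not> crosses (- z b) (- z (b + 1)) (z r) (z 0)"
proof -
  have "\<not> crosses (z 0) (z r) (z b) (z (b + 1))" "\<not> crosses (z 0) (z r) (- z b) (- z (b + 1))"
    using chord_visible assms unfolding visible_def by auto
  then show "\<not> crosses (z r) (z 0) (z b) (z (b + 1))" "\<not> crosses (z r) (z 0) (- z b) (- z (b + 1))"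
    unfolding crosses_flip1[of "z r"] .
  then show "\<not> crosses (z b) (z (b + 1)) (z r) (z 0)" "\<not> crosses (z b) (z (b + 1)) (- z r) (- z 0)"
    "\<not> crosses (- z b) (- z (b + 1)) (z r) (z 0)"
    using crosses_commute crosses_minus2 by metis+
qed

lemma edges_uncrossed:
  assumes "0 \<le> a" "a + 2 \<le> b" "b + 2 \<le> a + n"
  shows "\<not> crosses (z a) (z (a + 1)) (z b) (z (b + 1))" "\<not> crosses (z a) (z (a + 1)) (- z b) (- z (b + 1))"
    "\<not> crosses (z b) (z (b + 1)) (z a) (z (a + 1))" "\<not> crosses (z b) (z (b + 1)) (- z a) (- z (a + 1))"
    "\<not> crosses (- z b) (- z (b + 1)) (z a) (z (a + 1))"
proof -
  show "\<not> crosses (z a) (z (a + 1)) (z b) (z (b + 1))" "\<not> crosses (z a) (z (a + 1)) (- z b) (- z (b + 1))"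
    using proj_polygonD(4,5)[OF z] assms by auto
  then show "\<not> crosses (z b) (z (b + 1)) (z a) (z (a + 1))" "\<not> crosses (z b) (z (b + 1)) (- z a) (- z (a + 1))"
    "\<not> crosses (- z b) (- z (b + 1)) (z a) (z (a + 1))"
    using crosses_commute crosses_minus2 by metis+
qed

lemma k_polygon: "proj_polygon k (r + 1)"
proof -
  have "proj_polygon (\<lambda>i. z (i mod (r + 1))) (r + 1)"
  proof (rule proj_polygonI)
    show "3 \<le> r + 1" using r by simp
    show "det3 (z a) (z b) (z c) \<noteq> 0" if "{a, b, c} \<subseteq> {0..<r + 1}" "distinct [a, b, c]" for a b c
      by (rule proj_polygon_gp[OF z, of _ _ _ 0]) (use that r in auto)
    fix a b assume ab: "{a, b} \<subseteq> {0..<r + 1}" "a \<noteq> b" "(a + 1) mod (r + 1) \<noteq> b" "(b + 1) mod (r + 1) \<noteq> a"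
    have m: "(c + 1) mod (r + 1) = (if c = r then 0 else c + 1)" if "0 \<le> c" "c \<le> r" for c
      using that r by simp
    show "\<not> crosses (z a) (z ((a + 1) mod (r + 1))) (z b) (z ((b + 1) mod (r + 1))) \<and>
      \<not> crosses (z a) (z ((a + 1) mod (r + 1))) (- z b) (- z ((b + 1) mod (r + 1)))"
    proof -
      consider "a = r" "b < r" | "b = r" "a < r" | "a < r" "b < r" "a < b" | "a < r" "b < r" "b < a" using ab by force
      then show ?thesis
      proof cases
        case 1
        have "1 \<le> b" "b \<le> n - 2" "b \<noteq> r" "b \<noteq> r - 1" using 1 ab m[of a] m[of b] r by (auto split: if_splits)
        then show ?thesis using 1 ab m[of a] m[of b] chord_uncrossed[of b] by simp
      next
        case 2
        have "1 \<le> a" "a \<le> n - 2" "a \<noteq> r" "a \<noteq> r - 1" using 2 ab m[of a] m[of b] r by (auto split: if_splits)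
        then show ?thesis using 2 ab m[of a] m[of b] chord_uncrossed[of a] by simp
      next
        case 3
        have "0 \<le> a" "a + 2 \<le> b" "b + 2 \<le> a + n" using 3 ab m[of a] r by auto
        then show ?thesis using 3 ab m[of a] m[of b] edges_uncrossed[of a b] by simp
      next
        case 4
        have "0 \<le> b" "b + 2 \<le> a" "a + 2 \<le> b + n" using 4 ab m[of b] r by auto
        then show ?thesis using 4 ab m[of a] m[of b] edges_uncrossed[of b a] by simp
      qed
    qed
  qed
  then show ?thesis unfolding k_def .
qed

lemma k_gp:
  assumes "i mod (r + 1) \<noteq> j mod (r + 1)" "r < s" "s < n"
  shows "det3 (k i) (k j) (z s) \<noteq> 0"
  unfolding k_def by (rule proj_polygon_gp[OF z, of _ _ _ 0]) (use assms r pos_mod_bound[of "r + 1" i] pos_mod_bound[of "r + 1" j] in auto)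

lemma rest_edge_uncrossed:
  assumes "r < s" "s + 1 < n"
  shows "\<not> crosses (z s) (z (s + 1)) (k j) (k (j + 1))" "\<not> crosses (- z s) (- z (s + 1)) (k j) (k (j + 1))"
proof (atomize(full), rule k_edge[of j])
  assume "0 \<le> j mod (r + 1)" "j mod (r + 1) < r" "k j = z (j mod (r + 1))" "k (j + 1) = z (j mod (r + 1) + 1)"
  then show "\<not> crosses (z s) (z (s + 1)) (k j) (k (j + 1)) \<and> \<not> crosses (- z s) (- z (s + 1)) (k j) (k (j + 1))"
    using edges_uncrossed[of "j mod (r + 1)" s] assms by simp
next
  assume "j mod (r + 1) = r" "k j = z r" "k (j + 1) = z 0"
  then show "\<not> crosses (z s) (z (s + 1)) (k j) (k (j + 1)) \<and> \<not> crosses (- z s) (- z (s + 1)) (k j) (k (j + 1))"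
    using chord_uncrossed[of s] assms r by simp
qed

text \<open>Consecutive vertices of the rest are joined by edges that avoid \<open>k\<close>, so
  \<open>cnt_parity_step\<close> applies to each of them.\<close>

lemma rest_parity_const:
  assumes w: "generic w z n" and s: "r < s" "s < n"
  shows "odd (cnt k i (nat (r + 1)) w (z s)) = odd (cnt k i (nat (r + 1)) w (z (r + 1)))"
  using s
proof (induction s rule: int_gr_induct)
  case base
  show ?case ..
next
  case (step s)
  have gw: "det3 w (z i) (z j) \<noteq> 0" if "i \<noteq> j" "{i, j} \<subseteq> {0..<0 + n}" for i j
    using genericD[OF w that] .
  have gp: "det3 (z i) (z j) (z l) \<noteq> 0" if "distinct [i, j, l]" "{i, j, l} \<subseteq> {0..<0 + n}" for i j l
    using proj_polygon_gp[OF z that] .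
  have "odd (cnt k i (nat (r + 1)) w (z s)) = odd (cnt k i (nat (r + 1)) w (z (s + 1)))"
  proof (rule cnt_parity_step[OF k_polygon, of 0])
    fix j assume "0 \<le> j" "j < 0 + (r + 1)"
    show "\<not> crosses (z s) (z (s + 1)) (k j) (k (j + 1))" using rest_edge_uncrossed step by simp
    have "\<exists>a b. k j = z a \<and> k (j + 1) = z b \<and> a \<noteq> b \<and> 0 \<le> a \<and> a \<le> r \<and> 0 \<le> b \<and> b \<le> r"
      using r by (rule_tac k_edge[of j]) force+
    then obtain a b where ab: "k j = z a" "k (j + 1) = z b" "a \<noteq> b" "0 \<le> a" "a \<le> r" "0 \<le> b" "b \<le> r" by blast
    show "pasch_even w (z s) (z (s + 1)) (k j) (k (j + 1))"
      unfolding ab(1,2) by (rule pasch_even_generic; (rule gw | rule gp); use ab step in simp)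
  qed
  then show ?case using step by simp
qed

text \<open>The rest of the polygon lies to the right of the closed polygon cut off by the chord.\<close>
lemma rest_right:
  assumes t: "0 \<le> t" "t \<le> r" and s: "r < s" "s < n"
    and unc: "\<And>j. t + 1 \<le> j \<Longrightarrow> j \<le> t + r - 1 \<Longrightarrow> \<not> crosses (z t) (z s) (k j) (k (j + 1))"
  shows "\<not> left_of (k (t - 1)) (k t) (k (t + 1)) (z s)"
proof -
  obtain w where w: "generic w z n" using generic_exists[OF z] .
  have gw: "det3 w (z i) (z j) \<noteq> 0" if "i \<noteq> j" "{i, j} \<subseteq> {0..<0 + n}" for i j
    using genericD[OF w that] .
  have gp: "det3 (z i) (z j) (z l) \<noteq> 0" if "distinct [i, j, l]" "{i, j, l} \<subseteq> {0..<0 + n}" for i j l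
    using proj_polygon_gp[OF z that] .
  have wk: "generic w k (r + 1)"
    unfolding generic_def
  proof (intro allI impI)
    fix i j assume "i < j \<and> j < i + (r + 1)"
    then have "i mod (r + 1) \<noteq> j mod (r + 1)" using mod_neq_window by blast
    then show "det3 w (k i) (k j) \<noteq> 0"
      unfolding k_def by (intro gw) (use r pos_mod_bound[of "r + 1" i] pos_mod_bound[of "r + 1" j] in auto)
  qed
  have vis: "odd (cnt k t (nat (r + 1)) w (z s)) \<longleftrightarrow> side_parity k (r + 1) w t \<noteq> left_of (k (t - 1)) (k t) (k (t + 1)) (z s)"
    if t: "0 \<le> t" "t \<le> r" and s: "r < s" "s < n"
      and unc: "\<And>j. t + 1 \<le> j \<Longrightarrow> j \<le> t + r - 1 \<Longrightarrow> \<not> crosses (z t) (z s) (k j) (k (j + 1))" for t s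
  proof -
    have kt: "k t = z t" using t by (rule k_eq)
    have ix: "\<exists>a. k j = z a \<and> a \<noteq> t \<and> 0 \<le> a \<and> a \<le> r" if "t < j" "j < t + (r + 1)" for j
      using mod_neq_window[OF that] t r pos_mod_bound[of "r + 1" j] unfolding k_def
      by (intro exI[of _ "j mod (r + 1)"]) auto
    have "k (t + r) = k (t - 1)" using k_per[of "t - 1"] by (simp add: algebra_simps)
    then obtain a where a: "k (t - 1) = z a" "a \<noteq> t" "0 \<le> a" "a \<le> r" using ix[of "t + r"] r by auto
    obtain b where b: "k (t + 1) = z b" "b \<noteq> t" "0 \<le> b" "b \<le> r" using ix[of "t + 1"] r by auto
    show ?thesis
    proof (rule side_parity_visible[OF k_polygon])
      fix j assume j: "t + 1 \<le> j" "j < t + (r + 1) - 1"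
      show "\<not> crosses (k t) (z s) (k j) (k (j + 1))" unfolding kt by (rule unc) (use j in auto)
      have "\<exists>a b. k j = z a \<and> k (j + 1) = z b \<and> a \<noteq> b \<and> a \<noteq> t \<and> b \<noteq> t \<and> 0 \<le> a \<and> a \<le> r \<and> 0 \<le> b \<and> b \<le> r"
      proof -
        have "j mod (r + 1) \<noteq> (j + 1) mod (r + 1)" "t mod (r + 1) \<noteq> j mod (r + 1)" "t mod (r + 1) \<noteq> (j + 1) mod (r + 1)"
          using mod_neq_window[of j "j + 1" "r + 1"] mod_neq_window[of t j "r + 1"] mod_neq_window[of t "j + 1" "r + 1"] j r by auto
        then show ?thesis using t r pos_mod_bound[of "r + 1" j] pos_mod_bound[of "r + 1" "j + 1"] unfolding k_def
          by (intro exI[of _ "j mod (r + 1)"] exI[of _ "(j + 1) mod (r + 1)"]) auto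
      qed
      then obtain c d where cd: "k j = z c" "k (j + 1) = z d" "c \<noteq> d" "c \<noteq> t" "d \<noteq> t" "0 \<le> c" "c \<le> r" "0 \<le> d" "d \<le> r" by blast
      show "pasch_even w (k t) (z s) (k j) (k (j + 1))"
        unfolding kt cd(1,2) by (rule pasch_even_generic; (rule gw | rule gp); use cd s t in simp)
    next
      have perm: "det3 x y w = det3 w x y" for x y by (rule det3_rot'[symmetric])
      have perm': "det3 x w y = - det3 w x y" for x y by (rule det3_swap12)
      show "det3 (k t) (k (t - 1)) w \<noteq> 0" "det3 (k t) (k (t - 1)) (z s) \<noteq> 0" "det3 (k t) (k (t + 1)) w \<noteq> 0"
        "det3 (k t) (k (t + 1)) (z s) \<noteq> 0" "det3 (k t) w (z s) \<noteq> 0" "det3 w (k (t - 1)) (z s) \<noteq> 0" "det3 w (k (t + 1)) (z s) \<noteq> 0"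
        unfolding kt a(1) b(1) perm[of "z t"] perm' neg_equal_0_iff_equal
        by ((rule gw | rule gp); use a b s t r in simp)+
    qed
  qed
  have rot: "cnt k t (nat (r + 1)) w y = cnt k r (nat (r + 1)) w y" for t y
    by (rule cnt_rotate) (use k_per r in auto)
  \<comment> \<open>The reference vertex is \<open>z (r + 1)\<close>: it is seen from
    \<open>z r\<close> along an edge, and it lies on the right there because the chord leaves
    \<open>z r\<close> on the left side of the polygon.\<close>
  have "odd (cnt k r (nat (r + 1)) w (z (r + 1))) \<longleftrightarrow> side_parity k (r + 1) w r \<noteq> left_of (k (r - 1)) (k r) (k (r + 1)) (z (r + 1))"
  proof (rule vis)
    fix j assume j: "r + 1 \<le> j" "j \<le> r + r - 1"
    have "k j = z (j - (r + 1))" "k (j + 1) = z (j - (r + 1) + 1)"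
      using k_per[of "j - (r + 1)"] k_per[of "j - (r + 1) + 1"] k_eq[of "j - (r + 1)"] k_eq[of "j - (r + 1) + 1"] j
      by (simp_all add: algebra_simps)
    then show "\<not> crosses (z r) (z (r + 1)) (k j) (k (j + 1))"
      using edges_uncrossed[of "j - (r + 1)" r] j r by simp
  qed (use r in auto)
  moreover have "\<not> left_of (k (r - 1)) (k r) (k (r + 1)) (z (r + 1))"
  proof -
    have "k (r - 1) = z (r - 1)" "k r = z r" "k (r + 1) = z 0" using k_eq k_per[of 0] r by simp_all
    moreover have "\<not> left_of (z (r - 1)) (z r) (z 0) (z (r + 1))"
    proof (rule left_of_exchange)
      show "det3 (z r) (z (r - 1)) (z (r + 1)) \<noteq> 0" "det3 (z r) (z (r - 1)) (z 0) \<noteq> 0" "det3 (z r) (z (r + 1)) (z 0) \<noteq> 0"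
        by (rule gp; use r in simp)+
      show "left_of (z (r - 1)) (z r) (z (r + 1)) (z 0)" by (rule chord_left')
    qed
    ultimately show ?thesis by simp
  qed
  moreover have "odd (cnt k r (nat (r + 1)) w (z s)) = odd (cnt k r (nat (r + 1)) w (z (r + 1)))"
    by (rule rest_parity_const[OF w s])
  moreover have "side_parity k (r + 1) w r = side_parity k (r + 1) w t" by (rule side_parity_const[OF k_polygon wk])
  ultimately show ?thesis using vis[OF t s unc] rot[of t] by auto
qed

end

section \<open>Corners of the polygon cut off by a shortest inner chord\<close>

lemma in_cone_swap12: "in_cone z q p r \<longleftrightarrow> in_cone z p q r"
  using in_cone_flip in_cone_swap by metis

text \<open>The crossing is an equation between a positive combination of \<open>a, b\<close> and
  one of \<open>- p, - q\<close>; solving it for \<open>- p\<close> gives positive coefficients for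
  \<open>b\<close>, \<open>q\<close> and \<open>a\<close>.\<close>

lemma crosses_antipodal_in_cone:
  assumes "crosses a b (- p) (- q)"
  shows "in_cone (- p) b q a"
proof -
  have e: "det3 p q a = det3 a p q" "det3 b q a = det3 a b q * 1" "det3 b p a = det3 a b p" "det3 b q p = - det3 b p q"
    by (simp_all add: det3_expand algebra_simps)
  show ?thesis using assms unfolding crosses_def in_cone_def
    by (simp add: e mult_less_0_iff zero_less_mult_iff) argo
qed

lemma left_of_no_sector:
  assumes "0 < det3 w q y" "left_of p q y w" "det3 p q y \<noteq> 0"
  shows "\<not> sector q p w y"
proof -
  have e: "det3 q w y = - det3 w q y" "det3 q w p = det3 p q w" "det3 q p y = - det3 p q y"
    by (simp_all add: det3_expand algebra_simps)
  show ?thesis using assms unfolding left_of_def sector_def e by argo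
qed

lemma left_of_self: "\<not> left_of p q r p"
proof -
  have "det3 q r p = det3 p q r" by (rule det3_rot)
  then show ?thesis unfolding left_of_def by simp
qed

text \<open>The convex angle from \<open>r\<close> counterclockwise to \<open>w\<close> belongs to
  the left side as soon as \<open>w\<close> does.\<close>

lemma left_of_between:
  assumes "0 < det3 w q r" "left_of p q r w" "in_cone y w q r"
  shows "left_of p q r y"
proof -
  have e: "det3 y q r = det3 q r y" by (simp add: det3_expand algebra_simps)
  have y: "0 < det3 w q y" "0 < det3 q r y" using assms(1,3) unfolding in_cone_def e by (simp_all add: zero_less_mult_iff)
  have "det3 p q (det3 w q r *\<^sub>R y) = det3 p q (det3 y q r *\<^sub>R w + det3 w y r *\<^sub>R q + det3 w q y *\<^sub>R r)"
    by (rule arg_cong[where f = "det3 p q", OF cone_coords])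
  then have eq: "det3 w q r * det3 p q y = det3 q r y * det3 p q w + det3 w q y * det3 p q r"
    by (simp add: det3_add det3_scaleR e)
  show ?thesis
  proof (cases "0 < det3 p q r")
    case True
    then have "0 < det3 p q w" using assms(2) unfolding left_of_def by simp
    then have "0 < det3 q r y * det3 p q w" "0 < det3 w q y * det3 p q r" using True y by simp_all
    then have "0 < det3 w q r * det3 p q y" unfolding eq by simp
    then show ?thesis using y True assms(1) unfolding left_of_def by (simp add: zero_less_mult_iff)
  next
    case False
    then show ?thesis using y unfolding left_of_def by simp
  qed
qed

locale minimal_chord = chord_polygon +
  assumes free: "antipode_free z n"
    and no_ear: "\<And>t. \<not> ear z n t"
    and minimal: "\<And>t r'. r' < r \<Longrightarrow> \<not> inner_chord z n t r'"
begin

text \<open>In the triangle of a positive corner, which is no ear, the nearest vertex or antipode is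
  visible and on the left. It is not an antipode by \<open>free\<close>; another vertex of
  \<open>k\<close> would give a shorter inner chord; and the remaining vertices lie on the right of
  \<open>k\<close>.\<close>

lemma interior_corner_neg:
  assumes t: "1 \<le> t" "t < r"
  shows "det3 (z (t - 1)) (z t) (z (t + 1)) < 0"
proof (rule ccontr)
  assume "\<not> det3 (z (t - 1)) (z t) (z (t + 1)) < 0"
  moreover have "det3 (z (t - 1)) (z t) (z (t + 1)) \<noteq> 0" by (rule proj_polygonD(3)[OF z]) (use r in auto)
  ultimately have pos: "0 < det3 (z (t - 1)) (z t) (z (t + 1))" by simp
  have zt: "z (t + n - 1) = z (t - 1)" using per[of "t - 1"] by (simp add: algebra_simps)
  obtain s0 where s0: "t + 2 \<le> s0" "s0 \<le> t + n - 2"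
    "in_cone (z s0) (z (t - 1)) (z t) (z (t + 1)) \<or> in_cone (- z s0) (z (t - 1)) (z t) (z (t + 1))"
    using no_ear[of t] unfolding ear_def by blast
  then obtain y0 where y0: "y0 = z s0 \<or> y0 = - z s0" "in_cone y0 (z (t + n - 1)) (z t) (z (t + 1))"
    unfolding zt by blast
  have bnds: "t < t + n - 1" "t + n - 1 < t + n" "t < t + 1" "t + 1 < t + n" "t + n - 1 \<noteq> t + 1"
    "t < s0" "s0 < t + n" "s0 \<noteq> t + n - 1" "s0 \<noteq> t + 1" using s0 r by auto
  obtain s y where s: "t < s" "s < t + n" "s \<noteq> t + n - 1" "s \<noteq> t + 1" "y = z s \<or> y = - z s"
    "in_cone y (z (t + n - 1)) (z t) (z (t + 1))" "visible z n t s y"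
    and near: "\<forall>i j. t < i \<and> i < t + n \<and> t < j \<and> j < t + n \<and> crosses (z t) y (z i) (z j) \<longrightarrow>
       crosses (z t) (z (t + n - 1)) (z i) (z j) \<or> crosses (z t) (z (t + 1)) (z i) (z j)"
    by (rule corner_nearest[OF z bnds(1-5) visible_prev[OF z] visible_next[OF z] bnds(6-9) y0])
  have left: "left_of (z (t - 1)) (z t) (z (t + 1)) y"
    using left_of_in_cone[OF s(6)[unfolded zt]] pos by simp
  have yz: "y = z s"
  proof (rule ccontr)
    assume "y \<noteq> z s"
    then have "y = - z s" using s(5) by simp
    then show False using free s left unfolding antipode_free_def by auto
  qed
  have ic: "inner_chord z n t (s - t)"
    unfolding inner_chord_def using s left yz by auto
  consider "s \<le> r" | "n \<le> s" | "r < s" "s < n" by linarith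
  then show False
  proof cases
    case 1
    then show False using minimal[of "s - t" t] ic t by simp
  next
    case 2
    \<comment> \<open>The other end is the vertex \<open>s - n\<close> of \<open>k\<close>, before
      \<open>t\<close>. Read from that end, the chord has length \<open>n - (s - t)\<close>.\<close>
    have "inner_chord z n s (n - (s - t))" using inner_chord_commute[OF z ic] by simp
    moreover have "n - (s - t) < r" using 2 t by simp
    ultimately show False using minimal by blast
  next
    case 3
    have "\<not> left_of (k (t - 1)) (k t) (k (t + 1)) (z s)"
    proof (rule rest_right)
      fix j assume j: "t + 1 \<le> j" "j \<le> t + r - 1"
      consider "j < r" | "j = r" | "r < j" by linarith
      then show "\<not> crosses (z t) (z s) (k j) (k (j + 1))"
      proof cases
        case 1
        then have "k j = z j" "k (j + 1) = z (j + 1)" using k_eq j t by auto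
        then show ?thesis using s(7) j 1 3 r t yz unfolding visible_def by auto
      next
        case 2
        \<comment> \<open>This edge of \<open>k\<close> is the chord, about which visibility says
          nothing. It crosses neither side of the corner, so \<open>near\<close> shows that it does
          not cross the arc to \<open>z s\<close>.\<close>
        have kk: "k j = z r" "k (j + 1) = z n" using 2 k_eq[of r] k_per[of 0] k_eq[of 0] per[of 0] r by simp_all
        have tn: "t < r" "r < t + n" "t < n" "n < t + n" using t r by auto
        have "\<not> crosses (z t) (z (t + n - 1)) (z r) (z n)"
        proof (cases "t = 1")
          case True
          then show ?thesis using per[of 0] by simp
        next
          case False
          have "\<not> crosses (z (t - 1)) (z (t - 1 + 1)) (z r) (z 0)"
            by (rule chord_uncrossed(3)) (use False t r in auto)
          then show ?thesis unfolding zt using per[of 0] crosses_flip1[of "z t"] by simp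
        qed
        moreover have "\<not> crosses (z t) (z (t + 1)) (z r) (z n)"
        proof (cases "t = r - 1")
          case True
          then show ?thesis by simp
        next
          case False
          have "\<not> crosses (z t) (z (t + 1)) (z r) (z 0)"
            by (rule chord_uncrossed(3)) (use False t r in auto)
          then show ?thesis using per[of 0] by simp
        qed
        ultimately show ?thesis unfolding kk using near[rule_format, of r n] tn yz by blast
      next
        case 3
        have kk: "k j = z (j - (r + 1) + n)" "k (j + 1) = z (j - (r + 1) + n + 1)"
          using k_per[of "j - (r + 1)"] k_per[of "j - (r + 1) + 1"] k_eq[of "j - (r + 1)"] k_eq[of "j - (r + 1) + 1"]
            per[of "j - (r + 1)"] per[of "j - (r + 1) + 1"] j t 3 by (simp_all add: algebra_simps)
        then show ?thesis using s(7)[unfolded visible_def, rule_format, of "j - (r + 1) + n"] j 3 r t yz \<open>r < s\<close> \<open>s < n\<close>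
          by auto
      qed
    qed (use 3 t in auto)
    moreover have "k (t - 1) = z (t - 1)" "k t = z t" "k (t + 1) = z (t + 1)" using k_eq t by auto
    ultimately show False using left yz by simp
  qed
qed

text \<open>Suppose the corner between chord and first edge is positive. A nearest vertex or
  antipode in its triangle leads to a shorter inner chord or lies on the right of \<open>k\<close>.
  If the triangle is empty, cutting it off yields an inner chord from \<open>z 1\<close> to
  \<open>z r\<close> of length \<open>r - 1\<close>.\<close>

lemma first_corner_neg:
  assumes r3: "3 \<le> r"
  shows "det3 (z r) (z 0) (z 1) < 0"
proof (rule ccontr)
  assume "\<not> det3 (z r) (z 0) (z 1) < 0"
  have gp: "det3 (z i) (z j) (z l) \<noteq> 0" if "distinct [i, j, l]" "{i, j, l} \<subseteq> {0..<0 + n}" for i j l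
    using proj_polygon_gp[OF z that] .
  have "det3 (z r) (z 0) (z 1) \<noteq> 0" by (rule gp) (use r in auto)
  with \<open>\<not> det3 (z r) (z 0) (z 1) < 0\<close> have pos: "0 < det3 (z r) (z 0) (z 1)" by simp
  have zm: "z (- 1) = z (n - 1)" using per[of "- 1"] by simp
  have z0: "z n = z 0" using per[of 0] by simp
  have v1: "visible z n 0 1 (z 1)" using visible_next[OF z, of 0] by simp
  show False
  proof (cases "\<exists>s0 y0. 0 < s0 \<and> s0 < n \<and> s0 \<noteq> r \<and> s0 \<noteq> 1 \<and> (y0 = z s0 \<or> y0 = - z s0) \<and> in_cone y0 (z r) (z 0) (z 1)")
    case True
    then obtain s0 y0 where s0: "0 < s0" "s0 < 0 + n" "s0 \<noteq> r" "s0 \<noteq> 1" "y0 = z s0 \<or> y0 = - z s0" "in_cone y0 (z r) (z 0) (z 1)"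
      by auto
    have bnds: "0 < r" "r < 0 + n" "(0::int) < 1" "1 < 0 + n" "r \<noteq> 1" using r by auto
    obtain s y where s: "0 < s" "s < 0 + n" "s \<noteq> r" "s \<noteq> 1" "y = z s \<or> y = - z s"
      "in_cone y (z r) (z 0) (z 1)" "visible z n 0 s y"
      and "\<forall>i j. 0 < i \<and> i < 0 + n \<and> 0 < j \<and> j < 0 + n \<and> crosses (z 0) y (z i) (z j) \<longrightarrow>
       crosses (z 0) (z r) (z i) (z j) \<or> crosses (z 0) (z 1) (z i) (z j)"
      by (rule corner_nearest[OF z bnds chord_visible v1 s0])
    have left: "left_of (z (- 1)) (z 0) (z 1) y"
      by (rule left_of_between[OF pos chord_left s(6)])
    have yz: "y = z s"
    proof (rule ccontr)
      assume "y \<noteq> z s"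
      then have "y = - z s" using s(5) by simp
      then show False using free[unfolded antipode_free_def, rule_format, of 0 s] s left by auto
    qed
    have "s \<noteq> n - 1"
    proof
      assume "s = n - 1"
      then have "y = z (- 1)" using yz zm by simp
      then show False using left left_of_self by simp
    qed
    then have ic: "inner_chord z n 0 s"
      unfolding inner_chord_def using s left yz by auto
    show False
    proof (cases "s < r")
      case True
      then show False using minimal ic by blast
    next
      case False
      have "\<not> left_of (k (0 - 1)) (k 0) (k (0 + 1)) (z s)"
      proof (rule rest_right)
        fix j assume j: "0 + 1 \<le> j" "j \<le> 0 + r - 1"
        then have "k j = z j" "k (j + 1) = z (j + 1)" using k_eq by auto
        then show "\<not> crosses (z 0) (z s) (k j) (k (j + 1))"
          using s(7)[unfolded visible_def, rule_format, of j] j False s yz r by auto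
      qed (use False s r in auto)
      moreover have "k (0 - 1) = z r" using k_per[of "- 1"] k_eq[of r] r by simp
      moreover have "k 0 = z 0" "k (0 + 1) = z 1" using k_eq r by auto
      ultimately have "\<not> left_of (z r) (z 0) (z 1) y" using yz by simp
      then show False using left_of_in_cone[OF s(6)] pos by simp
    qed
  next
    case False
    then have emp: "\<not> in_cone (z s) (z r) (z 0) (z 1)" "\<not> in_cone (- z s) (z r) (z 0) (z 1)" if "0 < s" "s < n" "s \<noteq> r" "s \<noteq> 1" for s
      using that by blast+
    \<comment> \<open>The edge from \<open>z (n - 1)\<close> ends at the apex \<open>z 0\<close>, so
      the sector replaces Pasch's theorem. Since the chord leaves \<open>z 0\<close> on the left,
      this edge is outside the corner.\<close>
    have nosec: "\<not> sector (z 0) (z (n - 1)) (z r) (z 1)"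
      using left_of_no_sector[OF pos chord_left] gp[of "n - 1" 0 1] zm r by simp
    have vis: "\<not> crosses (z 1) (z r) (z j) (z (j + 1)) \<and> \<not> crosses (z 1) (z r) (- z j) (- z (j + 1))"
      if j: "2 \<le> j" "j \<le> n - 1" "j \<noteq> r" "j \<noteq> r - 1" for j
    proof (cases "j = n - 1")
      case True
      have "(of_bool (in_cone (z (n - 1)) (z r) (z 0) (z 1)) + of_bool (crosses (z 0) (z (n - 1)) (z r) (z 1)) :: nat)
          = of_bool (sector (z 0) (z (n - 1)) (z r) (z 1))"
        by (rule sector_iff; rule gp; use r in auto)
      then have "\<not> crosses (z 0) (z (n - 1)) (z r) (z 1)" using nosec by auto
      moreover have "\<not> crosses (z 1) (z r) (- z (n - 1)) (- z 0)"
      proof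
        assume "crosses (z 1) (z r) (- z (n - 1)) (- z 0)"
        then have "in_cone (- z (n - 1)) (z r) (z 0) (z 1)" by (rule crosses_antipodal_in_cone)
        then show False using emp(2)[of "n - 1"] r True j by auto
      qed
      ultimately show ?thesis using True z0 crosses_rev[of "z 1" "z r"] crosses_flip2[of "z 0" "z (n - 1)" "z r" "z 1"]
        by simp
    next
      case False
      have nc: "\<not> crosses (z r) (z 0) (z j) (z (j + 1))" "\<not> crosses (z r) (z 0) (- z j) (- z (j + 1))"
        "\<not> crosses (z 0) (z 1) (z j) (z (j + 1))" "\<not> crosses (z 0) (z 1) (- z j) (- z (j + 1))"
        using chord_uncrossed(1,2)[of j] edges_uncrossed(1,2)[of 0 j] j False r by auto
      have ic: "\<not> in_cone (z j) (z r) (z 0) (z 1)" "\<not> in_cone (- z j) (z r) (z 0) (z 1)"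
        "\<not> in_cone (z (j + 1)) (z r) (z 0) (z 1)" "\<not> in_cone (- z (j + 1)) (z r) (z 0) (z 1)"
        using emp[of j] emp[of "j + 1"] j False r by auto
      have "pasch_even (z r) (z 0) (z 1) (z j) (z (j + 1))"
        by (rule pasch_even_generic; rule gp; use j False r in simp)
      then have 1: "\<not> crosses (z r) (z 1) (z j) (z (j + 1))" using nc ic unfolding pasch_even_def by (simp add: of_bool_def split: if_splits)
      have "pasch_even (z r) (z 0) (z 1) (- z j) (- z (j + 1))"
        by (rule pasch_even_generic; (simp only: det3_minus neg_equal_0_iff_equal)?; rule gp; use j False r in simp)
      then have "\<not> crosses (z r) (z 1) (- z j) (- z (j + 1))" using nc ic unfolding pasch_even_def by (simp add: of_bool_def split: if_splits)
      with 1 show ?thesis by (simp add: crosses_flip1[of "z 1" "z r"])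
    qed
    have v: "visible z n 1 (1 + (r - 1)) (z (1 + (r - 1)))"
      unfolding visible_def
    proof (intro allI impI, elim conjE)
      fix j assume "1 + 1 \<le> j" "j \<le> 1 + n - 2" "j \<noteq> 1 + (r - 1)" "j \<noteq> 1 + (r - 1) - 1"
      then show "\<not> crosses (z 1) (z (1 + (r - 1))) (z j) (z (j + 1)) \<and> \<not> crosses (z 1) (z (1 + (r - 1))) (- z j) (- z (j + 1))"
        using vis[of j] by simp
    qed
    \<comment> \<open>Neither edge at \<open>z r\<close> enters the angle between \<open>z 0\<close>
      and \<open>z 1\<close>, so the new chord leaves \<open>z r\<close> on the same side as the old
      one.\<close>
    have secF: "\<not> sector (z r) (z a) (z 0) (z 1)" if a: "a = r - 1 \<or> a = r + 1" for a
    proof -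
      have "(of_bool (in_cone (z a) (z 0) (z r) (z 1)) + of_bool (crosses (z r) (z a) (z 0) (z 1)) :: nat)
          = of_bool (sector (z r) (z a) (z 0) (z 1))"
        by (rule sector_iff; rule gp; use r r3 a in auto)
      moreover have "\<not> in_cone (z a) (z 0) (z r) (z 1)"
        using emp(1)[of a] a r r3 in_cone_swap12[of "z a" "z 0" "z r" "z 1"] by auto
      moreover have "\<not> crosses (z r) (z a) (z 0) (z 1)"
        using edges_uncrossed(3)[of 0 "r - 1"] edges_uncrossed(3)[of 0 r] a r r3 crosses_flip1[of "z r" "z (r - 1)"] by auto
      ultimately show ?thesis by auto
    qed
    have "left_of (z (r - 1)) (z r) (z (r + 1)) (z 0) \<noteq> left_of (z (r - 1)) (z r) (z (r + 1)) (z 1) \<longleftrightarrow>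
      sector (z r) (z (r + 1)) (z 0) (z 1) \<noteq> sector (z r) (z (r - 1)) (z 0) (z 1)"
      by (rule left_of_change; rule gp; use r r3 in auto)
    then have lr: "left_of (z (r - 1)) (z r) (z (r + 1)) (z 1)" using secF chord_left' by auto
    obtain w where w: "generic w z n" using generic_exists[OF z] .
    have "left_of (z (1 - 1)) (z 1) (z (1 + 1)) (z r) = left_of (z (r - 1)) (z r) (z (r + 1)) (z 1)"
    proof (rule side_parity_chord[OF z w])
      fix j assume "1 + 1 \<le> j" "j \<le> 1 + n - 2" "j \<noteq> r" "j \<noteq> r - 1"
      then show "\<not> crosses (z 1) (z r) (z j) (z (j + 1))" using vis[of j] by simp
    qed (use r r3 in auto)
    then have "inner_chord z n 1 (r - 1)"
      unfolding inner_chord_def using v lr r r3 by simp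
    then show False using minimal[of "r - 1" 1] by simp
  qed
qed

end

text \<open>The flip, shifted by \<open>r\<close>, exchanges the ends of the chord and keeps left
  sides; it transfers \<open>first_corner_neg\<close> to the corner at \<open>z r\<close>.\<close>

lemma (in minimal_chord) flip: "minimal_chord (\<lambda>i. - z (r - i)) n r"
proof -
  define z' where "z' = (\<lambda>i. - z (- i))"
  have eq: "(\<lambda>i. - z (r - i)) = (\<lambda>i. z' (i + (- r)))" by (simp add: z'_def fun_eq_iff)
  have z': "proj_polygon z' n" unfolding z'_def by (rule proj_polygon_flip[OF z])
  show ?thesis
    unfolding eq
  proof
    show "proj_polygon (\<lambda>i. z' (i + (- r))) n" by (rule proj_polygon_shift[OF z'])
    show "inner_chord (\<lambda>i. z' (i + - r)) n 0 r"
      unfolding inner_chord_shift unfolding z'_def by (rule inner_chord_flip[OF z]) (use chord in simp)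
    show "antipode_free (\<lambda>i. z' (i + - r)) n"
      by (rule antipode_free_shift) (unfold z'_def, rule antipode_free_flip[OF z free])
    show "\<not> ear (\<lambda>i. z' (i + - r)) n t" for t
      unfolding ear_shift using ear_flip[OF z, of "t + - r"] no_ear unfolding z'_def by blast
    fix t r' assume r': "r' < r"
    have zz: "(\<lambda>i. - z' (- i)) = z" by (simp add: z'_def)
    show "\<not> inner_chord (\<lambda>i. z' (i + - r)) n t r'"
    proof
      assume "inner_chord (\<lambda>i. z' (i + - r)) n t r'"
      then have "inner_chord z' n (t + - r) r'" unfolding inner_chord_shift .
      then have "inner_chord (\<lambda>i. - z' (- i)) n (- (t + - r) - r') r'"
        by (intro inner_chord_flip[OF z']) simp
      then show False using minimal[OF r'] unfolding zz by blast
    qed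
  qed
qed

lemma (in minimal_chord) last_corner_neg:
  assumes "3 \<le> r"
  shows "det3 (z (r - 1)) (z r) (z 0) < 0"
proof -
  interpret f: minimal_chord "\<lambda>i. - z (r - i)" n r by (rule flip)
  have "det3 (- z (r - r)) (- z (r - 0)) (- z (r - 1)) < 0" by (rule f.first_corner_neg[OF assms])
  then show ?thesis by (simp add: det3_swap13[of "z 0" "z r" "z (r - 1)"])
qed

lemma (in minimal_chord) corners_neg: "det3 (k (i - 1)) (k i) (k (i + 1)) < 0"
proof -
  define j where "j = i mod (r + 1)"
  have kk: "k (i + a) = k (j + a)" for a unfolding k_def j_def by (simp add: mod_simps)
  have j: "0 \<le> j" "j \<le> r" unfolding j_def by (rule mod_range)+
  have eq: "k (i - 1) = k (j - 1)" "k i = k j" "k (i + 1) = k (j + 1)"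
    using kk[of "- 1"] kk[of 0] kk[of 1] by simp_all
  have k1: "k (- 1) = z r" "k (r + 1) = z 0" using k_per[of "- 1"] k_per[of 0] k_eq r by simp_all
  consider "1 \<le> j" "j < r" | "j = 0" | "j = r" "r \<noteq> 0" using j by linarith
  then show ?thesis unfolding eq
  proof cases
    case 1
    then show "det3 (k (j - 1)) (k j) (k (j + 1)) < 0" using interior_corner_neg[of j] k_eq by simp
  next
    case 2
    \<comment> \<open>For \<open>r = 2\<close> the polygon \<open>k\<close> is a triangle, and its
      three corners have the same determinant.\<close>
    have "det3 (z r) (z 0) (z 1) < 0"
    proof (cases "r = 2")
      case True
      then show ?thesis using interior_corner_neg[of 1] det3_rot'[of "z 2" "z 0" "z 1"] by simp
    next
      case False
      then show ?thesis using first_corner_neg r by simp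
    qed
    then show "det3 (k (j - 1)) (k j) (k (j + 1)) < 0" using 2 k1 k_eq r by simp
  next
    case 3
    have "det3 (z (r - 1)) (z r) (z 0) < 0"
    proof (cases "r = 2")
      case True
      then show ?thesis using interior_corner_neg[of 1] det3_rot[of "z 1" "z 2" "z 0"] by simp
    next
      case False
      then show ?thesis using last_corner_neg r by simp
    qed
    then show "det3 (k (j - 1)) (k j) (k (j + 1)) < 0" using 3 k1 k_eq r by simp
  qed
qed

section \<open>Closed polygons all of whose turns are negative\<close>

lemma nat_mod_bound:
  fixes p :: int
  assumes "0 < p" "int m = p - 1"
  shows "int (nat (i mod p)) = i mod p" "nat (i mod p) \<le> m"
proof -
  show 1: "int (nat (i mod p)) = i mod p" using assms by simp
  have "int (nat (i mod p)) \<le> int m" unfolding 1 using pos_mod_bound[OF assms(1), of i] assms(2) by linarith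
  then show "nat (i mod p) \<le> m" by linarith
qed

definition in_halfspace :: "(int \<Rightarrow> real^3) \<Rightarrow> bool" where
  "in_halfspace z \<longleftrightarrow> (\<exists>f. f \<noteq> 0 \<and> (\<forall>i. 0 \<le> f \<bullet> z i))"

text \<open>The results on locally convex paths ask for positive turns, so they are applied to
  antipodes of vertices. The bound \<open>m < n\<close> keeps the path within one period.\<close>

lemma window_conditions:
  fixes z :: "int \<Rightarrow> real^3" and m :: nat
  assumes z: "proj_polygon z n" and m: "int m < n"
  shows "i < j \<Longrightarrow> j < l \<Longrightarrow> l \<le> m \<Longrightarrow> det3 (- z (c + int i)) (- z (c + int j)) (- z (c + int l)) \<noteq> 0"
    "i + 2 \<le> j \<Longrightarrow> j + 1 \<le> m \<Longrightarrow>
      \<not> crosses (- z (c + int i)) (- z (c + int (i + 1))) (- z (c + int j)) (- z (c + int (j + 1)))"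
proof -
  show "det3 (- z (c + int i)) (- z (c + int j)) (- z (c + int l)) \<noteq> 0" if "i < j" "j < l" "l \<le> m"
    using proj_polygonD(3)[OF z, of "c + int i" "c + int j" "c + int l"] that m by simp
  have e: "c + int (i + 1) = c + int i + 1" for i by simp
  show "\<not> crosses (- z (c + int i)) (- z (c + int (i + 1))) (- z (c + int j)) (- z (c + int (j + 1)))"
    if "i + 2 \<le> j" "j + 1 \<le> m"
    unfolding e crosses_minus by (rule proj_polygonD(4)[OF z]) (use that m in auto)
qed

lemma negative_turns_in_halfspace:
  assumes z: "proj_polygon z n" and neg: "\<And>i. det3 (z (i - 1)) (z i) (z (i + 1)) < 0"
  shows "in_halfspace z"
proof -
  have n: "3 \<le> n" by (rule proj_polygonD(1)[OF z])
  define m where "m = nat (n - 1)"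
  have m: "int m = n - 1" "2 \<le> m" using n by (auto simp: m_def)
  have "\<exists>f. \<forall>i. 0 \<le> i \<and> i \<le> m \<longrightarrow> 0 < f \<bullet> (- z (0 + int i))"
  proof (rule convex_path_halfspace)
    fix i :: nat
    have e: "0 + int i = int i + 1 - 1" "0 + int (i + 1) = int i + 1" "0 + int (i + 2) = int i + 1 + 1" by simp_all
    show "0 < det3 (- z (0 + int i)) (- z (0 + int (i + 1))) (- z (0 + int (i + 2)))"
      unfolding e using neg[of "int i + 1"] by simp
  qed (use window_conditions(1)[OF z, where m = m and c = 0] window_conditions(2)[OF z, where m = m and c = 0] m in auto)
  then obtain f where f: "\<And>i. i \<le> m \<Longrightarrow> 0 < f \<bullet> (- z (int i))" by auto
  have "0 \<le> (- f) \<bullet> z i" for i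
  proof -
    have "z i = z (i mod n)" by (rule periodic_mod[symmetric], rule proj_polygonD(2)[OF z])
    moreover have "nat (i mod n) \<le> m" "int (nat (i mod n)) = i mod n" using nat_mod_bound[of n m i] n m by simp_all
    ultimately show ?thesis using f[of "nat (i mod n)"] by simp
  qed
  moreover have "f \<noteq> 0" using f[of 0] by auto
  ultimately show ?thesis unfolding in_halfspace_def by (intro exI[of _ "- f"]) auto
qed

text \<open>The convex window of one period may be shorter than the period. Its first two vertices
  \<open>s\<close> and \<open>s + 1\<close> span extreme rays, however. If the polygon is cut open
  between them, so that the path runs from \<open>s + 1\<close> around to \<open>s\<close>, the
  window must contain both ends and is the whole period.\<close>

lemma negative_turns_convex:
  assumes z: "proj_polygon z p" and neg: "\<And>i. det3 (z (i - 1)) (z i) (z (i + 1)) < 0"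
    and il: "l mod p \<noteq> i mod p" "l mod p \<noteq> (i + 1) mod p"
  shows "det3 (z i) (z (i + 1)) (z l) < 0"
proof -
  have p: "3 \<le> p" by (rule proj_polygonD(1)[OF z])
  have per: "z (i mod p) = z i" for i by (rule periodic_mod, rule proj_polygonD(2)[OF z])
  have per': "z i = z j" if "i mod p = j mod p" for i j using per[of i] per[of j] that by simp
  define m where "m = nat (p - 1)"
  have m: "int m = p - 1" "2 \<le> m" using p by (auto simp: m_def)
  define V where "V = (\<lambda>c j. - z (c + int j))"
  have "\<exists>s e. 0 \<le> s \<and> s + 2 \<le> e \<and> e \<le> m \<and> positive_on (V c) s e \<and>
      (\<forall>i. 0 \<le> i \<and> i \<le> m \<longrightarrow> V c i \<in> convex_cone hull (V c ` {s..e}))" for c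
  proof (rule convex_path_window)
    fix i :: nat
    have e: "c + int i = c + int i + 1 - 1" "c + int (i + 1) = c + int i + 1" "c + int (i + 2) = c + int i + 1 + 1" by simp_all
    show "0 < det3 (V c i) (V c (i + 1)) (V c (i + 2))"
      unfolding V_def e(2,3) using neg[of "c + int i + 1"] by simp
  qed (use window_conditions(1)[OF z, where m = m and c = c] window_conditions(2)[OF z, where m = m and c = c] m
      in \<open>auto simp: V_def\<close>)
  then have win: "\<exists>s e. s + 2 \<le> e \<and> e \<le> m \<and> positive_on (V c) s e \<and>
      (\<forall>i. i \<le> m \<longrightarrow> V c i \<in> convex_cone hull (V c ` {s..e}))" for c
    by simp
  obtain s e where "s + 2 \<le> e \<and> e \<le> m \<and> positive_on (V 0) s e \<and>
      (\<forall>i. i \<le> m \<longrightarrow> V 0 i \<in> convex_cone hull (V 0 ` {s..e}))" using win[of 0] by (elim exE)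
  then have se: "s + 2 \<le> e" "e \<le> m" "positive_on (V 0) s e"
    and hull0: "\<And>i. i \<le> m \<Longrightarrow> V 0 i \<in> convex_cone hull (V 0 ` {s..e})" by blast+
  have pos: "0 < det3 (V 0 a) (V 0 b) (V 0 c)" if "s \<le> a" "a < b" "b < c" "c \<le> e" for a b c
    using se(3) that unfolding positive_on_def by blast
  have gp: "det3 (V 0 a) (V 0 b) (V 0 c) \<noteq> 0" if "distinct [a, b, c]" "a \<le> m" "b \<le> m" "c \<le> m" for a b c
    using proj_polygon_gp[OF z, of "int a" "int b" "int c" 0] that m unfolding V_def by simp
  define c where "c = int s + 1"
  obtain s' e' where "s' + 2 \<le> e' \<and> e' \<le> m \<and> positive_on (V c) s' e' \<and>
      (\<forall>i. i \<le> m \<longrightarrow> V c i \<in> convex_cone hull (V c ` {s'..e'}))" using win[of c] by (elim exE)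
  then have se': "s' + 2 \<le> e'" "e' \<le> m" "positive_on (V c) s' e'"
    and hullc: "\<And>i. i \<le> m \<Longrightarrow> V c i \<in> convex_cone hull (V c ` {s'..e'})" by blast+
  have Vc: "\<exists>i\<le>m. V c j = V 0 i \<and> int i = (c + int j) mod p" if "j \<le> m" for j
  proof -
    define i where "i = nat ((c + int j) mod p)"
    have "int i = (c + int j) mod p" "i \<le> m" unfolding i_def using nat_mod_bound[of p m "c + int j"] p m by simp_all
    then show ?thesis unfolding V_def using per[of "c + int j"] by (intro exI[of _ i]) simp
  qed
  have sm: "int s < p" "int s + 1 < p" using se m by linarith+
  have Vc0: "V c 0 = V 0 (s + 1)" by (simp add: V_def c_def algebra_simps)
  have "c + int m = int s + p" using m(1) by (simp add: c_def)
  then have Vcm: "V c m = V 0 s" using proj_polygonD(2)[OF z, of "int s"] by (simp add: V_def)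
  have i_ne1: "i \<noteq> s + 1" if "int i = (c + int j) mod p" "1 \<le> j" "j \<le> m" for i j
    using mod_neq_window[of "int s + 1" "c + int j" p] that sm m unfolding c_def by auto
  have i_ne0: "i \<noteq> s" if "int i = (c + int j) mod p" "j < m" for i j
    using mod_neq_window[of "int s" "c + int j" p] that sm m unfolding c_def by auto
  \<comment> \<open>Sums of two edge functionals at a common vertex: \<open>f\<close> vanishes only
    at the vertex \<open>s + 1\<close> and \<open>g\<close> only at \<open>s\<close>, and both are
    positive at all others.\<close>
  define f where "f = cross3 (V 0 s) (V 0 (s + 1)) + cross3 (V 0 (s + 1)) (V 0 (s + 2))"
  define g where "g = cross3 (V 0 s) (V 0 (s + 1)) + cross3 (V 0 e) (V 0 s)"
  have f: "f \<bullet> x = det3 (V 0 s) (V 0 (s + 1)) x + det3 x (V 0 (s + 1)) (V 0 (s + 2))" for x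
    unfolding f_def inner_add_left det3_cross[symmetric] by (simp add: det3_expand algebra_simps)
  have g: "g \<bullet> x = det3 (V 0 s) (V 0 (s + 1)) x + det3 (V 0 s) x (V 0 e)" for x
    unfolding g_def inner_add_left det3_cross[symmetric] by (simp add: det3_expand algebra_simps)
  have nn1: "0 \<le> det3 (V 0 s) (V 0 (s + 1)) (V 0 i)" if "i \<le> m" for i
  proof -
    have "0 \<le> cross3 (V 0 s) (V 0 (s + 1)) \<bullet> V 0 i"
    proof (rule cone_hull_nonneg[OF _ hull0[OF that]])
      fix x assume "x \<in> V 0 ` {s..e}"
      then obtain j where "x = V 0 j" "s \<le> j" "j \<le> e" by auto
      then show "0 \<le> cross3 (V 0 s) (V 0 (s + 1)) \<bullet> x"
        using pos[of s "s + 1" j] unfolding det3_cross[symmetric] by (cases "j = s \<or> j = s + 1") auto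
    qed
    then show ?thesis unfolding det3_cross[symmetric] .
  qed
  have nn2: "0 \<le> det3 (V 0 i) (V 0 (s + 1)) (V 0 (s + 2))" if "s + 2 \<le> i" "i \<le> e" for i
    using pos[of "s + 1" "s + 2" i] that det3_rot'[of "V 0 i" "V 0 (s + 1)" "V 0 (s + 2)"] by (cases "i = s + 2") auto
  have nn2': "0 \<le> det3 (V 0 i) (V 0 (s + 1)) (V 0 (s + 2))" if "i \<le> m" for i
  proof -
    have "0 \<le> cross3 (V 0 (s + 1)) (V 0 (s + 2)) \<bullet> V 0 i"
    proof (rule cone_hull_nonneg[OF _ hull0[OF that]])
      fix x assume "x \<in> V 0 ` {s..e}"
      then obtain j where j: "x = V 0 j" "s \<le> j" "j \<le> e" by auto
      consider "j = s" | "j = s + 1" | "s + 2 \<le> j" using j by linarith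
      then show "0 \<le> cross3 (V 0 (s + 1)) (V 0 (s + 2)) \<bullet> x"
      proof cases
        case 1
        then show ?thesis unfolding j det3_cross'[symmetric] using pos[of s "s + 1" "s + 2"] se by simp
      next
        case 2
        then show ?thesis unfolding j det3_cross[symmetric] by simp
      next
        case 3
        then show ?thesis unfolding j det3_cross'[symmetric] using nn2[of j] j se by simp
      qed
    qed
    then show ?thesis unfolding det3_cross'[symmetric] .
  qed
  have nn3: "0 \<le> det3 (V 0 s) (V 0 i) (V 0 e)" if "i \<le> m" for i
  proof -
    have "0 \<le> cross3 (V 0 e) (V 0 s) \<bullet> V 0 i"
    proof (rule cone_hull_nonneg[OF _ hull0[OF that]])
      fix x assume "x \<in> V 0 ` {s..e}"
      then obtain j where "x = V 0 j" "s \<le> j" "j \<le> e" by auto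
      then show "0 \<le> cross3 (V 0 e) (V 0 s) \<bullet> x"
        using pos[of s j e] unfolding det3_cross[symmetric] det3_rot'[of "V 0 e"]
        by (cases "j = s \<or> j = e") auto
    qed
    then show ?thesis unfolding det3_cross[symmetric] det3_rot'[of "V 0 e"] .
  qed
  have fpos: "0 < f \<bullet> V 0 i" if "i \<le> m" "i \<noteq> s + 1" for i
  proof (cases "i = s")
    case True
    then show ?thesis unfolding f using pos[of s "s + 1" "s + 2"] se by simp
  next
    case False
    then have "det3 (V 0 s) (V 0 (s + 1)) (V 0 i) \<noteq> 0" using gp[of s "s + 1" i] that se by simp
    then show ?thesis unfolding f using nn1[OF that(1)] nn2'[OF that(1)] by linarith
  qed
  have gpos: "0 < g \<bullet> V 0 i" if "i \<le> m" "i \<noteq> s" for i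
  proof (cases "i = s + 1")
    case True
    then show ?thesis unfolding g using pos[of s "s + 1" e] se by simp
  next
    case False
    then have "det3 (V 0 s) (V 0 (s + 1)) (V 0 i) \<noteq> 0" using gp[of s "s + 1" i] that se by simp
    then show ?thesis unfolding g using nn1[OF that(1)] nn3[OF that(1)] by linarith
  qed
  have nz: "V 0 s \<noteq> 0" "V 0 (s + 1) \<noteq> 0" using pos[of s "s + 1" "s + 2"] se by force+
  have "s' = 0"
  proof (rule ccontr)
    assume "s' \<noteq> 0"
    have "0 < f \<bullet> V c 0"
    proof (rule cone_hull_pos[OF _ hullc])
      fix x assume "x \<in> V c ` {s'..e'}"
      then obtain j where j: "x = V c j" "s' \<le> j" "j \<le> e'" by auto
      then obtain i where "i \<le> m" "x = V 0 i" "int i = (c + int j) mod p" using Vc[of j] se' by auto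
      then show "0 < f \<bullet> x" using fpos[of i] i_ne1[of i j] j \<open>s' \<noteq> 0\<close> se' by simp
    qed (use nz Vc0 in auto)
    then show False unfolding Vc0 f by simp
  qed
  moreover have "e' = m"
  proof (rule ccontr)
    assume "e' \<noteq> m"
    have "0 < g \<bullet> V c m"
    proof (rule cone_hull_pos[OF _ hullc])
      fix x assume "x \<in> V c ` {s'..e'}"
      then obtain j where j: "x = V c j" "s' \<le> j" "j \<le> e'" by auto
      then obtain i where "i \<le> m" "x = V 0 i" "int i = (c + int j) mod p" using Vc[of j] se' by auto
      then show "0 < g \<bullet> x" using gpos[of i] i_ne0[of i j] j \<open>e' \<noteq> m\<close> se' by simp
    qed (use nz Vcm in auto)
    then show False unfolding Vcm g by simp
  qed
  ultimately have P: "0 < det3 (V c a) (V c b) (V c d)" if "a < b" "b < d" "d \<le> m" for a b d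
    using se'(3) that unfolding positive_on_def by blast
  have ix: "\<exists>a\<le>m. z i = - V c a \<and> int a = (i - c) mod p" for i
  proof -
    define a where "a = nat ((i - c) mod p)"
    have a: "int a = (i - c) mod p" "a \<le> m" unfolding a_def using nat_mod_bound[of p m "i - c"] p m by simp_all
    have "(c + int a) mod p = i mod p" unfolding a by (simp add: mod_simps)
    then have "z (c + int a) = z i" by (rule per')
    then show ?thesis using a unfolding V_def by (intro exI[of _ a]) simp
  qed
  obtain a where a: "a \<le> m" "z i = - V c a" "int a = (i - c) mod p" using ix by blast
  obtain b where b: "b \<le> m" "z l = - V c b" "int b = (l - c) mod p" using ix by blast
  have ba: "b \<noteq> a"
  proof
    assume "b = a"
    then have "(l - c) mod p = (i - c) mod p" using a b by simp
    then have "(l - c + c) mod p = (i - c + c) mod p" by (metis mod_add_left_eq)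
    then show False using il by simp
  qed
  have ba1: "int b \<noteq> (int a + 1) mod p"
  proof
    assume "int b = (int a + 1) mod p"
    then have "(l - c) mod p = (i - c + 1) mod p" using a b by (simp add: mod_simps)
    then have "(l - c + c) mod p = (i - c + 1 + c) mod p" by (metis mod_add_left_eq)
    then show False using il by (simp add: algebra_simps)
  qed
  show ?thesis
  proof (cases "a = m")
    case True
    then have "(int a + 1) mod p = 0" using m by simp
    then have "b \<noteq> 0" using ba1 by simp
    have "(i + 1) mod p = c mod p"
    proof -
      have "(i - c + 1) mod p = 0" using \<open>(int a + 1) mod p = 0\<close> a(3) by (simp add: mod_simps)
      then have "(i - c + 1 + c) mod p = (0 + c) mod p" by (metis mod_add_left_eq mod_0)
      then show ?thesis by (simp add: algebra_simps)
    qed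
    then have "z (i + 1) = - V c 0" using per'[of "i + 1" c] by (simp add: V_def)
    moreover have "0 < det3 (V c 0) (V c b) (V c m)" using P[of 0 b m] \<open>b \<noteq> 0\<close> ba True b by simp
    ultimately show ?thesis using a b True det3_rot'[of "V c m" "V c 0" "V c b"] by simp
  next
    case False
    have am: "(int a + 1) mod p = int a + 1" using False a m by simp
    have "c + int (a + 1) = (i - c) mod p + (c + 1)" using a(3) by simp
    then have "(c + int (a + 1)) mod p = (i - c + (c + 1)) mod p" by (simp only: mod_add_left_eq)
    then have "(i + 1) mod p = (c + int (a + 1)) mod p" by simp
    then have "z (i + 1) = - V c (a + 1)" using per'[of "i + 1" "c + int (a + 1)"] by (simp add: V_def)
    moreover have "0 < det3 (V c a) (V c (a + 1)) (V c b)"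
    proof (cases "b < a")
      case True
      then show ?thesis using P[of b a "a + 1"] a False det3_rot[of "V c a" "V c (a + 1)" "V c b"] by simp
    next
      case False
      then show ?thesis using P[of a "a + 1" b] ba ba1 am b by simp
    qed
    ultimately show ?thesis using a b by simp
  qed
qed

section \<open>The cone over a convex polygon\<close>

lemma finite_arg_min:
  fixes f :: "'a \<Rightarrow> real"
  assumes "finite S" "S \<noteq> {}"
  shows "\<exists>x\<in>S. \<forall>y\<in>S. f x \<le> f y"
proof -
  have "Min (f ` S) \<in> f ` S" using assms by simp
  then obtain x where x: "x \<in> S" "f x = Min (f ` S)" by auto
  have "f x \<le> f y" if "y \<in> S" for y unfolding x(2) using assms that by simp
  then show ?thesis using x by blast
qed

text \<open>A segment from \<open>c\<close> to an outer point leaves the cone through the edge plane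
  that it meets first. The exit point lies on the open arc of that edge, which makes it a forbidden
  crossing.\<close>

lemma convex_polygon_exit:
  assumes z: "proj_polygon z p"
    and conv: "\<And>i l. l mod p \<noteq> i mod p \<Longrightarrow> l mod p \<noteq> (i + 1) mod p \<Longrightarrow> det3 (z i) (z (i + 1)) (z l) < 0"
    and c: "\<And>i. det3 (z i) (z (i + 1)) c < 0"
    and d: "\<And>i. 0 < det3 (z i) (z (i + 1)) d \<Longrightarrow>
      det3 c d (z i) \<noteq> 0 \<and> det3 c d (z (i + 1)) \<noteq> 0 \<and> \<not> crosses c d (z i) (z (i + 1))"
  shows "det3 (z i) (z (i + 1)) d \<le> 0"
proof (rule ccontr)
  assume "\<not> det3 (z i) (z (i + 1)) d \<le> 0"
  then have i0: "0 < det3 (z i) (z (i + 1)) d" by simp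
  have p: "3 \<le> p" by (rule proj_polygonD(1)[OF z])
  have per: "z (i mod p) = z i" for i by (rule periodic_mod, rule proj_polygonD(2)[OF z])
  have per1: "z (i mod p + 1) = z (i + 1)" for i
    using per[of "i mod p + 1"] per[of "i + 1"] by (simp add: mod_simps)
  define G where "G = (\<lambda>i x. - det3 (z i) (z (i + 1)) x)"
  have Glin: "G i (s *\<^sub>R x + t *\<^sub>R y) = s * G i x + t * G i y" for i s t x y
    unfolding G_def by (simp add: det3_add det3_scaleR)
  have Gc: "0 < G i c" for i using c[of i] by (simp add: G_def)
  \<comment> \<open>The parameter at which the segment from \<open>c\<close> to \<open>d\<close>
    reaches the plane of edge \<open>i\<close>.\<close>
  define \<rho> where "\<rho> = (\<lambda>i. G i c / (G i c - G i d))"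
  let ?I = "{i \<in> {0..<p}. G i d < 0}"
  have "i mod p \<in> ?I" using i0 p by (simp add: G_def per per1)
  then have "finite ?I" "?I \<noteq> {}" by (auto intro: finite_subset[of _ "{0..<p}"])
  then have "\<exists>i\<in>?I. \<forall>j\<in>?I. \<rho> i \<le> \<rho> j" by (rule finite_arg_min)
  then obtain i where i: "i \<in> ?I" "\<forall>j\<in>?I. \<rho> i \<le> \<rho> j" ..
  have Gi: "G i d < 0" using i by simp
  have \<rho>: "0 < \<rho> i" "\<rho> i < 1" using Gc[of i] Gi by (simp_all add: \<rho>_def)
  define x where "x = (1 - \<rho> i) *\<^sub>R c + \<rho> i *\<^sub>R d"
  have Gx: "G j x = G j c - \<rho> i * (G j c - G j d)" for j
    unfolding x_def Glin by (simp add: algebra_simps)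
  have Gix: "G i x = 0" unfolding Gx using Gc[of i] Gi by (simp add: \<rho>_def)
  have Gnn0: "0 \<le> G j x" if j: "j \<in> {0..<p}" for j
  proof (cases "G j d < 0")
    case True
    then have "\<rho> i \<le> G j c / (G j c - G j d)" using i(2) j by (simp add: \<rho>_def)
    moreover have "0 < G j c - G j d" using True Gc[of j] by simp
    ultimately have "\<rho> i * (G j c - G j d) \<le> G j c" by (simp add: pos_le_divide_eq)
    then show ?thesis unfolding Gx by simp
  next
    case False
    then show ?thesis unfolding x_def Glin using \<rho> Gc[of j] by (intro add_nonneg_nonneg mult_nonneg_nonneg) auto
  qed
  have Gnn: "0 \<le> G j x" for j
    using Gnn0[of "j mod p"] p by (simp add: G_def per per1)
  let ?m = "det3 (z i) (z (i + 1)) (z (i + 2))"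
  have mods: "(i + 2) mod p \<noteq> i mod p" "(i + 2) mod p \<noteq> (i + 1) mod p" "(i - 1) mod p \<noteq> (i + 1) mod p" "(i - 1) mod p \<noteq> i mod p"
    "i mod p \<noteq> (i + 1) mod p"
    using mod_neq_window[of i "i + 2" p] mod_neq_window[of "i + 1" "i + 2" p] mod_neq_window[of "i - 1" "i + 1" p]
      mod_neq_window[of "i - 1" i p] mod_neq_window[of i "i + 1" p] p by auto
  have m: "?m < 0" using conv[of "i + 2" i] mods by simp
  have "det3 (z i) (z (i + 1)) x = 0" using Gix by (simp add: G_def)
  then have xm: "?m *\<^sub>R x = det3 x (z (i + 1)) (z (i + 2)) *\<^sub>R z i + det3 (z i) x (z (i + 2)) *\<^sub>R z (i + 1)"
    using cone_coords[of "z i" "z (i + 1)" "z (i + 2)" x] by simp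
  define \<alpha> \<beta> where "\<alpha> = det3 x (z (i + 1)) (z (i + 2)) / ?m" and "\<beta> = det3 (z i) x (z (i + 2)) / ?m"
  have x: "x = \<alpha> *\<^sub>R z i + \<beta> *\<^sub>R z (i + 1)"
  proof -
    have "x = (1 / ?m) *\<^sub>R (?m *\<^sub>R x)" using m by simp
    then show ?thesis unfolding xm \<alpha>_def \<beta>_def by (simp add: scaleR_add_right)
  qed
  have d': "det3 c d (z i) \<noteq> 0" "det3 c d (z (i + 1)) \<noteq> 0" "\<not> crosses c d (z i) (z (i + 1))"
    using d[of i] Gi by (simp_all add: G_def)
  have cdx: "det3 c d x = 0" unfolding x_def by (simp add: det3_add det3_scaleR)
  have "\<alpha> \<noteq> 0"
  proof
    assume "\<alpha> = 0"
    then have "\<beta> = 0" using cdx d'(2) unfolding x by (simp add: det3_scaleR)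
    then have "x = 0" using x \<open>\<alpha> = 0\<close> by simp
    then have "det3 c x (z i) = 0" by simp
    then have "\<rho> i * det3 c d (z i) = 0" unfolding x_def by (simp add: det3_add det3_scaleR)
    then show False using d' \<rho> by simp
  qed
  moreover have "\<beta> \<noteq> 0"
  proof
    assume "\<beta> = 0"
    then have "\<alpha> = 0" using cdx d'(1) unfolding x by (simp add: det3_scaleR)
    then show False using calculation by simp
  qed
  \<comment> \<open>The functional of the next edge vanishes at \<open>z (i + 1)\<close> and is
    positive at \<open>z i\<close>, so it reads off the coefficient \<open>\<alpha>\<close>; the
    preceding edge does the same for \<open>\<beta>\<close>.\<close>
  moreover have "0 \<le> \<alpha>"
  proof -
    have "G (i + 1) x = \<alpha> * G (i + 1) (z i)" unfolding x Glin by (simp add: G_def)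
    moreover have "0 < G (i + 1) (z i)" using conv[of i "i + 1"] mods by (simp add: G_def add.commute add.left_commute)
    ultimately show ?thesis using Gnn[of "i + 1"] by (simp add: zero_le_mult_iff)
  qed
  moreover have "0 \<le> \<beta>"
  proof -
    have "G (i - 1) x = \<beta> * G (i - 1) (z (i + 1))" unfolding x Glin by (simp add: G_def)
    moreover have "0 < G (i - 1) (z (i + 1))" using conv[of "i + 1" "i - 1"] mods by (simp add: G_def)
    ultimately show ?thesis using Gnn[of "i - 1"] by (simp add: zero_le_mult_iff)
  qed
  ultimately have "0 < \<alpha>" "0 < \<beta>" by simp_all
  moreover have "(1 - \<rho> i) *\<^sub>R c + \<rho> i *\<^sub>R d = \<alpha> *\<^sub>R z i + \<beta> *\<^sub>R z (i + 1)" using x unfolding x_def .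
  moreover have "det3 d (z i) (z (i + 1)) \<noteq> 0"
    using Gi det3_rot'[of d "z i" "z (i + 1)"] by (simp add: G_def)
  ultimately have "crosses c d (z i) (z (i + 1))" using \<rho> by (intro crossesI[of "1 - \<rho> i" c "\<rho> i" d \<alpha> "z i" \<beta>]) auto
  then show False using d' by simp
qed

text \<open>As corner 1 is no ear, some vertex or antipode \<open>\<sigma> *\<^sub>R z s0\<close>
  lies in the cone over \<open>k\<close>. Edges of the rest do not cross \<open>k\<close>, so the
  whole rest, multiplied by \<open>\<sigma>\<close>, lies there. If \<open>\<sigma>\<close> were
  \<open>- 1\<close>, the edge from \<open>- z (r + 1)\<close> to \<open>- z r\<close> would put
  \<open>- z r\<close> into the closed cone, on the wrong side of the first edge.\<close>

lemma (in minimal_chord) in_halfspace: "in_halfspace z"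
proof -
  have conv: "det3 (k i) (k (i + 1)) (k l) < 0" if "l mod (r + 1) \<noteq> i mod (r + 1)" "l mod (r + 1) \<noteq> (i + 1) mod (r + 1)" for i l
    by (rule negative_turns_convex[OF k_polygon corners_neg that])
  have convle: "det3 (k i) (k (i + 1)) (k l) \<le> 0" for i l
  proof (cases "l mod (r + 1) = i mod (r + 1) \<or> l mod (r + 1) = (i + 1) mod (r + 1)")
    case True
    then have "k l = k i \<or> k l = k (i + 1)" unfolding k_def by auto
    then show ?thesis by auto
  next
    case False
    then show ?thesis using conv[of l i] by simp
  qed
  have mods: "i mod (r + 1) \<noteq> (i + 1) mod (r + 1)" for i using mod_neq_window[of i "i + 1" "r + 1"] r by simp
  obtain s0 where s0: "3 \<le> s0" "s0 \<le> n - 1" "in_cone (z s0) (z 0) (z 1) (z 2) \<or> in_cone (- z s0) (z 0) (z 1) (z 2)"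
    using no_ear[of 1] unfolding ear_def by (auto simp: add.commute)
  then obtain \<sigma> :: real where \<sigma>: "\<sigma> = 1 \<or> \<sigma> = - 1" "in_cone (\<sigma> *\<^sub>R z s0) (z 0) (z 1) (z 2)" by fastforce
  have k012: "k 0 = z 0" "k 1 = z 1" "k 2 = z 2" using k_eq r by auto
  have inside: "det3 (k i) (k (i + 1)) y < 0" if y: "in_cone y (k 0) (k 1) (k 2)" for i y
  proof -
    have A: "det3 (k 0) (k 1) (k 2) < 0" using corners_neg[of 1] by simp
    have a: "det3 y (k 1) (k 2) < 0" "det3 (k 0) y (k 2) < 0" "det3 (k 0) (k 1) y < 0"
      using y A unfolding in_cone_def by (simp_all add: zero_less_mult_iff)
    have "det3 (k i) (k (i + 1)) (det3 (k 0) (k 1) (k 2) *\<^sub>R y) =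
       det3 (k i) (k (i + 1)) (det3 y (k 1) (k 2) *\<^sub>R k 0 + det3 (k 0) y (k 2) *\<^sub>R k 1 + det3 (k 0) (k 1) y *\<^sub>R k 2)"
      by (rule arg_cong[where f = "det3 (k i) (k (i + 1))", OF cone_coords])
    then have eq: "det3 (k 0) (k 1) (k 2) * det3 (k i) (k (i + 1)) y = det3 y (k 1) (k 2) * det3 (k i) (k (i + 1)) (k 0)
       + det3 (k 0) y (k 2) * det3 (k i) (k (i + 1)) (k 1) + det3 (k 0) (k 1) y * det3 (k i) (k (i + 1)) (k 2)"
      by (simp add: det3_add det3_scaleR)
    have nn: "0 \<le> det3 y (k 1) (k 2) * det3 (k i) (k (i + 1)) (k 0)" "0 \<le> det3 (k 0) y (k 2) * det3 (k i) (k (i + 1)) (k 1)"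
      "0 \<le> det3 (k 0) (k 1) y * det3 (k i) (k (i + 1)) (k 2)"
      using a convle[of i] by (simp_all add: mult_nonpos_nonpos)
    have "\<exists>l\<in>{0, 1, 2::int}. l mod (r + 1) \<noteq> i mod (r + 1) \<and> l mod (r + 1) \<noteq> (i + 1) mod (r + 1)"
    proof -
      have "(0::int) mod (r + 1) = 0" "1 mod (r + 1) = 1" "2 mod (r + 1) = 2" using r by simp_all
      then show ?thesis by force
    qed
    then have "det3 (k i) (k (i + 1)) (k 0) < 0 \<or> det3 (k i) (k (i + 1)) (k 1) < 0 \<or> det3 (k i) (k (i + 1)) (k 2) < 0"
      using conv[of _ i] by blast
    then have "0 < det3 y (k 1) (k 2) * det3 (k i) (k (i + 1)) (k 0) \<or> 0 < det3 (k 0) y (k 2) * det3 (k i) (k (i + 1)) (k 1)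
      \<or> 0 < det3 (k 0) (k 1) y * det3 (k i) (k (i + 1)) (k 2)"
      using a by (auto simp: mult_neg_neg)
    then have "0 < det3 (k 0) (k 1) (k 2) * det3 (k i) (k (i + 1)) y" unfolding eq using nn by linarith
    then show ?thesis using A by (simp add: zero_less_mult_iff)
  qed
  have in0: "det3 (k i) (k (i + 1)) (\<sigma> *\<^sub>R z s0) < 0" for i
    by (rule inside) (use \<sigma>(2) in \<open>simp add: k012\<close>)
  have "r < s0"
  proof (rule ccontr)
    assume "\<not> r < s0"
    then have "k s0 = z s0" using k_eq s0 by simp
    then show False using in0[of s0] by (simp add: det3_scaleR)
  qed
  have gp: "det3 (z i) (z j) (z l) \<noteq> 0" if "distinct [i, j, l]" "{i, j, l} \<subseteq> {0..<0 + n}" for i j l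
    using proj_polygon_gp[OF z that] .
  have kz: "\<exists>a. k i = z a \<and> 0 \<le> a \<and> a \<le> r" for i
    using mod_range[of i] unfolding k_def by (intro exI[of _ "i mod (r + 1)"]) simp
  have nz: "det3 (k i) (k (i + 1)) (\<sigma> *\<^sub>R z s) \<noteq> 0" if "r < s" "s < n" for i s
    using k_gp[OF mods that] \<sigma>(1) by (auto simp: det3_scaleR)
  have unc: "\<not> crosses (\<sigma> *\<^sub>R z s) (\<sigma> *\<^sub>R z (s + 1)) (k j) (k (j + 1))" if "r < s" "s + 1 < n" for s j
    using rest_edge_uncrossed[OF that] \<sigma>(1) by auto
  have propagate: "(\<forall>i. det3 (k i) (k (i + 1)) (\<sigma> *\<^sub>R z t) < 0)"
    if st: "r < s" "s < n" "r < t" "t < n" "t = s + 1 \<or> s = t + 1" and s: "\<forall>i. det3 (k i) (k (i + 1)) (\<sigma> *\<^sub>R z s) < 0" for s t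
  proof
    fix i
    have "det3 (k i) (k (i + 1)) (\<sigma> *\<^sub>R z t) \<le> 0"
    proof (rule convex_polygon_exit[OF k_polygon conv])
      show "det3 (k i) (k (i + 1)) (\<sigma> *\<^sub>R z s) < 0" for i using s by blast
      fix i
      have "det3 (\<sigma> *\<^sub>R z s) (\<sigma> *\<^sub>R z t) (k i) \<noteq> 0" for i
      proof -
        obtain a where "k i = z a" "0 \<le> a" "a \<le> r" using kz by blast
        then show ?thesis using gp[of s t a] st \<sigma>(1) r by (auto simp: det3_scaleR)
      qed
      moreover have "\<not> crosses (\<sigma> *\<^sub>R z s) (\<sigma> *\<^sub>R z t) (k i) (k (i + 1))"
        using st(5)
      proof
        assume "t = s + 1"
        then show ?thesis using unc[of s i] st by simp
      next
        assume "s = t + 1"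
        then show ?thesis using unc[of t i] st crosses_flip1 by simp
      qed
      ultimately show "det3 (\<sigma> *\<^sub>R z s) (\<sigma> *\<^sub>R z t) (k i) \<noteq> 0 \<and> det3 (\<sigma> *\<^sub>R z s) (\<sigma> *\<^sub>R z t) (k (i + 1)) \<noteq> 0 \<and>
        \<not> crosses (\<sigma> *\<^sub>R z s) (\<sigma> *\<^sub>R z t) (k i) (k (i + 1))" by blast
    qed auto
    then show "det3 (k i) (k (i + 1)) (\<sigma> *\<^sub>R z t) < 0" using nz[OF st(3,4), of i] by simp
  qed
  have up: "s < n \<longrightarrow> (\<forall>i. det3 (k i) (k (i + 1)) (\<sigma> *\<^sub>R z s) < 0)" if "s0 \<le> s" for s
    using that
  proof (induction s rule: int_ge_induct)
    case base
    then show ?case using in0 by blast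
  next
    case (step s)
    show ?case
    proof
      assume sn: "s + 1 < n"
      have "\<forall>i. det3 (k i) (k (i + 1)) (\<sigma> *\<^sub>R z s) < 0" using step.IH sn by simp
      then show "\<forall>i. det3 (k i) (k (i + 1)) (\<sigma> *\<^sub>R z (s + 1)) < 0"
        using propagate[of s "s + 1"] step.hyps \<open>r < s0\<close> sn by simp
    qed
  qed
  have down: "r < s \<longrightarrow> (\<forall>i. det3 (k i) (k (i + 1)) (\<sigma> *\<^sub>R z s) < 0)" if "s \<le> s0" for s
    using that
  proof (induction s rule: int_le_induct)
    case base
    then show ?case using in0 by blast
  next
    case (step s)
    show ?case
    proof
      assume sr: "r < s - 1"
      have "\<forall>i. det3 (k i) (k (i + 1)) (\<sigma> *\<^sub>R z s) < 0" using step.IH sr by simp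
      then show "\<forall>i. det3 (k i) (k (i + 1)) (\<sigma> *\<^sub>R z (s - 1)) < 0"
        using propagate[of s "s - 1"] step.hyps s0 sr by simp
    qed
  qed
  have all: "det3 (k i) (k (i + 1)) (\<sigma> *\<^sub>R z s) < 0" if "r < s" "s < n" for s i
    using up[of s] down[of s] that by (cases "s0 \<le> s") auto
  have "\<sigma> = 1"
  proof (rule ccontr)
    assume "\<sigma> \<noteq> 1"
    then have s1: "\<sigma> = - 1" using \<sigma>(1) by simp
    have "det3 (k 0) (k (0 + 1)) (- z r) \<le> 0"
    proof (rule convex_polygon_exit[OF k_polygon conv])
      show "det3 (k i) (k (i + 1)) (- z (r + 1)) < 0" for i using all[of "r + 1" i] r s1 by simp
      fix i assume pos: "0 < det3 (k i) (k (i + 1)) (- z r)"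
      define j where "j = i mod (r + 1)"
      have ni: "j \<noteq> r" "(i + 1) mod (r + 1) \<noteq> r" using pos by (auto simp: k_def j_def)
      have j: "0 \<le> j" "j < r" using mod_range[of i] ni(1) unfolding j_def by linarith+
      have "(i + 1) mod (r + 1) = (j + 1) mod (r + 1)" unfolding j_def by (simp add: mod_simps)
      also have "\<dots> = j + 1" by (rule mod_pos_pos_trivial) (use j in auto)
      finally have e: "k i = z j" "k (i + 1) = z (j + 1)" "j + 1 < r" using ni(2) j unfolding k_def j_def by auto
      have "\<not> crosses (- z (r + 1)) (- z r) (z j) (z (j + 1))"
        using edges_uncrossed(5)[of j r] j e(3) r unfolding crosses_flip1[of "- z (r + 1)"] by simp
      then show "det3 (- z (r + 1)) (- z r) (k i) \<noteq> 0 \<and> det3 (- z (r + 1)) (- z r) (k (i + 1)) \<noteq> 0 \<and>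
        \<not> crosses (- z (r + 1)) (- z r) (k i) (k (i + 1))"
        unfolding e(1,2) using gp[of "r + 1" r j] gp[of "r + 1" r "j + 1"] j e(3) r by simp
    qed auto
    moreover have "det3 (k 0) (k (0 + 1)) (k r) < 0" by (rule conv) (use r in auto)
    ultimately show False using k_eq[of r] r by simp
  qed
  \<comment> \<open>The sum of all edge functionals, with the sign that is positive inside. Every
    vertex lies off some edge, so the sum is positive at each.\<close>
  define f where "f = - (\<Sum>i\<in>{0..r}. cross3 (k i) (k (i + 1)))"
  have f: "f \<bullet> x = (\<Sum>i\<in>{0..r}. - det3 (k i) (k (i + 1)) x)" for x
    unfolding f_def by (simp add: inner_sum_left det3_cross sum_negf)
  have fpos: "0 < f \<bullet> z s" if s: "0 \<le> s" "s < n" for s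
  proof (cases "s \<le> r")
    case True
    then have ks: "z s = k s" using k_eq s by simp
    let ?i = "(s + 1) mod (r + 1)"
    have "k ?i = k (s + 1)" "k (?i + 1) = k (s + 1 + 1)" unfolding k_def by (simp_all only: mod_add_left_eq mod_mod_trivial)
    moreover have "det3 (k (s + 1)) (k (s + 1 + 1)) (k s) < 0"
      by (rule conv) (use mod_neq_window[of s "s + 1" "r + 1"] mod_neq_window[of s "s + 1 + 1" "r + 1"] r in auto)
    ultimately have "0 < - det3 (k ?i) (k (?i + 1)) (z s)" unfolding ks by simp
    moreover have "?i \<in> {0..r}" using mod_range by simp
    ultimately show ?thesis unfolding f
      by (intro sum_pos2[of _ ?i]) (use convle[of _ s] in \<open>auto simp: ks\<close>)
  next
    case False
    then show ?thesis unfolding f using all[of s] s r \<open>\<sigma> = 1\<close> by (intro sum_pos) auto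
  qed
  have "0 \<le> f \<bullet> z i" for i
  proof -
    have "z (i mod n) = z i" by (rule periodic_mod, rule per)
    then show ?thesis using fpos[of "i mod n"] r pos_mod_bound[of n i] pos_mod_sign[of n i] by simp
  qed
  moreover have "f \<noteq> 0" using fpos[of 0] r by auto
  ultimately show ?thesis unfolding in_halfspace_def by blast
qed

section \<open>Existence of an ear\<close>

lemma in_halfspace_shift: "in_halfspace (\<lambda>i. z (i + a)) = in_halfspace z"
proof -
  have "(\<forall>i. P (i + a)) = (\<forall>i. P i)" for P by (metis diff_add_cancel)
  from this[of "\<lambda>i. 0 \<le> _ \<bullet> z i"] show ?thesis unfolding in_halfspace_def by simp
qed

lemma in_halfspace_minus: "in_halfspace (\<lambda>i. - z i) = in_halfspace z"
proof -
  have "in_halfspace (\<lambda>i. - z i)" if z: "in_halfspace z" for z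
  proof -
    from z obtain f where "f \<noteq> 0" "\<forall>i. 0 \<le> f \<bullet> z i" unfolding in_halfspace_def by blast
    then show ?thesis unfolding in_halfspace_def by (intro exI[of _ "- f"]) simp
  qed
  from this[of z] this[of "\<lambda>i. - z i"] show ?thesis by auto
qed

text \<open>Balance enters twice: it provides a positive turn, whose triangle yields an inner chord,
  and it contradicts \<open>in_halfspace\<close> for an inner chord of least length.\<close>

lemma ear_exists_aux:
  assumes z: "proj_polygon z n" and free: "antipode_free z n" and bal: "\<not> in_halfspace z"
  shows "\<exists>t. ear z n t"
proof (rule ccontr)
  assume "\<not> (\<exists>t. ear z n t)"
  then have no_ear: "\<not> ear z n t" for t by blast
  have n: "3 \<le> n" by (rule proj_polygonD(1)[OF z])
  obtain t where "\<not> det3 (z (t - 1)) (z t) (z (t + 1)) < 0"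
    using negative_turns_in_halfspace[OF z] bal by blast
  moreover have "det3 (z (t - 1)) (z t) (z (t + 1)) \<noteq> 0" by (rule proj_polygonD(3)[OF z]) (use n in auto)
  ultimately have pos: "0 < det3 (z (t - 1)) (z t) (z (t + 1))" by simp
  have zt: "z (t + n - 1) = z (t - 1)" using proj_polygonD(2)[OF z, of "t - 1"] by (simp add: algebra_simps)
  obtain s0 where s0: "t + 2 \<le> s0" "s0 \<le> t + n - 2"
    "in_cone (z s0) (z (t - 1)) (z t) (z (t + 1)) \<or> in_cone (- z s0) (z (t - 1)) (z t) (z (t + 1))"
    using no_ear[of t] unfolding ear_def by blast
  then obtain y0 where y0: "y0 = z s0 \<or> y0 = - z s0" "in_cone y0 (z (t + n - 1)) (z t) (z (t + 1))"
    unfolding zt by blast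
  have bnds: "t < t + n - 1" "t + n - 1 < t + n" "t < t + 1" "t + 1 < t + n" "t + n - 1 \<noteq> t + 1"
    "t < s0" "s0 < t + n" "s0 \<noteq> t + n - 1" "s0 \<noteq> t + 1" using s0 n by auto
  obtain s y where s: "t < s" "s < t + n" "s \<noteq> t + n - 1" "s \<noteq> t + 1" "y = z s \<or> y = - z s"
    "in_cone y (z (t + n - 1)) (z t) (z (t + 1))" "visible z n t s y"
    and "\<forall>i j. t < i \<and> i < t + n \<and> t < j \<and> j < t + n \<and> crosses (z t) y (z i) (z j) \<longrightarrow>
       crosses (z t) (z (t + n - 1)) (z i) (z j) \<or> crosses (z t) (z (t + 1)) (z i) (z j)"
    by (rule corner_nearest[OF z bnds(1-5) visible_prev[OF z] visible_next[OF z] bnds(6-9) y0])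
  have left: "left_of (z (t - 1)) (z t) (z (t + 1)) y"
    using left_of_in_cone[OF s(6)[unfolded zt]] pos by simp
  have "y = z s"
  proof (rule ccontr)
    assume "y \<noteq> z s"
    then have "y = - z s" using s(5) by simp
    then show False using free s left unfolding antipode_free_def by auto
  qed
  then have "inner_chord z n t (s - t)" unfolding inner_chord_def using s left by auto
  then have ex: "\<exists>m. \<exists>t. inner_chord z n t (int m)"
    by (intro exI[of _ "nat (s - t)"] exI[of _ t]) (use s in auto)
  define m where "m = (LEAST m. \<exists>t. inner_chord z n t (int m))"
  obtain a where a: "inner_chord z n a (int m)" using LeastI_ex[OF ex] unfolding m_def by blast
  have min: "\<not> inner_chord z n t r'" if "r' < int m" for t r'
  proof
    assume c: "inner_chord z n t r'"
    then have "0 \<le> r'" unfolding inner_chord_def by simp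
    then have "inner_chord z n t (int (nat r'))" "nat r' < m" using c that by auto
    then show False using not_less_Least[of "nat r'" "\<lambda>m. \<exists>t. inner_chord z n t (int m)"] unfolding m_def by blast
  qed
  interpret minimal_chord "\<lambda>i. z (i + a)" n "int m"
  proof
    show "proj_polygon (\<lambda>i. z (i + a)) n" by (rule proj_polygon_shift[OF z])
    show "inner_chord (\<lambda>i. z (i + a)) n 0 (int m)" unfolding inner_chord_shift using a by simp
    show "antipode_free (\<lambda>i. z (i + a)) n" by (rule antipode_free_shift[OF free])
    show "\<not> ear (\<lambda>i. z (i + a)) n t" for t unfolding ear_shift by (rule no_ear)
    show "\<not> inner_chord (\<lambda>i. z (i + a)) n t r'" if "r' < int m" for t r'
      unfolding inner_chord_shift by (rule min[OF that])
  qed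
  show False using in_halfspace bal unfolding in_halfspace_shift by blast
qed

lemma ear_exists:
  assumes z: "proj_polygon z n" and bal: "\<not> in_halfspace z"
  shows "\<exists>t. ear z n t"
  using antipode_free_cases[OF z]
proof
  assume "antipode_free z n"
  then show ?thesis by (rule ear_exists_aux[OF z _ bal])
next
  assume "antipode_free (\<lambda>i. - z i) n"
  then have "\<exists>t. ear (\<lambda>i. - z i) n t"
    by (rule ear_exists_aux[OF proj_polygon_minus[OF z]]) (simp add: in_halfspace_minus bal)
  then show ?thesis unfolding ear_minus .
qed

subsection \<open>Sign changes and deletion of an ear\<close>

definition turn :: "(int \<Rightarrow> real^3) \<Rightarrow> int \<Rightarrow> real" where
  "turn z i = det3 (z (i - 1)) (z i) (z (i + 1))"

definition sign_changes :: "(int \<Rightarrow> real^3) \<Rightarrow> int \<Rightarrow> nat" where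
  "sign_changes z n = (\<Sum>i\<in>{0..<n}. of_bool ((0 < turn z i) \<noteq> (0 < turn z (i + 1))))"

lemma turn_per: "(\<And>i. z (i + n) = z i) \<Longrightarrow> turn z (i + n) = turn z i"
  unfolding turn_def by (metis (no_types, opaque_lifting) add.commute add.left_commute add_diff_eq)

lemma turn_nonzero: "proj_polygon z n \<Longrightarrow> turn z i \<noteq> 0"
  unfolding turn_def by (rule proj_polygonD(3)) (use proj_polygonD(1) in force)+

lemma sign_changes_shift:
  assumes "\<And>i. z (i + n) = z i" "0 \<le> n"
  shows "sign_changes (\<lambda>i. z (i + a)) n = sign_changes z n"
proof -
  define g :: "int \<Rightarrow> nat" where "g = (\<lambda>i. of_bool ((0 < turn z i) \<noteq> (0 < turn z (i + 1))))"
  have gper: "g (i + n) = g i" for i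
    using turn_per[of z n i, OF assms(1)] turn_per[of z n "i + 1", OF assms(1)] by (simp add: g_def algebra_simps)
  have S: "sign_changes (\<lambda>i. z (i + a)) n = (\<Sum>i\<in>{0..<n}. g (i + a))" for a
    unfolding sign_changes_def g_def turn_def by (simp add: algebra_simps)
  have step: "(\<Sum>i\<in>{0..<n}. g (i + (a + 1))) = (\<Sum>i\<in>{0..<n}. g (i + a))" for a
  proof (cases "n = 0")
    case False
    have "(\<Sum>i\<in>{0..<n}. g (i + (a + 1))) = (\<Sum>i\<in>{1..<n + 1}. g (i + a))"
      by (rule sum.reindex_bij_witness[of _ "\<lambda>i. i - 1" "\<lambda>i. i + 1"]) (auto simp: algebra_simps)
    also have "{1..<n + 1} = insert n {1..<n}" using False assms(2) by auto
    also have "(\<Sum>i\<in>insert n {1..<n}. g (i + a)) = g (n + a) + (\<Sum>i\<in>{1..<n}. g (i + a))" by simp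
    also have "g (n + a) = g (0 + a)" using gper[of a] by (simp add: add.commute)
    also have "g (0 + a) + (\<Sum>i\<in>{1..<n}. g (i + a)) = (\<Sum>i\<in>insert 0 {1..<n}. g (i + a))" by simp
    also have "insert 0 {1..<n} = {0..<n}" using False assms(2) by auto
    finally show ?thesis .
  qed simp
  have "(\<Sum>i\<in>{0..<n}. g (i + a)) = (\<Sum>i\<in>{0..<n}. g (i + 0))"
  proof (induction a rule: int_induct[where k = 0])
    case (step1 i)
    then show ?case using step[of i] by simp
  next
    case (step2 i)
    then show ?case using step[of "i - 1"] by simp
  qed simp
  then show ?thesis using S[of a] S[of 0] by simp
qed

lemma sign_changes_minus: "proj_polygon z n \<Longrightarrow> sign_changes (\<lambda>i. - z i) n = sign_changes z n"
proof -
  assume z: "proj_polygon z n"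
  have "turn (\<lambda>i. - z i) i = - turn z i" for i by (simp add: turn_def)
  moreover have "0 < - turn z i \<longleftrightarrow> \<not> 0 < turn z i" for i using turn_nonzero[OF z, of i] by auto
  ultimately show ?thesis unfolding sign_changes_def by (intro sum.cong) auto
qed

text \<open>Cutting off the corner at \<open>c\<close> turns the adjacent corner \<open>b\<close> towards the side of \<open>c\<close>.\<close>
lemma turn_cut:
  assumes nz: "det3 a b c \<noteq> 0" "det3 b c d \<noteq> 0" "det3 a b d \<noteq> 0" "det3 a c d \<noteq> 0"
    and "\<not> in_cone a b c d" "\<not> crosses a b c d" "(0 < det3 a b c) = (0 < det3 b c d)"
  shows "(0 < det3 a b d) = (0 < det3 b c d)"
proof -
  have e: "det3 b a d = - det3 a b d" "det3 b c a = det3 a b c" by (simp_all add: det3_expand algebra_simps)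
  have "in_cone a b c d \<longleftrightarrow> (0 < det3 a c d) = (0 < det3 b c d) \<and> (0 < - det3 a b d) = (0 < det3 b c d) \<and>
     (0 < det3 a b c) = (0 < det3 b c d)"
    using in_cone_iff[of a c d b] nz unfolding e by simp
  then show ?thesis using assms unfolding crosses_iff[OF nz(1,3,4,2)] by argo
qed

text \<open>The new edge and the two old ones bound a triangle free of other vertices and of their
  antipodes. By Pasch's theorem, an edge of either polygon that crossed the new edge would cross one
  of the old ones.\<close>

lemma delete_vertex:
  assumes z: "proj_polygon z n" and n: "4 \<le> n" and e: "ear z n (n - 1)"
  defines "x \<equiv> \<lambda>i. z (i mod (n - 1))"
  shows "proj_polygon x (n - 1)" "sign_changes x (n - 1) \<le> sign_changes z n"
proof -
  have per: "z (i + n) = z i" for i by (rule proj_polygonD(2)[OF z])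
  have gp: "det3 (z i) (z j) (z l) \<noteq> 0" if "distinct [i, j, l]" "{i, j, l} \<subseteq> {0..<0 + n}" for i j l
    using proj_polygon_gp[OF z that] .
  have zn: "z n = z 0" using per[of 0] by simp
  have emp: "\<not> in_cone (z s) (z (n - 2)) (z (n - 1)) (z 0)" "\<not> in_cone (- z s) (z (n - 2)) (z (n - 1)) (z 0)"
    if "1 \<le> s" "s \<le> n - 3" for s
    using e[unfolded ear_def, rule_format, of "s + n"] that per[of s] zn by (auto simp: algebra_simps)
  have nc: "\<not> crosses (z a) (z (a + 1)) (z b) (z (b + 1))" "\<not> crosses (z a) (z (a + 1)) (- z b) (- z (b + 1))"
    "\<not> crosses (z b) (z (b + 1)) (z a) (z (a + 1))" "\<not> crosses (z b) (z (b + 1)) (- z a) (- z (a + 1))"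
    if "a + 2 \<le> b" "b + 2 \<le> a + n" for a b
  proof -
    show "\<not> crosses (z a) (z (a + 1)) (z b) (z (b + 1))" "\<not> crosses (z a) (z (a + 1)) (- z b) (- z (b + 1))"
      using proj_polygonD(4,5)[OF z] that by auto
    then show "\<not> crosses (z b) (z (b + 1)) (z a) (z (a + 1))" "\<not> crosses (z b) (z (b + 1)) (- z a) (- z (a + 1))"
      using crosses_commute crosses_minus2 by metis+
  qed
  have new: "\<not> crosses (z (n - 2)) (z 0) (z b) (z (b + 1))" "\<not> crosses (z (n - 2)) (z 0) (- z b) (- z (b + 1))"
    if b: "1 \<le> b" "b \<le> n - 4" for b
  proof -
    have i: "n - 2 + 1 = n - 1" "n - 1 + 1 = n" by simp_all
    have c: "\<not> crosses (z (n - 2)) (z (n - 1)) (z b) (z (b + 1))" "\<not> crosses (z (n - 2)) (z (n - 1)) (- z b) (- z (b + 1))"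
      "\<not> crosses (z (n - 1)) (z 0) (z b) (z (b + 1))" "\<not> crosses (z (n - 1)) (z 0) (- z b) (- z (b + 1))"
      using nc(3,4)[of b "n - 2", unfolded i] nc(3,4)[of b "n - 1", unfolded i zn] b by auto
    have ic: "\<not> in_cone (z b) (z (n - 2)) (z (n - 1)) (z 0)" "\<not> in_cone (- z b) (z (n - 2)) (z (n - 1)) (z 0)"
       "\<not> in_cone (z (b + 1)) (z (n - 2)) (z (n - 1)) (z 0)" "\<not> in_cone (- z (b + 1)) (z (n - 2)) (z (n - 1)) (z 0)"
      using emp[of b] emp[of "b + 1"] b by auto
    have "pasch_even (z (n - 2)) (z (n - 1)) (z 0) (z b) (z (b + 1))"
      by (rule pasch_even_generic; rule gp; use b in simp)
    then show "\<not> crosses (z (n - 2)) (z 0) (z b) (z (b + 1))"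
      using c ic unfolding pasch_even_def by (simp add: of_bool_def split: if_splits)
    have "pasch_even (z (n - 2)) (z (n - 1)) (z 0) (- z b) (- z (b + 1))"
      by (rule pasch_even_generic; (simp only: det3_minus neg_equal_0_iff_equal)?; rule gp; use b in simp)
    then show "\<not> crosses (z (n - 2)) (z 0) (- z b) (- z (b + 1))"
      using c ic unfolding pasch_even_def by (simp add: of_bool_def split: if_splits)
  qed
  have x: "x i = z i" if "0 \<le> i" "i < n - 1" for i using that by (simp add: x_def)
  have x1: "x (n - 1) = z 0" "x (- 1) = z (n - 2)"
  proof -
    show "x (n - 1) = z 0" by (simp add: x_def)
    have "(- 1) mod (n - 1) = n - 2" using n by (simp add: zmod_minus1)
    then show "x (- 1) = z (n - 2)" by (simp add: x_def)
  qed
  show X: "proj_polygon x (n - 1)"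
    unfolding x_def
  proof (rule proj_polygonI)
    show "3 \<le> n - 1" using n by simp
    show "det3 (z a) (z b) (z c) \<noteq> 0" if "{a, b, c} \<subseteq> {0..<n - 1}" "distinct [a, b, c]" for a b c
      by (rule gp) (use that in auto)
    fix a b assume ab: "{a, b} \<subseteq> {0..<n - 1}" "a \<noteq> b" "(a + 1) mod (n - 1) \<noteq> b" "(b + 1) mod (n - 1) \<noteq> a"
    have m: "(c + 1) mod (n - 1) = (if c = n - 2 then 0 else c + 1)" if "0 \<le> c" "c < n - 1" for c
      using that n by auto
    consider "a = n - 2" "b < n - 2" | "b = n - 2" "a < n - 2" | "a < n - 2" "b < n - 2" "a < b" | "a < n - 2" "b < n - 2" "b < a"
      using ab by force
    then show "\<not> crosses (z a) (z ((a + 1) mod (n - 1))) (z b) (z ((b + 1) mod (n - 1))) \<and>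
      \<not> crosses (z a) (z ((a + 1) mod (n - 1))) (- z b) (- z ((b + 1) mod (n - 1)))"
    proof cases
      case 1
      have "1 \<le> b" "b \<le> n - 4" using 1 ab m[of a] m[of b] n by (auto split: if_splits)
      then show ?thesis using 1 ab m[of a] m[of b] new[of b] by simp
    next
      case 2
      have "1 \<le> a" "a \<le> n - 4" using 2 ab m[of a] m[of b] n by (auto split: if_splits)
      then have "\<not> crosses (z a) (z (a + 1)) (z (n - 2)) (z 0)" "\<not> crosses (z a) (z (a + 1)) (- z (n - 2)) (- z 0)"
        using new[of a] crosses_commute crosses_minus2 by metis+
      then show ?thesis using 2 ab m[of a] m[of b] by simp
    next
      case 3
      have "a + 2 \<le> b" "b + 2 \<le> a + n" using 3 ab m[of a] by auto
      then show ?thesis using 3 ab m[of a] m[of b] nc[of a b] by simp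
    next
      case 4
      have "b + 2 \<le> a" "a + 2 \<le> b + n" using 4 ab m[of b] by auto
      then show ?thesis using 4 ab m[of a] m[of b] nc[of b a] by simp
    qed
  qed
  define S where "S = (\<lambda>i. 0 < turn z i)"
  define S' where "S' = (\<lambda>i. 0 < turn x i)"
  have same: "S' i = S i" if "1 \<le> i" "i \<le> n - 3" for i
    unfolding S_def S'_def turn_def using x that by simp
  have T: "turn z (n - 1) = det3 (z (n - 2)) (z (n - 1)) (z 0)" "turn z (n - 2) = det3 (z (n - 3)) (z (n - 2)) (z (n - 1))"
    "turn z 0 = det3 (z (n - 1)) (z 0) (z 1)"
    "turn x (n - 2) = det3 (z (n - 3)) (z (n - 2)) (z 0)" "turn x 0 = det3 (z (n - 2)) (z 0) (z 1)"
    unfolding turn_def using zn per[of "- 1"] x x1 n by (simp_all add: algebra_simps)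
  have c1: "S' (n - 2) = S (n - 1)" if "S (n - 2) = S (n - 1)"
    using that unfolding S_def S'_def T
  proof (intro turn_cut)
    show "\<not> in_cone (z (n - 3)) (z (n - 2)) (z (n - 1)) (z 0)" using emp(1)[of "n - 3"] n by simp
    show "\<not> crosses (z (n - 3)) (z (n - 2)) (z (n - 1)) (z 0)"
      using nc(1)[of "n - 3" "n - 1"] zn n by simp
  qed (rule gp; use n in simp)+
  have c2: "S' 0 = S (n - 1)" if "S 0 = S (n - 1)"
  proof -
    have e: "det3 (z (n - 1)) (z 0) (z 1) = - det3 (z 1) (z 0) (z (n - 1))"
      "det3 (z (n - 2)) (z (n - 1)) (z 0) = - det3 (z 0) (z (n - 1)) (z (n - 2))"
      "det3 (z (n - 2)) (z 0) (z 1) = - det3 (z 1) (z 0) (z (n - 2))"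
      by (simp_all add: det3_expand algebra_simps)
    have nz: "det3 (z 1) (z 0) (z (n - 1)) \<noteq> 0" "det3 (z 0) (z (n - 1)) (z (n - 2)) \<noteq> 0"
      "det3 (z 1) (z 0) (z (n - 2)) \<noteq> 0" "det3 (z 1) (z (n - 1)) (z (n - 2)) \<noteq> 0"
      by (rule gp; use n in simp)+
    have "(0 < det3 (z 1) (z 0) (z (n - 2))) = (0 < det3 (z 0) (z (n - 1)) (z (n - 2)))"
    proof (rule turn_cut[OF nz])
      show "\<not> in_cone (z 1) (z 0) (z (n - 1)) (z (n - 2))" using emp(1)[of 1] n by (simp add: in_cone_flip[of "z 1" "z 0"])
      show "\<not> crosses (z 1) (z 0) (z (n - 1)) (z (n - 2))"
        using nc(1)[of 0 "n - 2"] n unfolding crosses_flip1[of "z 1"] crosses_flip2[of _ _ "z (n - 1)"] by simp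
      show "(0 < det3 (z 1) (z 0) (z (n - 1))) = (0 < det3 (z 0) (z (n - 1)) (z (n - 2)))"
        using that nz unfolding S_def T e by argo
    qed
    then show ?thesis using nz unfolding S_def S'_def T e by argo
  qed
  have "S' (n - 1) = S' 0" "S n = S 0"
    unfolding S_def S'_def using turn_per[of x "n - 1" 0] turn_per[of z n 0] proj_polygonD(2)[OF X] per by simp_all
  note wrap = this
  let ?f = "\<lambda>i. of_bool (S i \<noteq> S (i + 1)) :: nat" and ?g = "\<lambda>i. of_bool (S' i \<noteq> S' (i + 1)) :: nat"
  have sum: "sum h (A \<union> B) = sum h A + sum h B" if "finite A" "finite B" "A \<inter> B = {}" for h :: "int \<Rightarrow> nat" and A B
    using that by (rule sum.union_disjoint)
  have "{0..<n} = {1..n - 4} \<union> {0, n - 3, n - 2, n - 1}" using n by auto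
  then have "sign_changes z n = sum ?f ({1..n - 4} \<union> {0, n - 3, n - 2, n - 1})"
    unfolding sign_changes_def S_def by (rule sum.cong) simp
  also have "\<dots> = sum ?f {1..n - 4} + sum ?f {0, n - 3, n - 2, n - 1}" by (rule sum) auto
  also have "sum ?f {0, n - 3, n - 2, n - 1} = ?f 0 + (?f (n - 3) + (?f (n - 2) + ?f (n - 1)))" using n by simp
  finally have A: "sign_changes z n = (\<Sum>i\<in>{1..n - 4}. ?f i) + (?f 0 + (?f (n - 3) + (?f (n - 2) + ?f (n - 1))))" .
  have "{0..<n - 1} = {1..n - 4} \<union> {0, n - 3, n - 2}" using n by auto
  then have "sign_changes x (n - 1) = sum ?g ({1..n - 4} \<union> {0, n - 3, n - 2})"
    unfolding sign_changes_def S'_def by (rule sum.cong) simp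
  also have "\<dots> = sum ?g {1..n - 4} + sum ?g {0, n - 3, n - 2}" by (rule sum) auto
  also have "sum ?g {0, n - 3, n - 2} = ?g 0 + (?g (n - 3) + ?g (n - 2))" using n by simp
  finally have B: "sign_changes x (n - 1) = (\<Sum>i\<in>{1..n - 4}. ?g i) + (?g 0 + (?g (n - 3) + ?g (n - 2)))" .
  have C: "(\<Sum>i\<in>{1..n - 4}. ?g i) = (\<Sum>i\<in>{1..n - 4}. ?f i)"
    by (rule sum.cong) (use same in auto)
  have "n - 3 + 1 = n - 2" "n - 2 + 1 = n - 1" "n - 1 + 1 = n" "(0::int) + 1 = 1" by simp_all
  note ix = this
  have D: "?g 0 + (?g (n - 3) + ?g (n - 2)) \<le> ?f 0 + (?f (n - 3) + (?f (n - 2) + ?f (n - 1)))"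
  proof -
    \<comment> \<open>Here \<open>v, t, s0\<close> are the old signs at the three affected vertices,
      \<open>q, r\<close> the new signs at the two that remain, and \<open>u, s1\<close> the signs
      next to them. A neighbour that agrees with the deleted corner keeps its sign by
      \<open>turn_cut\<close>.\<close>
    have count: "of_bool (r \<noteq> s1) + (of_bool (u \<noteq> q) + of_bool (q \<noteq> r))
      \<le> (of_bool (s0 \<noteq> s1) + (of_bool (u \<noteq> v) + (of_bool (v \<noteq> t) + of_bool (t \<noteq> s0))) :: nat)"
      if "v = t \<Longrightarrow> q = t" "s0 = t \<Longrightarrow> r = t" for r s1 u q s0 v t :: bool
      using that by (cases r; cases s1; cases u; cases q; cases s0; cases v; cases t) simp_all
    have "S' 1 = S 1" "S' (n - 3) = S (n - 3)" using same[of 1] same[of "n - 3"] n by simp_all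
    then show ?thesis unfolding ix wrap using count[where r = "S' 0" and ?s1.0 = "S 1" and u = "S (n - 3)" and q = "S' (n - 2)"
        and ?s0.0 = "S 0" and v = "S (n - 2)" and t = "S (n - 1)", OF c1 c2] by (simp only:)
  qed
  show "sign_changes x (n - 1) \<le> sign_changes z n" unfolding A B C using D by simp
qed

subsection \<open>Polygons with an essential vertex\<close>

text \<open>The arc from \<open>x\<close> to \<open>y\<close> meets the great circle of
  \<open>w\<close> and \<open>a\<close>, which plus and minus \<open>w\<close> and \<open>a\<close>
  divide into four arcs. Two are excluded by assumption, the one between \<open>- w\<close> and
  \<open>- a\<close> by \<open>f\<close>. Through the last one the arc can only pass
  counterclockwise about \<open>w\<close>.\<close>

lemma line_crossing:
  assumes "0 < f \<bullet> w" "0 \<le> f \<bullet> a" "0 \<le> f \<bullet> x" "0 \<le> f \<bullet> y" "det3 w a x < 0" "0 < det3 w a y"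
    "\<not> crosses (- w) a x y" "\<not> crosses w (- a) x y" "det3 w x y \<noteq> 0" "det3 a x y \<noteq> 0"
  shows "0 < det3 w x y \<and> crosses w a x y"
proof -
  have "det3 w a y *\<^sub>R x - det3 w a x *\<^sub>R y = det3 w x y *\<^sub>R a - det3 a x y *\<^sub>R w"
    using det3_cramer[of a x y w] by (simp add: algebra_simps)
  from arg_cong[OF this, of "\<lambda>v. f \<bullet> v"]
  have "det3 w a y * (f \<bullet> x) - det3 w a x * (f \<bullet> y) = det3 w x y * (f \<bullet> a) - det3 a x y * (f \<bullet> w)"
    by (simp add: inner_diff_right)
  moreover have "0 \<le> det3 w a y * (f \<bullet> x)" "0 \<le> - det3 w a x * (f \<bullet> y)" using assms by (simp_all only: mult_nonneg_nonneg less_imp_le neg_0_le_iff_le)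
  ultimately have pos: "0 \<le> det3 w x y * (f \<bullet> a) - det3 a x y * (f \<bullet> w)" by linarith
  have "\<not> (det3 w x y < 0 \<and> 0 < det3 a x y)"
  proof
    assume "det3 w x y < 0 \<and> 0 < det3 a x y"
    then have "det3 w x y * (f \<bullet> a) \<le> 0" "0 < det3 a x y * (f \<bullet> w)" using assms by (simp_all add: mult_nonpos_nonneg)
    then show False using pos by linarith
  qed
  then show ?thesis using assms(5-10) unfolding crosses_def by (auto simp: mult_less_0_iff zero_less_mult_iff)
qed

text \<open>In a representation of \<open>c\<close> as a positive combination of \<open>w\<close>,
  \<open>x\<close> and \<open>y\<close>, moving the term of \<open>w\<close> to the other side
  produces the crossing point.\<close>

lemma crosses_of_in_cone: "in_cone c w x y \<Longrightarrow> crosses (- w) c x y"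
proof -
  have e: "det3 w x c = - det3 w c x" by (simp add: det3_expand algebra_simps)
  show "in_cone c w x y \<Longrightarrow> crosses (- w) c x y"
    unfolding in_cone_def crosses_def e by (auto simp: mult_less_0_iff zero_less_mult_iff)
qed

text \<open>The polygon is seen from the antipode \<open>w\<close> of the only vertex outside the half-space of \<open>f\<close>;
  \<open>d i j\<close> is positive iff \<open>z j\<close> is counterclockwise from \<open>z i\<close> around \<open>w\<close>.\<close>
locale essential_vertex =
  fixes z :: "int \<Rightarrow> real^3" and n :: int and f :: "real^3"
  assumes z: "proj_polygon z n" and n: "4 \<le> n" and bal: "\<not> in_halfspace z"
    and pos: "\<And>i. 1 \<le> i \<Longrightarrow> i \<le> n - 1 \<Longrightarrow> 0 \<le> f \<bullet> z i" and neg: "f \<bullet> z 0 < 0"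
    and orient: "0 < det3 (- z 0) (z 1) (z (n - 1))"
begin

definition w :: "real^3" where "w = - z 0"

definition d :: "int \<Rightarrow> int \<Rightarrow> real" where "d i j = det3 w (z i) (z j)"

lemma zn: "z n = z 0"
  using proj_polygonD(2)[OF z, of 0] by simp

lemma gp: "distinct [i, j, k] \<Longrightarrow> {i, j, k} \<subseteq> {0..<n} \<Longrightarrow> det3 (z i) (z j) (z k) \<noteq> 0"
  using proj_polygon_gp[OF z, of i j k 0] by simp

lemma nocross:
  assumes "i + 2 \<le> j" "j + 2 \<le> i + n"
  shows "\<not> crosses (z i) (z (i + 1)) (z j) (z (j + 1))" "\<not> crosses (z j) (z (j + 1)) (z i) (z (i + 1))"
    "\<not> crosses (z i) (z (i + 1)) (- z j) (- z (j + 1))" "\<not> crosses (z j) (z (j + 1)) (- z i) (- z (i + 1))"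
proof -
  show "\<not> crosses (z i) (z (i + 1)) (z j) (z (j + 1))" "\<not> crosses (z i) (z (i + 1)) (- z j) (- z (j + 1))"
    using proj_polygonD(4,5)[OF z assms] by auto
  then show "\<not> crosses (z j) (z (j + 1)) (z i) (z (i + 1))" "\<not> crosses (z j) (z (j + 1)) (- z i) (- z (i + 1))"
    using crosses_commute crosses_minus2 by metis+
qed

lemma fw: "0 < f \<bullet> w"
  using neg by (simp add: w_def)

lemma d_nonzero: "i \<noteq> j \<Longrightarrow> {i, j} \<subseteq> {1..n - 1} \<Longrightarrow> d i j \<noteq> 0"
  unfolding d_def w_def using gp[of 0 i j] by simp

lemma d_anti: "d j i = - d i j"
  unfolding d_def using det3_swap23 .

lemma d_same [simp]: "d i i = 0"
  by (simp add: d_def)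

lemma d_pos_neq: "0 < d i j \<Longrightarrow> i \<noteq> j"
  by auto

lemma d_pluecker: "d i j * d k l = d i k * d j l - d i l * d j k"
  unfolding d_def using det3_pluecker[of w "z i" "z j" "z k" "z l"] by simp

lemma orient': "0 < d 1 (n - 1)"
  using orient by (simp add: d_def w_def)

text \<open>The edge from \<open>- w\<close> to \<open>z 1\<close> meets neither the edge at
  \<open>j\<close> nor its antipode. So an edge that changes sides of the line through
  \<open>w\<close> and \<open>z 1\<close> passes between these two points, as in
  \<open>line_crossing\<close>. \<open>b_line\<close> uses the edge from \<open>z (n - 1)\<close> to
  \<open>- w\<close>.\<close>

lemma a_line:
  assumes "2 \<le> j" "j \<le> n - 2" "x = j \<and> y = j + 1 \<or> x = j + 1 \<and> y = j" "d 1 x < 0" "0 < d 1 y"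
  shows "0 < d x y" "crosses w (z 1) (z x) (z y)"
proof -
  have xy: "{1, x, y} \<subseteq> {1..n - 1}" "distinct [1, x, y]" using assms by auto
  have i: "(0::int) + 1 = 1" by simp
  have c: "\<not> crosses (- w) (z 1) (z j) (z (j + 1))" "\<not> crosses w (- z 1) (z j) (z (j + 1))"
    using nocross(1,3)[of 0 j, unfolded i] assms(1,2) by (simp_all add: w_def crosses_minus2)
  have c': "\<not> crosses (- w) (z 1) (z x) (z y)" "\<not> crosses w (- z 1) (z x) (z y)"
    using c assms(3) crosses_flip2 by metis+
  have "0 < det3 w (z x) (z y) \<and> crosses w (z 1) (z x) (z y)"
    by (rule line_crossing[OF fw]; (rule pos c' c'(2) gp)?)
      (use xy assms(4,5) d_nonzero[of x y] in \<open>auto simp: d_def\<close>)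
  then show "0 < d x y" "crosses w (z 1) (z x) (z y)" by (simp_all add: d_def)
qed

lemma b_line:
  assumes "1 \<le> j" "j \<le> n - 3" "x = j \<and> y = j + 1 \<or> x = j + 1 \<and> y = j" "d (n - 1) x < 0" "0 < d (n - 1) y"
  shows "0 < d x y" "crosses w (z (n - 1)) (z x) (z y)"
proof -
  have xy: "{n - 1, x, y} \<subseteq> {1..n - 1}" "distinct [n - 1, x, y]" using assms by auto
  have i: "n - 1 + 1 = n" by simp
  have c: "\<not> crosses (- w) (z (n - 1)) (z j) (z (j + 1))" "\<not> crosses w (- z (n - 1)) (z j) (z (j + 1))"
    using nocross(2,4)[of j "n - 1", unfolded i zn] assms(1,2)
    by (simp_all add: w_def crosses_minus2 crosses_flip1[of "z (n - 1)" "z 0"])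
  have c': "\<not> crosses (- w) (z (n - 1)) (z x) (z y)" "\<not> crosses w (- z (n - 1)) (z x) (z y)"
    using c assms(3) crosses_flip2 by metis+
  have "0 < det3 w (z x) (z y) \<and> crosses w (z (n - 1)) (z x) (z y)"
    by (rule line_crossing[OF fw]; (rule pos c' c'(2) gp)?)
      (use xy assms(4,5) d_nonzero[of x y] in \<open>auto simp: d_def\<close>)
  then show "0 < d x y" "crosses w (z (n - 1)) (z x) (z y)" by (simp_all add: d_def)
qed

lemma d_sign_aux: "d 1 (n - 1) * d x y = d 1 x * d (n - 1) y - d 1 y * d (n - 1) x"
  by (rule d_pluecker)

lemma d_pos_iff: "0 < d x y \<longleftrightarrow> 0 < d 1 x * d (n - 1) y - d 1 y * d (n - 1) x"
  unfolding d_sign_aux[symmetric] using orient' by (simp add: zero_less_mult_iff)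

text \<open>The region excluded is the angle around \<open>w\<close> opposite to the one between
  \<open>z 1\<close> and \<open>z (n - 1)\<close>. The path starts outside, and the directions
  prescribed by \<open>a_line\<close> and \<open>b_line\<close> are incompatible with an edge
  entering it.\<close>

lemma no_opposite:
  assumes "1 \<le> i" "i \<le> n - 1" "d 1 i < 0" shows "d (n - 1) i < 0"
proof -
  have "i \<le> n - 1 \<longrightarrow> \<not> (d 1 i < 0 \<and> 0 < d (n - 1) i)" using assms(1)
  proof (induction i rule: int_ge_induct)
    case (step i)
    show ?case
    proof (intro impI notI)
      assume i: "i + 1 \<le> n - 1" and h: "d 1 (i + 1) < 0 \<and> 0 < d (n - 1) (i + 1)"
      have i3: "i \<le> n - 3" using i h by (cases "i + 1 = n - 1") auto
      have B: "0 < d i (i + 1)" if "d (n - 1) i < 0" using b_line(1)[of i i "i + 1"] that h step.hyps i3 by simp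
      show False
      proof (cases "i = 1")
        case True
        then show False using B h d_anti[of 1 "n - 1"] orient' by auto
      next
        case False
        then have i2: "2 \<le> i" using step.hyps by simp
        have nz: "d 1 i \<noteq> 0" "d (n - 1) i \<noteq> 0" by (rule d_nonzero; use i2 i3 in auto)+
        have A: "0 < d (i + 1) i" if "0 < d 1 i" using a_line(1)[of i "i + 1" i] that h i2 i3 by simp
        have "\<not> (d 1 i < 0 \<and> 0 < d (n - 1) i)" using step.IH i by simp
        then consider "d 1 i < 0" "d (n - 1) i < 0" | "0 < d 1 i" "0 < d (n - 1) i" | "0 < d 1 i" "d (n - 1) i < 0"
          using nz by linarith
        then show False
        proof cases
          case 1
          then have "d 1 i * d (n - 1) (i + 1) < 0" "0 < d 1 (i + 1) * d (n - 1) i"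
            using h by (simp_all add: mult_neg_pos mult_neg_neg)
          then show False using B 1 d_pos_iff[of i "i + 1"] by linarith
        next
          case 2
          then have "0 < d 1 i * d (n - 1) (i + 1)" "d 1 (i + 1) * d (n - 1) i < 0"
            using h by (simp_all add: mult_neg_pos)
          then show False using A 2 d_pos_iff[of "i + 1" i] by linarith
        next
          case 3
          then show False using A B d_anti[of i "i + 1"] by linarith
        qed
      qed
    qed
  qed simp
  moreover have "i \<noteq> n - 1" using assms(3) orient' by auto
  then have "d (n - 1) i \<noteq> 0" using assms by (intro d_nonzero) auto
  ultimately show ?thesis using assms by force
qed

text \<open>Extreme means clockwise-most around \<open>w\<close> among the vertices below the line
  of \<open>z 1\<close>.\<close>

definition low :: "int \<Rightarrow> bool" where
  "low l \<longleftrightarrow> 2 \<le> l \<and> l \<le> n - 2 \<and> d 1 l < 0 \<and> (\<forall>i. 1 \<le> i \<and> i \<le> n - 1 \<and> i \<noteq> l \<and> d 1 i < 0 \<longrightarrow> 0 < d l i)"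

lemma not_halfspace: "\<exists>i. 1 \<le> i \<and> i \<le> n - 1 \<and> g \<bullet> z i < 0" if "g \<noteq> 0" "g \<bullet> w = 0" for g
proof (rule ccontr)
  assume h: "\<not> ?thesis"
  have "0 \<le> g \<bullet> z i" for i
  proof -
    have "0 \<le> i mod n" "i mod n < n" using n by simp_all
    moreover have "g \<bullet> z 0 = 0" using that(2) by (simp add: w_def)
    moreover have "\<not> g \<bullet> z k < 0" if "1 \<le> k" "k \<le> n - 1" for k using h that by blast
    ultimately have "0 \<le> g \<bullet> z (i mod n)" by (smt (verit))
    then show ?thesis using periodic_mod[of z n i, OF proj_polygonD(2)[OF z]] by simp
  qed
  then show False using bal that(1) unfolding in_halfspace_def by blast
qed

lemma exists_d_neg: "\<exists>i. 1 \<le> i \<and> i \<le> n - 1 \<and> d k i < 0" if "k \<in> {1..n - 1}"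
proof -
  obtain j where j: "j \<in> {1..n - 1}" "j \<noteq> k" using that[of 1] that[of 2] n by (cases "k = 1") auto
  have c: "d k i = cross3 w (z k) \<bullet> z i" for i unfolding d_def by (rule det3_cross)
  have "cross3 w (z k) \<noteq> 0" using d_nonzero[of k j] that j unfolding c by auto
  moreover have "cross3 w (z k) \<bullet> w = 0" using det3_cross[of w "z k" w] by simp
  ultimately show ?thesis unfolding c using not_halfspace by blast
qed

lemma exists_low: "\<exists>l. low l"
proof -
  let ?L = "{i\<in>{1..n - 1}. d 1 i < 0}"
  have "?L \<noteq> {}" using exists_d_neg[of 1] n by auto
  moreover have "finite ?L" by (rule finite_subset[of _ "{1..n - 1}"]) auto
  \<comment> \<open>By the three-term relation \<open>d_sign_aux\<close>, this quotient orders the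
    directions below the line.\<close>
  ultimately obtain l where l: "l \<in> ?L" and min: "\<And>i. i \<in> ?L \<Longrightarrow> d (n - 1) l / d 1 l \<le> d (n - 1) i / d 1 i"
    using finite_arg_min[of ?L "\<lambda>i. d (n - 1) i / d 1 i"] by blast
  have "l \<noteq> 1" "l \<noteq> n - 1" using l orient' by auto
  moreover have "0 < d l i" if i: "1 \<le> i \<and> i \<le> n - 1 \<and> i \<noteq> l \<and> d 1 i < 0" for i
  proof -
    have "d (n - 1) l / d 1 l \<le> d (n - 1) i / d 1 i" using min i by simp
    then have "d (n - 1) l * d 1 i \<le> d (n - 1) i * d 1 l" using i l by (simp add: divide_simps mult_less_0_iff)
    then have "0 \<le> d 1 (n - 1) * d l i" unfolding d_sign_aux by (simp add: algebra_simps)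
    then have "0 \<le> d l i" using orient' by (simp add: zero_le_mult_iff)
    then show ?thesis using d_nonzero[of l i] i l by auto
  qed
  ultimately show ?thesis unfolding low_def using l by (intro exI[of _ l]) auto
qed

lemma low_d_pos:
  assumes l: "low l" and i: "1 \<le> i" "i \<le> n - 1" "i \<noteq> l" "\<not> 0 < d (n - 1) i" shows "0 < d l i"
proof (cases "d 1 i < 0")
  case True
  then show ?thesis using l i unfolding low_def by auto
next
  case False
  have Al: "d 1 l < 0" "2 \<le> l" "l \<le> n - 2" using l unfolding low_def by auto
  have "d (n - 1) l < 0" using no_opposite[of l] Al by simp
  then have "0 \<le> d 1 l * d (n - 1) i" "d 1 i * d (n - 1) l \<le> 0"
    using Al i False by (simp_all add: mult_nonpos_nonpos mult_nonneg_nonpos)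
  then have "0 \<le> d 1 (n - 1) * d l i" unfolding d_sign_aux by linarith
  then have "0 \<le> d l i" using orient' by (simp add: zero_le_mult_iff)
  then show ?thesis using d_nonzero[of l i] i Al by auto
qed

text \<open>Balance puts some vertex clockwise from \<open>z l\<close>, and by
  \<open>low_d_pos\<close> only vertices above the line of \<open>z (n - 1)\<close> qualify.\<close>

lemma low_exists_up:
  assumes l: "low l" shows "\<exists>i. 1 \<le> i \<and> i \<le> n - 1 \<and> 0 < d (n - 1) i \<and> d l i < 0"
proof -
  have "l \<in> {1..n - 1}" using l unfolding low_def by auto
  then obtain i where i: "1 \<le> i" "i \<le> n - 1" "d l i < 0" using exists_d_neg[of l] by blast
  then show ?thesis using low_d_pos[OF l i(1,2)] by force
qed

lemma low_neighbours:
  assumes l: "low l" shows "0 < d l (l + 1)" "0 < d l (l - 1)"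
proof -
  have Al: "d 1 l < 0" "2 \<le> l" "l \<le> n - 2" using l unfolding low_def by auto
  have Bl: "d (n - 1) l < 0" using no_opposite[of l] Al by simp
  show "0 < d l (l + 1)"
  proof (cases "0 < d (n - 1) (l + 1)")
    case True
    then have "l + 1 \<noteq> n - 1" using d_pos_neq by metis
    then show ?thesis using b_line(1)[of l l "l + 1"] True Al Bl by simp
  qed (use low_d_pos[OF l, of "l + 1"] Al in auto)
  show "0 < d l (l - 1)"
  proof (cases "0 < d (n - 1) (l - 1)")
    case True
    then show ?thesis using b_line(1)[of "l - 1" l "l - 1"] True Al Bl by simp
  qed (use low_d_pos[OF l, of "l - 1"] Al in auto)
qed

text \<open>Four cases by the line of \<open>w\<close> and \<open>z (n - 1)\<close>. Ends that are
  not above it are counterclockwise from \<open>z l\<close>. An edge crossing it is oriented by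
  \<open>b_line\<close>. An edge above it is also above the line of \<open>z 1\<close>, so the angle
  it spans contains no direction below that line.\<close>

lemma low_sector:
  assumes l: "low l" and j: "1 \<le> j" "j \<le> n - 2" "j \<noteq> l - 1" "j \<noteq> l"
  shows "\<not> ((0 < d j l) = (0 < d j (j + 1)) \<and> (0 < d l (j + 1)) = (0 < d j (j + 1)))"
proof
  assume h: "(0 < d j l) = (0 < d j (j + 1)) \<and> (0 < d l (j + 1)) = (0 < d j (j + 1))"
  have Al: "d 1 l < 0" "2 \<le> l" "l \<le> n - 2" using l unfolding low_def by auto
  have nz: "d j l \<noteq> 0" "d j (j + 1) \<noteq> 0" "d l (j + 1) \<noteq> 0" "d (n - 1) j \<noteq> 0" by (rule d_nonzero; use j Al in auto)+
  have an: "d l j = - d j l" "d (j + 1) j = - d j (j + 1)" "d j (n - 1) = - d (n - 1) j"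
    "d 1 j = - d j 1" "d 1 (j + 1) = - d (j + 1) 1" by (rule d_anti)+
  show False
  proof (cases "0 < d (n - 1) j"; cases "0 < d (n - 1) (j + 1)")
    assume U: "0 < d (n - 1) j" "0 < d (n - 1) (j + 1)"
    have ne: "j \<noteq> 1" "j + 1 \<noteq> n - 1" using U d_pos_neq d_anti[of 1 "n - 1"] orient' by (metis less_asym neg_0_less_iff_less)+
    have "d 1 j \<noteq> 0" "d 1 (j + 1) \<noteq> 0" by (rule d_nonzero; use j ne in auto)+
    then have A: "0 < d 1 j" "0 < d 1 (j + 1)" using no_opposite[of j] no_opposite[of "j + 1"] U j by force+
    have "d 1 l * d j (j + 1) = d 1 j * d l (j + 1) - d 1 (j + 1) * d l j" by (rule d_pluecker)
    then have e: "d 1 l * d j (j + 1) = d 1 j * d l (j + 1) + d 1 (j + 1) * d j l" unfolding an by simp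
    show False
    proof (cases "0 < d j (j + 1)")
      case True
      then have "d 1 l * d j (j + 1) < 0" "0 < d 1 j * d l (j + 1)" "0 < d 1 (j + 1) * d j l"
        using h A Al by (simp_all add: mult_neg_pos)
      then show False using e by linarith
    next
      case False
      then have "d j (j + 1) < 0" "d l (j + 1) < 0" "d j l < 0" using h nz by linarith+
      then have "0 < d 1 l * d j (j + 1)" "d 1 j * d l (j + 1) < 0" "d 1 (j + 1) * d j l < 0"
        using A Al by (simp_all add: mult_neg_neg mult_pos_neg)
      then show False using e by linarith
    qed
  next
    assume U: "0 < d (n - 1) j" "\<not> 0 < d (n - 1) (j + 1)"
    have p: "0 < d l (j + 1)" using low_d_pos[OF l, of "j + 1"] U j by simp
    then have "0 < d j (j + 1)" using h by simp
    then show False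
    proof (cases "j + 1 = n - 1")
      case True
      then show False using \<open>0 < d j (j + 1)\<close> U an(3) by (metis less_asym neg_0_less_iff_less)
    next
      case False
      then have "d (n - 1) (j + 1) \<noteq> 0" using j by (intro d_nonzero) auto
      then have "0 < d (j + 1) j" using b_line(1)[of j "j + 1" j] U j False by simp
      then show False using \<open>0 < d j (j + 1)\<close> an by simp
    qed
  next
    assume U: "\<not> 0 < d (n - 1) j" "0 < d (n - 1) (j + 1)"
    have "0 < d l j" using low_d_pos[OF l, of j] U j by simp
    moreover have "j + 1 \<noteq> n - 1" using U d_pos_neq by metis
    then have "0 < d j (j + 1)" using b_line(1)[of j j "j + 1"] U j nz by simp
    ultimately show False using h an by simp
  next
    assume U: "\<not> 0 < d (n - 1) j" "\<not> 0 < d (n - 1) (j + 1)"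
    have "0 < d l j" "0 < d l (j + 1)" using low_d_pos[OF l, of j] low_d_pos[OF l, of "j + 1"] U j by simp_all
    then show False using h an by simp
  qed
qed

end

lemma sign_switch:
  fixes P :: "int \<Rightarrow> bool"
  assumes "p \<le> q" "P p \<noteq> P q" shows "\<exists>k. p \<le> k \<and> k < q \<and> P k \<noteq> P (k + 1)"
proof (rule ccontr)
  assume h: "\<not> ?thesis"
  have "q' \<le> q \<longrightarrow> P p = P q'" if "p \<le> q'" for q'
    using that by (induction q' rule: int_ge_induct) (use h in auto)
  then show False using assms by blast
qed

lemma sector_of_crosses:
  assumes "crosses w c x y \<or> crosses (- w) c x y \<or> in_cone c w x y"
  shows "(0 < det3 w x c) = (0 < det3 w x y) \<and> (0 < det3 w c y) = (0 < det3 w x y)"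
proof -
  have e: "det3 w x c = - det3 w c x" by (rule det3_swap23)
  show ?thesis using assms unfolding in_cone_def crosses_def e by (auto simp: mult_less_0_iff zero_less_mult_iff)
qed

section \<open>Crossing counts and turns along the path between the extreme vertices\<close>

context essential_vertex
begin

lemma crosses_a:
  assumes j: "2 \<le> j" "j \<le> n - 2" "(0 < d 1 j) \<noteq> (0 < d 1 (j + 1))"
  shows "crosses w (z 1) (z j) (z (j + 1))"
proof -
  have "d 1 j \<noteq> 0" "d 1 (j + 1) \<noteq> 0" by (rule d_nonzero; use j in auto)+
  then consider "d 1 j < 0" "0 < d 1 (j + 1)" | "0 < d 1 j" "d 1 (j + 1) < 0" using j(3) by linarith
  then show ?thesis
    using a_line(2)[of j j "j + 1"] a_line(2)[of j "j + 1" j] j crosses_flip2[of w "z 1"] by cases auto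
qed

lemma crosses_b_iff: "crosses w (z (n - 1)) (z j) (z (j + 1)) \<longleftrightarrow> (0 < d (n - 1) j) \<noteq> (0 < d (n - 1) (j + 1))"
  if "1 \<le> j" "j \<le> n - 3"
proof
  assume "crosses w (z (n - 1)) (z j) (z (j + 1))"
  then show "(0 < d (n - 1) j) \<noteq> (0 < d (n - 1) (j + 1))"
    unfolding crosses_def d_def by (auto simp: mult_less_0_iff)
next
  assume h: "(0 < d (n - 1) j) \<noteq> (0 < d (n - 1) (j + 1))"
  have "d (n - 1) j \<noteq> 0" "d (n - 1) (j + 1) \<noteq> 0" by (rule d_nonzero; use that in auto)+
  then consider "d (n - 1) j < 0" "0 < d (n - 1) (j + 1)" | "0 < d (n - 1) j" "d (n - 1) (j + 1) < 0" using h by linarith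
  then show "crosses w (z (n - 1)) (z j) (z (j + 1))"
    using b_line(2)[of j j "j + 1"] b_line(2)[of j "j + 1" j] that crosses_flip2[of w "z (n - 1)"] by cases auto
qed

text \<open>On these edges, crossing the line of \<open>w\<close> and \<open>z (n - 1)\<close> means
  crossing the arc between them, so the parity records the side. The path starts at
  \<open>z 1\<close>, below the line.\<close>

lemma cnt_b_parity: "int m \<le> n - 3 \<Longrightarrow> even (cnt z 1 m w (z (n - 1)) + of_bool (0 < d (n - 1) (1 + int m)))"
proof (induction m)
  case 0
  then show ?case using d_anti[of 1 "n - 1"] orient' by simp
next
  case (Suc m)
  have e: "1 + int (Suc m) = 1 + int m + 1" by simp
  have "cnt z 1 (Suc m) w (z (n - 1)) =
    cnt z 1 m w (z (n - 1)) + of_bool (crosses w (z (n - 1)) (z (1 + int m)) (z (1 + int m + 1)))"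
    by (simp add: cnt_def)
  then have *: "cnt z 1 (Suc m) w (z (n - 1)) =
    cnt z 1 m w (z (n - 1)) + of_bool ((0 < d (n - 1) (1 + int m)) \<noteq> (0 < d (n - 1) (1 + int m + 1)))"
    using crosses_b_iff[of "1 + int m"] Suc.prems by simp
  have "even (cnt z 1 m w (z (n - 1)) + of_bool (0 < d (n - 1) (1 + int m)))" using Suc by simp
  then show ?case unfolding e * by (cases "0 < d (n - 1) (1 + int m)"; cases "0 < d (n - 1) (1 + int m + 1)") simp_all
qed

text \<open>Pasch's theorem for the triangle \<open>w\<close>, \<open>z j\<close>,
  \<open>z (j + 1)\<close>: the path starts outside, since otherwise the edge from
  \<open>- w\<close> to \<open>z 1\<close> would cross edge \<open>j\<close>, and it does not cross
  the side opposite to \<open>w\<close>.\<close>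

lemma path_parity:
  assumes "1 \<le> p" "p < j" "j \<le> n - 2"
  shows "even (cnt z 1 (nat (p - 1)) w (z j) + cnt z 1 (nat (p - 1)) w (z (j + 1)) + of_bool (in_cone (z p) w (z j) (z (j + 1))))"
proof -
  let ?m = "nat (p - 1)"
  have i: "(0::int) + 1 = 1" by simp
  have "\<not> crosses (- w) (z 1) (z j) (z (j + 1))" using nocross(1)[of 0 j, unfolded i] assms by (simp add: w_def)
  then have 1: "\<not> in_cone (z 1) w (z j) (z (j + 1))" using crosses_of_in_cone by blast
  have 2: "cnt z 1 ?m (z j) (z (j + 1)) = 0"
  proof (rule cnt_eq_0)
    fix k assume "k < ?m"
    then show "\<not> crosses (z j) (z (j + 1)) (z (1 + int k)) (z (1 + int k + 1))"
      using nocross(2)[of "1 + int k" j] assms by linarith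
  qed
  have "pasch_even w (z j) (z (j + 1)) (z (1 + int k)) (z (1 + int k + 1))" if "k < ?m" for k
    unfolding w_def
    by (rule pasch_even_generic; (simp only: det3_minus neg_equal_0_iff_equal)?; rule gp; use that assms in auto)
  from pasch_path[of ?m w "z j" "z (j + 1)" z 1, OF this] show ?thesis using 1 2 assms by simp
qed

text \<open>Carries the count from \<open>z j\<close> along the path to \<open>z (n - 1)\<close>,
  where \<open>cnt_b_parity\<close> evaluates it.\<close>

lemma path_const:
  assumes p: "1 \<le> p" "p < j" and emp: "\<And>k. j \<le> k \<Longrightarrow> k \<le> n - 2 \<Longrightarrow> \<not> in_cone (z p) w (z k) (z (k + 1))"
    and j: "j \<le> n - 1"
  shows "even (cnt z 1 (nat (p - 1)) w (z j) + cnt z 1 (nat (p - 1)) w (z (n - 1)))"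
proof -
  have "k \<le> n - 1 \<longrightarrow> even (cnt z 1 (nat (p - 1)) w (z j) + cnt z 1 (nat (p - 1)) w (z k))" if "j \<le> k" for k
    using that
  proof (induction k rule: int_ge_induct)
    case (step k)
    show ?case
    proof
      assume k: "k + 1 \<le> n - 1"
      have "even (cnt z 1 (nat (p - 1)) w (z k) + cnt z 1 (nat (p - 1)) w (z (k + 1)))"
        using path_parity[of p k] emp[of k] p k step.hyps by simp
      moreover have "even (cnt z 1 (nat (p - 1)) w (z j) + cnt z 1 (nat (p - 1)) w (z k))" using step.IH k by simp
      ultimately show "even (cnt z 1 (nat (p - 1)) w (z j) + cnt z 1 (nat (p - 1)) w (z (k + 1)))" by presburger
    qed
  qed simp
  then show ?thesis using j by blast
qed

lemma low_free:
  assumes l: "low l" and j: "1 \<le> j" "j \<le> n - 2" "j \<noteq> l - 1" "j \<noteq> l"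
  shows "\<not> crosses w (z l) (z j) (z (j + 1))" "\<not> crosses (- w) (z l) (z j) (z (j + 1))"
    "\<not> in_cone (z l) w (z j) (z (j + 1))"
  using low_sector[OF l j] sector_of_crosses[of w "z l" "z j" "z (j + 1)"] unfolding d_def by blast+

lemma low_cnt: "low l \<Longrightarrow> int m + 1 < l \<Longrightarrow> cnt z 1 m w (z l) = 0"
  by (rule cnt_eq_0, rule low_free(1)) (auto simp: low_def)

text \<open>The arc from \<open>w\<close> to \<open>z (l + 1)\<close> meets the path from
  \<open>z 1\<close> to \<open>z l\<close> an even number of times, while the arc to
  \<open>z l\<close> meets no edge before the last. Hence \<open>z (l - 1)\<close> is outside the
  angle at \<open>z l\<close> between \<open>w\<close> and \<open>z (l + 1)\<close>. Both neighbours
  are counterclockwise from \<open>z l\<close> around \<open>w\<close>, which leaves only a negative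
  turn.\<close>

lemma turn_low:
  assumes l: "low l" shows "turn z l < 0"
proof -
  have Al: "d 1 l < 0" "2 \<le> l" "l \<le> n - 2" using l unfolding low_def by auto
  have Bl: "d (n - 1) l < 0" using no_opposite[of l] Al by simp
  let ?N = "\<lambda>y. cnt z 1 (nat (l - 1)) w y" and ?N' = "\<lambda>y. cnt z 1 (nat (l - 2)) w y"
  have "even (?N (z (l + 1)) + ?N (z (n - 1)))"
    by (rule path_const) (use Al low_free(3)[OF l] in auto)
  moreover have "even (?N (z (n - 1)))" using cnt_b_parity[of "nat (l - 1)"] Al Bl by simp
  ultimately have 1: "even (?N (z (l + 1)))" by simp
  have "nat (l - 1) = Suc (nat (l - 2))" using Al by simp
  then have 2: "?N (z (l + 1)) = ?N' (z (l + 1)) + of_bool (crosses w (z (l + 1)) (z (l - 1)) (z l))"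
    using Al by (simp add: cnt_def)
  have 3: "even (?N' (z l) + ?N' (z (l + 1)) + of_bool (in_cone (z (l - 1)) w (z l) (z (l + 1))))"
    using path_parity[of "l - 1" l] Al by (simp add: algebra_simps)
  have 5: "?N' (z l) = 0" using low_cnt[OF l, of "nat (l - 2)"] Al by simp
  have 4: "even (of_bool (crosses w (z (l + 1)) (z (l - 1)) (z l)) + of_bool (in_cone (z (l - 1)) w (z l) (z (l + 1))) :: nat)"
    using 1 3 unfolding 2 5 by auto
  have c: "crosses w (z (l + 1)) (z (l - 1)) (z l) = crosses (z l) (z (l - 1)) w (z (l + 1))"
    using crosses_commute[of w "z (l + 1)" "z (l - 1)" "z l"] crosses_flip1[of "z l" "z (l - 1)"] by simp
  have e: "det3 (z l) w (z (l + 1)) = - d l (l + 1)" "det3 (z l) w (z (l - 1)) = - d l (l - 1)"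
    "det3 (z l) (z (l - 1)) (z (l + 1)) = - turn z l" "det3 w (z (l - 1)) (z (l + 1)) = d (l - 1) (l + 1)"
    unfolding d_def turn_def by (simp_all add: det3_expand algebra_simps)
  have nz: "d l (l + 1) \<noteq> 0" "d l (l - 1) \<noteq> 0" "d (l - 1) (l + 1) \<noteq> 0" by (rule d_nonzero; use Al in auto)+
  have t: "turn z l \<noteq> 0" by (rule turn_nonzero[OF z])
  have "(of_bool (in_cone (z (l - 1)) w (z l) (z (l + 1))) + of_bool (crosses (z l) (z (l - 1)) w (z (l + 1))) :: nat) =
    of_bool (sector (z l) (z (l - 1)) w (z (l + 1)))"
    by (rule sector_iff) (use nz t in \<open>simp_all add: e\<close>)
  then have "\<not> sector (z l) (z (l - 1)) w (z (l + 1))" using 4 unfolding c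
    by (cases "sector (z l) (z (l - 1)) w (z (l + 1))") (simp_all add: add.commute)
  then show ?thesis using low_neighbours[OF l] t unfolding sector_def e by auto
qed

text \<open>Otherwise the antipodal path starting at \<open>w\<close> is locally convex up to an
  edge where the polygon crosses the line of \<open>z 1\<close>. Its convex window starts at
  \<open>w\<close>, since \<open>f\<close> separates \<open>w\<close> from the rest; so the first
  two edges support the path, which contradicts the crossing of the arc from \<open>w\<close> to
  \<open>z 1\<close>.\<close>

lemma positive_before_low:
  assumes l: "low l" shows "\<exists>i. 1 \<le> i \<and> i \<le> l - 1 \<and> 0 < turn z i"
proof (rule ccontr)
  assume h: "\<not> ?thesis"
  have Al: "d 1 l < 0" "2 \<le> l" "l \<le> n - 2" using l unfolding low_def by auto
  have tn: "turn z i < 0" if "1 \<le> i" "i \<le> l - 1" for i using h that turn_nonzero[OF z, of i] by force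
  have "turn z 1 = - d 1 2" by (simp add: turn_def d_def w_def)
  then have "0 < d 1 2" using tn[of 1] Al by simp
  then obtain j where j: "2 \<le> j" "j < l" "(0 < d 1 j) \<noteq> (0 < d 1 (j + 1))"
    using sign_switch[of 2 l "\<lambda>i. 0 < d 1 i"] Al by auto
  define t where "t = nat j + 1"
  have t: "int t = j + 1" using j by (simp add: t_def)
  define V where "V = (\<lambda>i. - z (0 + int i))"
  have tl: "int t < n" using t j Al by simp
  have V0: "V 0 = w" "V 1 = - z 1" by (simp_all add: V_def w_def)
  have "\<exists>s e. 0 \<le> s \<and> s + 2 \<le> e \<and> e \<le> t \<and> positive_on V s e \<and>
    (\<forall>i. 0 \<le> i \<and> i \<le> t \<longrightarrow> V i \<in> convex_cone hull (V ` {s..e}))"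
  proof (rule convex_path_window)
    show "0 + 2 \<le> t" using j by (simp add: t_def)
    show "det3 (V i) (V k) (V m) \<noteq> 0" if "i < k" "k < m" "m \<le> t" for i k m
      unfolding V_def using window_conditions(1)[OF z tl that] .
    show "\<not> crosses (V i) (V (i + 1)) (V k) (V (k + 1))" if "i + 2 \<le> k" "k + 1 \<le> t" for i k
      unfolding V_def using window_conditions(2)[OF z tl that] .
    show "0 < det3 (V i) (V (i + 1)) (V (i + 2))" if "i + 2 \<le> t" for i
      using tn[of "int i + 1"] that t j by (simp add: V_def turn_def add.commute)
  qed
  then obtain s e where s: "s + 2 \<le> e" "e \<le> t" "positive_on V s e"
    and H: "\<And>i. i \<le> t \<Longrightarrow> V i \<in> convex_cone hull (V ` {s..e})" by blast
  have "s = 0"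
  proof (rule ccontr)
    assume s0: "s \<noteq> 0"
    have "0 \<le> - f \<bullet> V 0"
    proof (rule cone_hull_nonneg[OF _ H])
      fix x assume "x \<in> V ` {s..e}"
      then obtain i where i: "s \<le> i" "i \<le> e" "x = V i" by auto
      then show "0 \<le> - f \<bullet> x" using pos[of "int i"] s0 s tl by (simp add: V_def)
    qed simp
    then show False using fw unfolding V0 by simp
  qed
  note P = s(3)[unfolded positive_on_def \<open>s = 0\<close>, rule_format]
  \<comment> \<open>The sum of the two edge functionals at \<open>V 1\<close>: zero there, positive
    at \<open>w\<close>, nonnegative on the rest of the window.\<close>
  define g where "g = cross3 (V 0) (V 1) + cross3 (V 1) (V 2)"
  have g: "g \<bullet> x = det3 (V 0) (V 1) x + det3 (V 1) (V 2) x" for x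
    by (simp add: g_def inner_add_left det3_cross)
  have P2: "0 < det3 (V 0) (V 1) (V 2)" by (rule P) (use s \<open>s = 0\<close> in auto)
  then have g0: "0 < g \<bullet> V 0" unfolding g det3_rot[of "V 1" "V 2" "V 0"] by simp
  have "0 \<le> g \<bullet> V i" if "i \<le> e" for i
  proof -
    consider "i = 0" | "i = 1" | "i = 2" | "3 \<le> i" by linarith
    then show ?thesis
    proof cases
      case 3
      then show ?thesis using P2 unfolding g by simp
    next
      case 4
      then have "0 < det3 (V 0) (V 1) (V i)" "0 < det3 (V 1) (V 2) (V i)" by (auto intro!: P that)
      then show ?thesis unfolding g by linarith
    qed (use g0 in \<open>simp_all add: g\<close>)
  qed
  then have gn: "0 \<le> g \<bullet> V i" if "i \<le> t" for i
    by (intro cone_hull_nonneg[OF _ H[OF that]]) (use \<open>s = 0\<close> in auto)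
  have "crosses w (z 1) (z j) (z (j + 1))" by (rule crosses_a) (use j Al in auto)
  then obtain x y u v where c: "0 < x" "0 < y" "0 < u" "0 < v" "x *\<^sub>R w + y *\<^sub>R z 1 = u *\<^sub>R z j + v *\<^sub>R z (j + 1)"
    by (rule crossesE)
  have "x * (g \<bullet> w) + y * (g \<bullet> z 1) = u * (g \<bullet> z j) + v * (g \<bullet> z (j + 1))"
    using arg_cong[OF c(5), of "\<lambda>v. g \<bullet> v"] by (simp add: inner_add_right)
  moreover have "g \<bullet> z 1 = 0" using g[of "V 1"] unfolding V0 by simp
  moreover have "0 < x * (g \<bullet> w)" using c g0 unfolding V0 by simp
  moreover have "g \<bullet> z j \<le> 0" "g \<bullet> z (j + 1) \<le> 0"
    using gn[of "nat j"] gn[of t] j t by (simp_all add: V_def t_def add.commute)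
  then have "u * (g \<bullet> z j) \<le> 0" "v * (g \<bullet> z (j + 1)) \<le> 0" using c by (simp_all add: mult_nonneg_nonpos)
  ultimately show False by simp
qed

text \<open>Otherwise the path from \<open>w\<close> through \<open>- z l\<close> to
  \<open>- z m\<close> is locally convex and lies in an open half-space \<open>g\<close>. A crossing
  of the arc from \<open>w\<close> to \<open>z 1\<close> makes \<open>g\<close> negative at
  \<open>z 1\<close>. Now \<open>?c\<close> times \<open>w\<close> is a positive combination of
  \<open>z l\<close>, \<open>z 1\<close>, \<open>z m\<close>: \<open>f\<close> makes
  \<open>?c\<close> nonnegative, \<open>g\<close> makes it negative.\<close>

lemma positive_above_low:
  assumes l: "low l" and m: "l < m" "m \<le> n - 2" "0 < d 1 m" "d l m < 0"
  shows "\<exists>i. l + 1 \<le> i \<and> i \<le> m - 1 \<and> 0 < turn z i"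
proof (rule ccontr)
  assume h: "\<not> ?thesis"
  have Al: "d 1 l < 0" "2 \<le> l" "l \<le> n - 2" using l unfolding low_def by auto
  have tn: "turn z i < 0" if "l + 1 \<le> i" "i \<le> m - 1" for i using h that turn_nonzero[OF z, of i] by force
  define t where "t = nat (m - l) + 1"
  have t: "int t = m - l + 1" using m by (simp add: t_def)
  \<comment> \<open>Index 0 is \<open>w\<close> and index 1 is \<open>- z l\<close>: the arc from
    \<open>w\<close> replaces the part of the path before \<open>z l\<close>.\<close>
  define V where "V = (\<lambda>i. if i = 0 then w else - z ((l - 1) + int i))"
  have tl: "int t < n" using t m Al by simp
  have "\<exists>g. \<forall>i. 0 \<le> i \<and> i \<le> t \<longrightarrow> 0 < g \<bullet> V i"
  proof (rule convex_path_halfspace)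
    show "0 + 2 \<le> t" using t m by linarith
    show "det3 (V i) (V k) (V p) \<noteq> 0" if "i < k" "k < p" "p \<le> t" for i k p
    proof (cases "i = 0")
      case True
      have "d (l - 1 + int k) (l - 1 + int p) \<noteq> 0" by (rule d_nonzero) (use that Al m t in auto)
      then show ?thesis using True that by (simp add: V_def d_def)
    next
      case False
      then show ?thesis using window_conditions(1)[OF z tl that, of "l - 1"] that by (simp add: V_def)
    qed
    show "0 < det3 (V i) (V (i + 1)) (V (i + 2))" if "i + 2 \<le> t" for i
    proof (cases "i = 0")
      case True
      then show ?thesis using low_neighbours(1)[OF l] by (simp add: V_def d_def add.commute)
    next
      case False
      then show ?thesis using tn[of "l + int i"] that t by (simp add: V_def turn_def algebra_simps)
    qed
    show "\<not> crosses (V i) (V (i + 1)) (V k) (V (k + 1))" if "i + 2 \<le> k" "k + 1 \<le> t" for i k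
    proof (cases "i = 0")
      case True
      have "\<not> crosses (- w) (z l) (z (l - 1 + int k)) (z (l - 1 + int k + 1))"
        by (rule low_free(2)[OF l]) (use that Al m t True in auto)
      then have "\<not> crosses (- (- w)) (- z l) (- z (l - 1 + int k)) (- z (l - 1 + int k + 1))"
        unfolding crosses_minus .
      then show ?thesis using True that by (simp add: V_def algebra_simps)
    next
      case False
      then show ?thesis using window_conditions(2)[OF z tl that, of "l - 1"] that by (simp add: V_def)
    qed
  qed
  then obtain g where g: "\<And>i. i \<le> t \<Longrightarrow> 0 < g \<bullet> V i" by auto
  have gw: "0 < g \<bullet> w" using g[of 0] by (simp add: V_def)
  have gz: "g \<bullet> z i < 0" if "l \<le> i" "i \<le> m" for i
    using g[of "nat (i - l + 1)"] that t m by (simp add: V_def)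
  obtain j where j: "l \<le> j" "j < m" "(0 < d 1 j) \<noteq> (0 < d 1 (j + 1))"
    using sign_switch[of l m "\<lambda>i. 0 < d 1 i"] Al m by auto
  have "crosses w (z 1) (z j) (z (j + 1))" by (rule crosses_a) (use j Al m in auto)
  then obtain x y u v where c: "0 < x" "0 < y" "0 < u" "0 < v" "x *\<^sub>R w + y *\<^sub>R z 1 = u *\<^sub>R z j + v *\<^sub>R z (j + 1)"
    by (rule crossesE)
  have "x * (g \<bullet> w) + y * (g \<bullet> z 1) = u * (g \<bullet> z j) + v * (g \<bullet> z (j + 1))"
    using arg_cong[OF c(5), of "\<lambda>v. g \<bullet> v"] by (simp add: inner_add_right)
  moreover have "0 < x * (g \<bullet> w)" "u * (g \<bullet> z j) < 0" "v * (g \<bullet> z (j + 1)) < 0"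
    using c gw gz[of j] gz[of "j + 1"] j by (simp_all add: mult_pos_neg)
  ultimately have "y * (g \<bullet> z 1) < 0" by linarith
  then have ga: "g \<bullet> z 1 < 0" using c by (simp add: mult_less_0_iff)
  let ?c = "det3 (z l) (z 1) (z m)"
  have id: "?c *\<^sub>R w = d 1 m *\<^sub>R z l + (- d l m) *\<^sub>R z 1 + d l 1 *\<^sub>R z m"
    using det3_cramer[of "z l" "z 1" "z m" w] by (simp add: d_def algebra_simps)
  have I: "?c * (k \<bullet> w) = d 1 m * (k \<bullet> z l) + (- d l m) * (k \<bullet> z 1) + d l 1 * (k \<bullet> z m)" for k
    using arg_cong[OF id, of "\<lambda>v. k \<bullet> v"] by (simp add: inner_add_right inner_diff_right)
  have co: "0 < d 1 m" "0 < - d l m" "0 < d l 1" using m Al d_anti[of 1 l] by simp_all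
  have "0 \<le> d 1 m * (f \<bullet> z l)" "0 \<le> (- d l m) * (f \<bullet> z 1)" "0 \<le> d l 1 * (f \<bullet> z m)"
    by (rule mult_nonneg_nonneg; use co pos Al m in simp)+
  then have "0 \<le> ?c * (f \<bullet> w)" unfolding I by linarith
  then have "0 \<le> ?c" using fw by (simp add: zero_le_mult_iff)
  then have "0 \<le> ?c * (g \<bullet> w)" using gw by simp
  moreover have "d 1 m * (g \<bullet> z l) < 0" "(- d l m) * (g \<bullet> z 1) < 0" "d l 1 * (g \<bullet> z m) < 0"
    by (rule mult_pos_neg; use co ga gz m in simp)+
  ultimately show False using I[of g] by linarith
qed

section \<open>Mirror symmetry and the six sign changes\<close>

lemma mirror: "essential_vertex (\<lambda>i. - z (- i)) n (- f)"
proof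
  have per: "z (- i) = z (n - i)" for i using proj_polygonD(2)[OF z, of "- i"] by (simp add: add.commute)
  show "proj_polygon (\<lambda>i. - z (- i)) n" by (rule proj_polygon_flip[OF z])
  show "4 \<le> n" by (rule n)
  show "\<not> in_halfspace (\<lambda>i. - z (- i))"
  proof
    assume "in_halfspace (\<lambda>i. - z (- i))"
    then obtain g where g: "g \<noteq> 0" "\<And>i. 0 \<le> g \<bullet> - z (- i)" unfolding in_halfspace_def by blast
    have "0 \<le> - g \<bullet> z i" for i using g(2)[of "- i"] by simp
    then show False using bal g(1) unfolding in_halfspace_def by (metis neg_equal_0_iff_equal)
  qed
  show "0 \<le> - f \<bullet> - z (- i)" if "1 \<le> i" "i \<le> n - 1" for i
    using pos[of "n - i"] that unfolding per by simp
  show "- f \<bullet> - z (- 0) < 0" using neg by simp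
  have "det3 (z 0) (z (n - 1)) (z 1) = - det3 (z 0) (z 1) (z (n - 1))" by (rule det3_swap23)
  then show "0 < det3 (- (- z (- 0))) (- z (- 1)) (- z (- (n - 1)))"
    using orient per[of 1] per[of "n - 1"] by simp
qed

text \<open>The flip exchanges \<open>z 1\<close> with \<open>z (n - 1)\<close> and replaces
  \<open>w\<close> by \<open>- w\<close>. A low vertex \<open>l\<close> of the flipped polygon
  becomes \<open>n - l\<close>, with everything proved about it.\<close>

lemma exists_high: "\<exists>m. 2 \<le> m \<and> m \<le> n - 2 \<and> 0 < d (n - 1) m \<and>
    (\<forall>i. 1 \<le> i \<and> i \<le> n - 1 \<and> i \<noteq> m \<and> 0 < d (n - 1) i \<longrightarrow> 0 < d i m) \<and>
    (\<forall>j. 1 \<le> j \<and> j \<le> n - 2 \<and> j \<noteq> m - 1 \<and> j \<noteq> m \<longrightarrow> \<not> in_cone (z m) w (z j) (z (j + 1))) \<and>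
    turn z m < 0 \<and> (\<exists>i. m + 1 \<le> i \<and> i \<le> n - 1 \<and> 0 < turn z i)"
proof -
  interpret M: essential_vertex "\<lambda>i. - z (- i)" n "- f" by (rule mirror)
  have per: "z (- i) = z (n - i)" for i using proj_polygonD(2)[OF z, of "- i"] by (simp add: add.commute)
  have Mw: "M.w = - w" by (simp add: M.w_def w_def)
  have Md: "M.d i j = - d (n - i) (n - j)" for i j
    by (simp add: M.d_def Mw d_def per[of i] per[of j])
  have T: "turn (\<lambda>i. - z (- i)) i = turn z (n - i)" for i
    using det3_swap13[of "z (n - (i - 1))" "z (n - i)" "z (n - (i + 1))"] unfolding turn_def per by (simp add: algebra_simps)
  obtain l where l: "M.low l" using M.exists_low by blast
  note L = l[unfolded M.low_def Md]
  show ?thesis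
  proof (rule exI[of _ "n - l"], intro conjI allI impI)
    show "2 \<le> n - l" "n - l \<le> n - 2" "0 < d (n - 1) (n - l)" using L by simp_all
    show "0 < d i (n - l)" if "1 \<le> i \<and> i \<le> n - 1 \<and> i \<noteq> n - l \<and> 0 < d (n - 1) i" for i
    proof -
      have "d (n - 1) (n - (n - i)) = d (n - 1) i" "d (n - l) (n - (n - i)) = d (n - l) i" by simp_all
      moreover have "0 < - d (n - l) (n - (n - i))"
        using L that by (intro L[THEN conjunct2, THEN conjunct2, THEN conjunct2, rule_format]) auto
      ultimately show ?thesis using d_anti[of i "n - l"] by simp
    qed
    show "\<not> in_cone (z (n - l)) w (z j) (z (j + 1))" if "1 \<le> j \<and> j \<le> n - 2 \<and> j \<noteq> n - l - 1 \<and> j \<noteq> n - l" for j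
    proof -
      have "\<not> in_cone (z (n - l)) w (z (n - (n - 1 - j))) (z (n - (n - 1 - j + 1)))"
        using M.low_free(3)[OF l, of "n - 1 - j", unfolded Mw, unfolded per in_cone_minus] that by auto
      then show ?thesis unfolding in_cone_swap[of _ _ "z (n - (n - 1 - j))"] by (simp add: add.commute)
    qed
    show "turn z (n - l) < 0" using M.turn_low[OF l] unfolding T .
    obtain i where i: "1 \<le> i" "i \<le> l - 1" "0 < turn z (n - i)" using M.positive_before_low[OF l] unfolding T by blast
    show "\<exists>i. n - l + 1 \<le> i \<and> i \<le> n - 1 \<and> 0 < turn z i" by (rule exI[of _ "n - i"]) (use i in simp)
  qed
qed

lemma six_sign_changes: "6 \<le> sign_changes z n"
proof -
  obtain l where l: "low l" using exists_low by blast
  have Al: "d 1 l < 0" "2 \<le> l" "l \<le> n - 2" using l unfolding low_def by auto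
  have Bl: "d (n - 1) l < 0" using no_opposite[of l] Al by simp
  obtain m where m: "2 \<le> m" "m \<le> n - 2" and Bm: "0 < d (n - 1) m"
    and up: "\<And>i. 1 \<le> i \<Longrightarrow> i \<le> n - 1 \<Longrightarrow> i \<noteq> m \<Longrightarrow> 0 < d (n - 1) i \<Longrightarrow> 0 < d i m"
    and emp: "\<And>j. 1 \<le> j \<Longrightarrow> j \<le> n - 2 \<Longrightarrow> j \<noteq> m - 1 \<Longrightarrow> j \<noteq> m \<Longrightarrow> \<not> in_cone (z m) w (z j) (z (j + 1))"
    and tm: "turn z m < 0" "\<exists>i. m + 1 \<le> i \<and> i \<le> n - 1 \<and> 0 < turn z i"
    using exists_high by blast
  have A: "0 < d 1 i" if "1 \<le> i" "i \<le> n - 1" "0 < d (n - 1) i" for i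
  proof -
    have "i \<noteq> 1" using that d_anti[of 1 "n - 1"] orient' by auto
    then have "d 1 i \<noteq> 0" by (intro d_nonzero) (use that in auto)
    then show ?thesis using no_opposite[of i] that by linarith
  qed
  have Am: "0 < d 1 m" using A[of m] m Bm by simp
  \<comment> \<open>\<open>low_exists_up\<close> gives a vertex above the line of
    \<open>z (n - 1)\<close> and clockwise from \<open>z l\<close>. The extreme vertex
    \<open>z m\<close> is counterclockwise from it, and the three-term relation with
    \<open>z 1\<close> transfers the sign.\<close>
  have dlm: "d l m < 0"
  proof -
    obtain i where i: "1 \<le> i" "i \<le> n - 1" "0 < d (n - 1) i" "d l i < 0" using low_exists_up[OF l] by blast
    show ?thesis
    proof (cases "i = m")
      case False
      have e: "d l i * d 1 m = d l 1 * d i m - d l m * d i 1" by (rule d_pluecker)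
      have "d l i * d 1 m < 0" "0 < d l 1 * d i m"
        using i Am Al up[of i] False d_anti[of 1 l] by (simp_all add: mult_neg_pos mult_neg_neg)
      then have "0 < d l m * d i 1" using e by linarith
      moreover have "d i 1 < 0" using A[of i] i d_anti[of 1 i] by simp
      ultimately show ?thesis by (simp add: zero_less_mult_iff)
    qed (use i in simp)
  qed
  \<comment> \<open>If \<open>z m\<close> came first, the path from \<open>z 1\<close> to
    \<open>z m\<close> would meet the arcs from \<open>w\<close> to \<open>z l\<close> and to
    \<open>z (n - 1)\<close> with equal parity; but the first count is zero and the second
    odd.\<close>
  have lm: "l < m"
  proof (rule ccontr)
    assume "\<not> l < m"
    then have ml: "m < l" using Bl Bm by (cases "l = m") auto
    have "even (cnt z 1 (nat (m - 1)) w (z l) + cnt z 1 (nat (m - 1)) w (z (n - 1)))"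
      by (rule path_const) (use ml m Al emp in auto)
    moreover have "cnt z 1 (nat (m - 1)) w (z l) = 0" using low_cnt[OF l, of "nat (m - 1)"] ml m by simp
    moreover have "odd (cnt z 1 (nat (m - 1)) w (z (n - 1)))" using cnt_b_parity[of "nat (m - 1)"] m Bm by simp
    ultimately show False by simp
  qed
  obtain i1 where i1: "1 \<le> i1" "i1 \<le> l - 1" "0 < turn z i1" using positive_before_low[OF l] by blast
  obtain i2 where i2: "l + 1 \<le> i2" "i2 \<le> m - 1" "0 < turn z i2"
    using positive_above_low[OF l lm m(2) Am dlm] by blast
  obtain i3 where i3: "m + 1 \<le> i3" "i3 \<le> n - 1" "0 < turn z i3" using tm(2) by blast
  let ?Q = "\<lambda>k. (0 < turn z k) \<noteq> (0 < turn z (k + 1))"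
  have t0: "\<not> 0 < turn z 0" "\<not> 0 < turn z n"
  proof -
    have "turn z 0 = det3 (z (n - 1)) (z 0) (z 1)" using proj_polygonD(2)[OF z, of "- 1"] by (simp add: turn_def)
    also have "\<dots> = det3 (z 0) (z 1) (z (n - 1))" by (rule det3_rot')
    finally show "\<not> 0 < turn z 0" using orient by simp
    then show "\<not> 0 < turn z n" using turn_per[of z n 0, OF proj_polygonD(2)[OF z]] by simp
  qed
  have sw: "\<exists>k. p \<le> k \<and> k < q \<and> ?Q k" if "p \<le> q" "(0 < turn z p) \<noteq> (0 < turn z q)" for p q
    using sign_switch[OF that(1), of "\<lambda>i. 0 < turn z i"] that(2) by blast
  have tl: "\<not> 0 < turn z l" "\<not> 0 < turn z m" using turn_low[OF l] tm(1) by simp_all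
  \<comment> \<open>The turns are negative at \<open>0\<close>, \<open>l\<close>, \<open>m\<close>,
    \<open>n\<close> and positive at \<open>i1\<close>, \<open>i2\<close>, \<open>i3\<close> between
    them, so each of six disjoint intervals contains a change.\<close>
  obtain k1 where k1: "0 \<le> k1" "k1 < i1" "?Q k1" using sw[of 0 i1] i1 t0 by auto
  obtain k2 where k2: "i1 \<le> k2" "k2 < l" "?Q k2" using sw[of i1 l] i1 tl by auto
  obtain k3 where k3: "l \<le> k3" "k3 < i2" "?Q k3" using sw[of l i2] i2 tl by auto
  obtain k4 where k4: "i2 \<le> k4" "k4 < m" "?Q k4" using sw[of i2 m] i2 tl by auto
  obtain k5 where k5: "m \<le> k5" "k5 < i3" "?Q k5" using sw[of m i3] i3 tl by auto
  obtain k6 where k6: "i3 \<le> k6" "k6 < n" "?Q k6" using sw[of i3 n] i3 t0 by auto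
  have dist: "distinct [k1, k2, k3, k4, k5, k6]" using k1 k2 k3 k4 k5 k6 by auto
  have "(\<Sum>k\<in>{k1, k2, k3, k4, k5, k6}. of_bool (?Q k) :: nat) = 6"
    using dist k1(3) k2(3) k3(3) k4(3) k5(3) k6(3) by simp
  moreover have "(\<Sum>k\<in>{k1, k2, k3, k4, k5, k6}. of_bool (?Q k) :: nat) \<le> sign_changes z n"
    unfolding sign_changes_def by (rule sum_mono2) (use k1 k2 k3 k4 k5 k6 i1 i2 i3 in auto)
  ultimately show ?thesis by simp
qed

end

subsection \<open>From spherical polygons to cones\<close>

text \<open>The antipodal map reverses the corner at \<open>z 0\<close> and preserves the number of
  sign changes, which yields the orientation required by \<open>essential_vertex\<close>.\<close>

lemma essential_vertex_sign_changes:
  assumes z: "proj_polygon z n" and n: "4 \<le> n" and bal: "\<not> in_halfspace z"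
    and f: "f \<noteq> 0" "\<And>i. 1 \<le> i \<Longrightarrow> i \<le> n - 1 \<Longrightarrow> 0 \<le> f \<bullet> z i"
  shows "6 \<le> sign_changes z n"
proof -
  have neg: "f \<bullet> z 0 < 0"
  proof (rule ccontr)
    assume "\<not> f \<bullet> z 0 < 0"
    moreover have "0 \<le> i mod n \<and> i mod n \<le> n - 1" for i using n pos_mod_bound[of n i] by auto
    ultimately have "0 \<le> f \<bullet> z (i mod n)" for i using f(2)[of "i mod n"] by (smt (verit))
    then have "0 \<le> f \<bullet> z i" for i using periodic_mod[of z n i, OF proj_polygonD(2)[OF z]] by metis
    then show False using bal f(1) unfolding in_halfspace_def by blast
  qed
  have "det3 (z 0) (z 1) (z (n - 1)) \<noteq> 0" by (rule proj_polygonD(3)[OF z]) (use n in auto)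
  then consider "det3 (z 0) (z 1) (z (n - 1)) < 0" | "0 < det3 (z 0) (z 1) (z (n - 1))" by linarith
  then show ?thesis
  proof cases
    case 1
    have "essential_vertex z n f" by unfold_locales (use z n bal f neg 1 in auto)
    then show ?thesis by (rule essential_vertex.six_sign_changes)
  next
    case 2
    have "essential_vertex (\<lambda>i. - z i) n (- f)"
      by unfold_locales (use proj_polygon_minus[OF z] n bal f neg 2 in \<open>auto simp: in_halfspace_minus\<close>)
    then show ?thesis unfolding sign_changes_minus[OF z, symmetric] by (rule essential_vertex.six_sign_changes)
  qed
qed

text \<open>Three independent vectors lie on a plane that misses the origin. Its normal
  \<open>g\<close> has the value \<open>?D\<close> at all three, and the factor \<open>?D\<close>
  makes it positive.\<close>

lemma quadrilateral_vertex_essential: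
  assumes n: "n = 4" and z: "proj_polygon z n"
  shows "\<exists>f. f \<noteq> 0 \<and> (\<forall>i. 1 \<le> i \<and> i \<le> n - 1 \<longrightarrow> 0 \<le> f \<bullet> z i)"
proof -
  let ?D = "det3 (z 1) (z 2) (z 3)"
  have D: "?D \<noteq> 0" by (rule proj_polygonD(3)[OF z]) (use n in auto)
  define g where "g = cross3 (z 2) (z 3) + cross3 (z 3) (z 1) + cross3 (z 1) (z 2)"
  have g: "g \<bullet> x = det3 (z 2) (z 3) x + det3 (z 3) (z 1) x + det3 (z 1) (z 2) x" for x
    by (simp add: g_def inner_add_left det3_cross)
  have v: "g \<bullet> z 1 = ?D" "g \<bullet> z 2 = ?D" "g \<bullet> z 3 = ?D"
    unfolding g by (simp_all add: det3_expand algebra_simps)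
  have c: "i = 1 \<or> i = 2 \<or> i = 3" if "1 \<le> i" "i \<le> n - 1" for i using that n by auto
  have "(?D *\<^sub>R g) \<noteq> 0" using D v(1) by auto
  moreover have "0 \<le> (?D *\<^sub>R g) \<bullet> z i" if "1 \<le> i" "i \<le> n - 1" for i
    using c[OF that] v by (elim disjE) simp_all
  ultimately show ?thesis by blast
qed

text \<open>The bound is 4, not 6, because deleting ears may lead below six vertices; at four
  vertices the first case always applies.\<close>

lemma balanced_sign_changes:
  assumes "proj_polygon z n" "4 \<le> n" "\<not> in_halfspace z"
  shows "6 \<le> sign_changes z n"
  using assms
proof (induction "nat n" arbitrary: z n rule: less_induct)
  case less
  note z = less.prems(1) and n = less.prems(2) and bal = less.prems(3)
  note per = proj_polygonD(2)[OF z]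
  show ?case
  proof (cases "\<exists>t f. f \<noteq> 0 \<and> (\<forall>i. 1 \<le> i \<and> i \<le> n - 1 \<longrightarrow> 0 \<le> f \<bullet> z (i + t))")
    case True
    then obtain t f where f: "f \<noteq> 0" "\<And>i. 1 \<le> i \<Longrightarrow> i \<le> n - 1 \<Longrightarrow> 0 \<le> f \<bullet> z (i + t)" by blast
    have "6 \<le> sign_changes (\<lambda>i. z (i + t)) n"
      by (rule essential_vertex_sign_changes[OF proj_polygon_shift[OF z] n _ f])
        (use bal in \<open>simp_all add: in_halfspace_shift\<close>)
    then show ?thesis using sign_changes_shift[of z n t, OF per] n by simp
  next
    case False
    have n5: "5 \<le> n"
    proof (rule ccontr)
      assume "\<not> 5 \<le> n"
      then have "n = 4" using n by simp
      then have "\<exists>f. f \<noteq> 0 \<and> (\<forall>i. 1 \<le> i \<and> i \<le> n - 1 \<longrightarrow> 0 \<le> f \<bullet> z (i + 0))" using quadrilateral_vertex_essential[OF _ z] by simp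
      then show False using False by blast
    qed
    obtain t where t: "ear z n t" using ear_exists[OF z bal] by blast
    define y where "y = (\<lambda>i. z (i + (t + 1 - n)))"
    have y: "proj_polygon y n" unfolding y_def by (rule proj_polygon_shift[OF z])
    have e: "ear y n (n - 1)" using t unfolding y_def ear_shift by simp
    let ?x = "\<lambda>i. y (i mod (n - 1))"
    note del = delete_vertex[OF y n e]
    have "\<not> in_halfspace ?x"
    proof
      assume "in_halfspace ?x"
      then obtain f where f: "f \<noteq> 0" "\<And>i. 0 \<le> f \<bullet> ?x i" unfolding in_halfspace_def by blast
      have "0 \<le> f \<bullet> z (i + t)" if "1 \<le> i" "i \<le> n - 1" for i
      proof -
        have m: "(i - 1) mod (n - 1) = i - 1" and e: "i - 1 + (t + 1 - n) = i + t - n" using that by simp_all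
        have "0 \<le> f \<bullet> z (i + t - n)" using f(2)[of "i - 1"] unfolding m y_def e .
        then show ?thesis using per[of "i + t - n"] by simp
      qed
      then show False using False f(1) by blast
    qed
    then have "6 \<le> sign_changes ?x (n - 1)" using less.hyps[of "n - 1" ?x] del(1) n5 by simp
    also have "\<dots> \<le> sign_changes y n" by (rule del(2))
    also have "\<dots> = sign_changes z n" unfolding y_def using sign_changes_shift[of z n "t + 1 - n", OF per] n by simp
    finally show ?thesis .
  qed
qed

section \<open>Arcs, edges and inflections of the given polygon\<close>

lemma crosses_sph_arc: "crosses a b c d \<Longrightarrow> sph_arc a b \<inter> sph_arc c d \<noteq> {}"
proof -
  have arc: "sgn (x *\<^sub>R a + y *\<^sub>R b) \<in> sph_arc a b" if "0 < x" "0 < y" for x y and a b :: "real^3"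
  proof -
    have p: "0 < x + y" using that by simp
    \<comment> \<open>Division by \<open>x + y\<close> moves the positive combination onto the
      chord; \<open>sgn\<close> ignores the factor.\<close>
    have "(1 - y / (x + y)) *\<^sub>R a + (y / (x + y)) *\<^sub>R b = (1 / (x + y)) *\<^sub>R (x *\<^sub>R a + y *\<^sub>R b)"
      using p by (simp add: scaleR_add_right diff_divide_eq_iff)
    moreover have "sgn ((1 / (x + y)) *\<^sub>R (x *\<^sub>R a + y *\<^sub>R b)) = sgn (x *\<^sub>R a + y *\<^sub>R b)"
      unfolding sgn_scaleR using p by simp
    ultimately show ?thesis unfolding sph_arc_def using that p
      by (intro CollectI bexI[of _ "y / (x + y)"]) auto
  qed
  assume "crosses a b c d"
  then obtain x y u v where "0 < x" "0 < y" "0 < u" "0 < v" "x *\<^sub>R a + y *\<^sub>R b = u *\<^sub>R c + v *\<^sub>R d"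
    by (rule crossesE)
  then show ?thesis using arc[of x y a b] arc[of u v c d] by auto
qed

lemma sph_arc_minus: "sph_arc (- a) (- b) = uminus ` sph_arc a b"
proof -
  have "(1 - t) *\<^sub>R (- a) + t *\<^sub>R (- b) = - ((1 - t) *\<^sub>R a + t *\<^sub>R b)" for t by simp
  then have "sgn ((1 - t) *\<^sub>R (- a) + t *\<^sub>R (- b)) = - sgn ((1 - t) *\<^sub>R a + t *\<^sub>R b)" for t
    by (simp only: sgn_minus)
  then show ?thesis unfolding sph_arc_def by auto
qed

lemma vtx_mod: "0 < n \<Longrightarrow> vtx u n k = u (nat (int k mod int n))"
  by (simp add: vtx_def nat_mod_distrib)

lemma num_inflections_eq:
  assumes n: "4 \<le> n" and z: "proj_polygon (\<lambda>i. u (nat (i mod int n))) (int n)"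
  shows "num_inflections u n = sign_changes (\<lambda>i. u (nat (i mod int n))) (int n)"
proof -
  let ?z = "\<lambda>i. u (nat (i mod int n))"
  have v: "vtx u n k = ?z (int k)" for k using n by (intro vtx_mod) simp
  have per: "?z (i + int n) = ?z i" for i by simp
  have "inflection u n i \<longleftrightarrow> (0 < turn ?z (int i)) \<noteq> (0 < turn ?z (int i + 1))" for i
  proof -
    have i1: "int (i + n - 1) = (int i - 1) + int n" using n by simp
    have "det3 (vtx u n (i + n - 1)) (vtx u n i) (vtx u n (i + 1)) = turn ?z (int i)"
      unfolding v i1 per turn_def by (simp add: add.commute)
    moreover have "det3 (vtx u n i) (vtx u n (i + 1)) (vtx u n (i + 2)) = turn ?z (int i + 1)"
      unfolding v turn_def by (simp add: add.commute)
    ultimately show ?thesis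
      using turn_nonzero[OF z, of "int i"] turn_nonzero[OF z, of "int i + 1"] unfolding inflection_def Let_def by auto
  qed
  note infl = this
  have "sign_changes ?z (int n) = (\<Sum>i<n. of_bool ((0 < turn ?z (int i)) \<noteq> (0 < turn ?z (int i + 1))))"
    unfolding sign_changes_def
    by (rule sum.reindex_bij_witness[of _ int nat]) auto
  also have "\<dots> = (\<Sum>i<n. if inflection u n i then 1 else 0)" by (rule sum.cong) (auto simp: infl)
  also have "\<dots> = card {i. i < n \<and> inflection u n i}" by (subst sum.If_cases) (simp_all add: Collect_conj_eq lessThan_def Int_commute)
  finally show ?thesis unfolding num_inflections_def by simp
qed

lemma proj_polygon_of_spherical:
  assumes n: "4 \<le> n" and gp: "general_position u n"
    and si: "\<not> has_self_intersection u n" and ai: "\<not> has_antipodal_intersection u n"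
  shows "proj_polygon (\<lambda>i. u (nat (i mod int n))) (int n)"
proof (rule proj_polygonI)
  show "3 \<le> int n" using n by simp
  show "det3 (u (nat a)) (u (nat b)) (u (nat c)) \<noteq> 0" if "{a, b, c} \<subseteq> {0..<int n}" "distinct [a, b, c]" for a b c
  proof -
    have "nat a < n" "nat b < n" "nat c < n" "nat a \<noteq> nat b" "nat b \<noteq> nat c" "nat a \<noteq> nat c" using that by auto
    then show ?thesis using gp unfolding general_position_def by blast
  qed
  fix a b assume ab: "{a, b} \<subseteq> {0..<int n}" "a \<noteq> b" "(a + 1) mod int n \<noteq> b" "(b + 1) mod int n \<noteq> a"
  obtain i j where ij: "a = int i" "b = int j" using ab(1) by (auto elim!: nonneg_int_cases)
  have e: "(int k + 1) mod int n = int ((k + 1) mod n)" for k by (simp add: zmod_int add.commute)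
  have na: "nonadjacent n i j" using ab unfolding ij e nonadjacent_def by auto
  have ed: "edge u n k = sph_arc (u k) (u ((k + 1) mod n))" if "k < n" for k
    using that by (simp add: edge_def vtx_def)
  have lt: "i < n" "j < n" using ab(1) ij by auto
  have "edge u n i \<inter> edge u n j = {}" "edge u n i \<inter> uminus ` edge u n j = {}"
    using si ai na unfolding has_self_intersection_def has_antipodal_intersection_def by blast+
  then show "\<not> crosses (u (nat a)) (u (nat ((a + 1) mod int n))) (u (nat b)) (u (nat ((b + 1) mod int n))) \<and>
    \<not> crosses (u (nat a)) (u (nat ((a + 1) mod int n))) (- u (nat b)) (- u (nat ((b + 1) mod int n)))"
    unfolding ij e nat_int ed[OF lt(1)] ed[OF lt(2)] sph_arc_minus[symmetric] using crosses_sph_arc by blast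
qed

theorem theorem9:
  fixes u :: "nat \<Rightarrow> real^3" and n :: nat
  assumes "n \<ge> 6"
    and "spherical_polygon u n"
    and "general_position u n"
    and "balanced u n"
    and "\<not> has_self_intersection u n"
    and "\<not> has_antipodal_intersection u n"
  shows "num_inflections u n \<ge> 6"
proof -
  let ?z = "\<lambda>i. u (nat (i mod int n))"
  have n: "4 \<le> n" using assms(1) by simp
  have z: "proj_polygon ?z (int n)" using n assms(3,5,6) by (rule proj_polygon_of_spherical)
  have "\<not> in_halfspace ?z"
  proof
    assume "in_halfspace ?z"
    then obtain f where f: "f \<noteq> 0" "\<And>i. 0 \<le> f \<bullet> ?z i" unfolding in_halfspace_def by blast
    have "0 \<le> f \<bullet> u i" if "i < n" for i using f(2)[of "int i"] that by simp
    then show False using assms(4) f(1) unfolding balanced_def by blast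
  qed
  then show ?thesis using balanced_sign_changes[OF z] n num_inflections_eq[OF n z] by simp
qed

end
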